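(* Let $G$ be a finite group with $Z_\infty(G)=1$. If $\Gamma_2(G)$ is not strongly connected, then $G$ is either almost simple or a Frobenius group.
   Context: $Z_\infty(G)$ denotes the hypercenter of $G$. Commutators: $[a,b]=a^{-1}b^{-1}ab$, $[x,{}_2y]=[[x,y],y]$. Let $I_{r,2}(G)=\{g\in G\mid [g,{}_2x]=1 \text{ for all } x\in G\}$ and $I_{l,2}(G)=\{g\in G\mid [x,{}_2g]=1\text{ for all }x\in G\}$. The directed graph $\Gamma_2(G)$ has vertex set $G\setminus (I_{r,2}(G)\cap I_{l,2}(G))$ and an edge $x\mapsto y$ if and only if $[x,{}_2y]=1$. A directed graph is strongly connected if for every pair of vertices $(x,y)$ it contains a directed path from $x$ to $y$ (the empty graph is regarded as strongly connected). *)

theory Defs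
  imports "HOL-Algebra.Algebra" "Graph_Theory.Digraph_Component"
begin

definition commutator :: "('a, 'b) monoid_scheme \<Rightarrow> 'a \<Rightarrow> 'a \<Rightarrow> 'a" where
  "commutator G a b = inv\<^bsub>G\<^esub> a \<otimes>\<^bsub>G\<^esub> inv\<^bsub>G\<^esub> b \<otimes>\<^bsub>G\<^esub> a \<otimes>\<^bsub>G\<^esub> b"

(* engel2 G x y is [x, y, y] = [[x, y], y]. *)
definition engel2 :: "('a, 'b) monoid_scheme \<Rightarrow> 'a \<Rightarrow> 'a \<Rightarrow> 'a" where
  "engel2 G x y = commutator G (commutator G x y) y"

primrec upper_central :: "('a, 'b) monoid_scheme \<Rightarrow> nat \<Rightarrow> 'a set" where
  "upper_central G 0 = {\<one>\<^bsub>G\<^esub>}"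
| "upper_central G (Suc n) =
     {x \<in> carrier G. \<forall>y \<in> carrier G. commutator G x y \<in> upper_central G n}"

(* The hypercenter is the limit of the upper central series.  The union over the
   natural numbers is this limit for finite groups; for infinite groups the series
   may have to be continued transfinitely. *)
definition hypercenter :: "('a, 'b) monoid_scheme \<Rightarrow> 'a set" where
  "hypercenter G = (\<Union>n. upper_central G n)"

(* I_{r,2}(G) *)
definition right_engel2 :: "('a, 'b) monoid_scheme \<Rightarrow> 'a set" where
  "right_engel2 G = {g \<in> carrier G. \<forall>x \<in> carrier G. engel2 G g x = \<one>\<^bsub>G\<^esub>}"

(* I_{l,2}(G) *)
definition left_engel2 :: "('a, 'b) monoid_scheme \<Rightarrow> 'a set" where
  "left_engel2 G = {g \<in> carrier G. \<forall>x \<in> carrier G. engel2 G x g = \<one>\<^bsub>G\<^esub>}"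

definition engel2_verts :: "('a, 'b) monoid_scheme \<Rightarrow> 'a set" where
  "engel2_verts G = carrier G - (right_engel2 G \<inter> left_engel2 G)"

(* The digraph Gamma_2(G), arcs being ordered pairs of vertices.  Every vertex carries
   a loop; loops are irrelevant to connectivity. *)
definition engel2_digraph :: "('a, 'b) monoid_scheme \<Rightarrow> ('a, 'a \<times> 'a) pre_digraph" where
  "engel2_digraph G =
     \<lparr>verts = engel2_verts G,
      arcs = {(x, y). x \<in> engel2_verts G \<and> y \<in> engel2_verts G \<and> engel2 G x y = \<one>\<^bsub>G\<^esub>},
      tail = fst,
      head = snd\<rparr>"

(* strongly_connected requires a nonempty vertex set; here the empty digraph
   counts as strongly connected. *)
definition strongly_connected_or_empty :: "('a, 'b) pre_digraph \<Rightarrow> bool" where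
  "strongly_connected_or_empty D \<longleftrightarrow> verts D = {} \<or> strongly_connected D"

(* Inner automorphisms as elements of AutoGroup, whose carrier consists of functions
   that are undefined outside the carrier of the group. *)
definition inner_autos :: "('a, 'b) monoid_scheme \<Rightarrow> ('a \<Rightarrow> 'a) set" where
  "inner_autos S = (\<lambda>g. \<lambda>x \<in> carrier S. g \<otimes>\<^bsub>S\<^esub> x \<otimes>\<^bsub>S\<^esub> inv\<^bsub>S\<^esub> g) ` carrier S"

(* Inn(S) \<le> G \<le> Aut(S) up to isomorphism, for some nonabelian simple S.  Taking S
   over the element type of G is no restriction, since S embeds into G. *)
definition almost_simple :: "('a, 'b) monoid_scheme \<Rightarrow> bool" where
  "almost_simple G \<longleftrightarrow>
     (\<exists>(S :: 'a monoid) A. simple_group S \<and> \<not> comm_group S \<and>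
        subgroup A (AutoGroup S) \<and> inner_autos S \<subseteq> A \<and>
        G \<cong> (AutoGroup S)\<lparr>carrier := A\<rparr>)"

(* H is a Frobenius complement: a nontrivial proper subgroup that meets each conjugate
   by an element outside H trivially. *)
definition frobenius_complement :: "('a, 'b) monoid_scheme \<Rightarrow> 'a set \<Rightarrow> bool" where
  "frobenius_complement G H \<longleftrightarrow>
     subgroup H G \<and> H \<noteq> {\<one>\<^bsub>G\<^esub>} \<and> H \<noteq> carrier G \<and>
     (\<forall>g \<in> carrier G - H. H \<inter> ((g <#\<^bsub>G\<^esub> H) #>\<^bsub>G\<^esub> inv\<^bsub>G\<^esub> g) = {\<one>\<^bsub>G\<^esub>})"

definition frobenius_group :: "('a, 'b) monoid_scheme \<Rightarrow> bool" where
  "frobenius_group G \<longleftrightarrow> group G \<and> (\<exists>H. frobenius_complement G H)"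

end

theory Submission
  imports Defs "HOL-Number_Theory.Number_Theory"
begin

text \<open>
  There is an edge from \<open>x\<close> to \<open>y\<close> iff \<open>y\<close> commutes with its conjugate by \<open>x\<close>; in particular
  commuting elements are joined in both directions.  Suppose that the nontrivial elements of a normal
  subgroup \<open>A\<close> lie in one strong component.  Every vertex reaches \<open>A\<close>: a suitable power of prime
  order either centralizes a nontrivial element of \<open>A\<close> or normalizes a Sylow subgroup of \<open>A\<close>, and
  then it has an edge to the centre of that subgroup.  So if the graph is not strongly connected,
  the set \<open>U\<close> of vertices that \<open>A\<close> does not reach is nonempty.  It consists of the nontrivial
  \<open>\<pi>\<close>-elements for a set \<open>\<pi>\<close> of primes, and they act freely on \<open>A\<close>.  If \<open>2 \<in> \<pi>\<close>, an involution
  of \<open>U\<close> inverts \<open>A\<close> and its centralizer is a Frobenius complement.  Otherwise the Sylow subgroups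
  for the primes in \<open>\<pi>\<close> are cyclic, and Burnside's transfer argument, applied to the smallest
  prime, shows that the elements outside \<open>U\<close> form a normal subgroup; by the Frattini argument the
  normalizer of a Sylow subgroup is a Frobenius complement.

  A minimal normal subgroup \<open>N\<close> is such an \<open>A\<close> if its centralizer is nontrivial or if it is a proper
  product of commuting subgroups.  In the remaining case \<open>N\<close> is nonabelian simple with trivial
  centralizer, and \<open>G\<close> is almost simple.
\<close>

text \<open>Away from commuting pairs an edge may have no reverse, so reachability is directed. What
  makes \<open>U\<close> tractable is that it is closed under predecessors: a vertex with an edge
  into \<open>U\<close> lies in \<open>U\<close>. Hence a nontrivial element of \<open>A\<close>
  cannot commute with an element of \<open>U\<close>, which is the freeness of the action, and every
  nontrivial element normalizing an abelian subgroup that meets \<open>U\<close> lies in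
  \<open>U\<close>. So the orders of such normalizers involve only primes of \<pi>, and the smallest
  prime of \<pi> can play the part that the smallest prime divisor of the group order has in
  Burnside's argument. The hypothesis on the hypercenter identifies the vertices with the nontrivial
  elements: a nontrivial element that is both left and right 2-Engel would produce a nontrivial
  central element.\<close>

hide_const (open) Divisibility.prime

section \<open>Actions of \<open>p\<close>-groups\<close>

text \<open>\<open>group_action\<close> asks for permutations of \<open>S\<close> that are
  \<open>undefined\<close> outside \<open>S\<close>, whereas conjugation and translation are total
  functions. The action of \<open>inv g\<close> witnesses bijectivity.\<close>

lemma group_action_restrict:
  fixes P (structure)
  assumes "group P"
    and cl: "\<And>g s. g \<in> carrier P \<Longrightarrow> s \<in> S \<Longrightarrow> act g s \<in> S"
    and one: "\<And>s. s \<in> S \<Longrightarrow> act \<one> s = s"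
    and mult: "\<And>g h s. g \<in> carrier P \<Longrightarrow> h \<in> carrier P \<Longrightarrow> s \<in> S \<Longrightarrow>
      act (g \<otimes> h) s = act g (act h s)"
  shows "group_action P S (\<lambda>g. restrict (act g) S)"
proof -
  interpret P: group P by fact
  define \<phi> where "\<phi> g = restrict (act g) S" for g
  have bij: "bij_betw (\<phi> g) S S" if g: "g \<in> carrier P" for g
  proof (rule bij_betw_byWitness[where f' = "\<phi> (inv g)"])
    show "\<forall>a\<in>S. \<phi> (inv g) (\<phi> g a) = a"
      using g by (simp add: \<phi>_def cl flip: mult) (simp add: one)
    show "\<forall>a\<in>S. \<phi> g (\<phi> (inv g) a) = a"
      using g by (simp add: \<phi>_def cl flip: mult) (simp add: one)
  qed (use g cl in \<open>auto simp: \<phi>_def\<close>)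
  have "\<phi> \<in> hom P (BijGroup S)"
  proof (rule homI)
    fix g assume "g \<in> carrier P"
    then show "\<phi> g \<in> carrier (BijGroup S)"
      using bij by (auto simp: BijGroup_def Bij_def) (auto simp: \<phi>_def)
  next
    fix g h assume gh: "g \<in> carrier P" "h \<in> carrier P"
    have "\<phi> g \<in> Bij S" "\<phi> h \<in> Bij S"
      using bij gh by (auto simp: Bij_def) (auto simp: \<phi>_def)
    then show "\<phi> (g \<otimes> h) = \<phi> g \<otimes>\<^bsub>BijGroup S\<^esub> \<phi> h"
      using gh by (auto simp: BijGroup_def compose_def \<phi>_def mult cl)
  qed
  then have "group_action P S \<phi>"
    by (intro group_action.intro group_hom.intro group_hom_axioms.intro)
      (simp_all add: assms(1) group_BijGroup)
  then show ?thesis unfolding \<phi>_def .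
qed

text \<open>Orbit lengths divide \<open>p ^ k\<close>, so every orbit of length other than 1
  contributes a multiple of \<open>p\<close>; the other orbits are the fixed points.\<close>

lemma pgroup_fixed_points:
  fixes P (structure)
  assumes "group P" "card (carrier P) = p ^ k" "prime p" "finite S"
    and cl: "\<And>g s. g \<in> carrier P \<Longrightarrow> s \<in> S \<Longrightarrow> act g s \<in> S"
    and one: "\<And>s. s \<in> S \<Longrightarrow> act \<one> s = s"
    and mult: "\<And>g h s. g \<in> carrier P \<Longrightarrow> h \<in> carrier P \<Longrightarrow> s \<in> S \<Longrightarrow>
      act (g \<otimes> h) s = act g (act h s)"
  shows "[card S = card {s \<in> S. \<forall>g \<in> carrier P. act g s = s}] (mod p)"
proof -
  interpret P: group P by fact
  define \<phi> where "\<phi> g = restrict (act g) S" for g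
  interpret A: group_action P S \<phi>
    unfolding \<phi>_def by (rule group_action_restrict) (fact assms)+
  define B where "B = orbits P S \<phi>"
  have orb: "orbit P \<phi> s \<subseteq> S" if "s \<in> S" for s
    using that cl by (auto simp: orbit_def \<phi>_def)
  have finB: "finite B" unfolding B_def orbits_def using \<open>finite S\<close> by simp
  have cardS: "card S = (\<Sum>b\<in>B. card b)"
    using disjoint_sum[OF finB \<open>finite S\<close>, of "\<lambda>_. 1 :: nat"] A.orbit_partition by (simp add: B_def)
  have dvd: "p dvd card b" if b: "b \<in> B" "card b \<noteq> 1" for b
  proof -
    obtain s where s: "s \<in> S" "b = orbit P \<phi> s" using b by (auto simp: B_def orbits_def)
    have "card b dvd p ^ k"
      using A.orbit_stabilizer_theorem[OF s(1)] s assms(2) by (metis dvd_triv_left order_def)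
    then show ?thesis using b \<open>prime p\<close> by (metis divides_primepow_nat dvd_power gr0I power_0)
  qed
  define F where "F = {s \<in> S. \<forall>g \<in> carrier P. act g s = s}"
  have fix_orb: "orbit P \<phi> s = {s}" if "s \<in> F" for s
    using that P.one_closed by (force simp: F_def orbit_def \<phi>_def)
  have B1: "{b \<in> B. card b = 1} = (\<lambda>s. {s}) ` F"
  proof (intro Set.set_eqI iffI)
    fix b assume "b \<in> {b \<in> B. card b = 1}"
    then obtain s where s: "s \<in> S" "b = orbit P \<phi> s" "card b = 1" by (auto simp: B_def orbits_def)
    have "s \<in> b" using A.orbit_refl s by simp
    with s(3) have b: "b = {s}" by (metis card_1_singletonE singletonD)
    have "act g s = s" if "g \<in> carrier P" for g
    proof -
      have "\<phi> g s \<in> b" using that s(2) by (auto simp: orbit_def)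
      then show ?thesis using b s(1) by (simp add: \<phi>_def)
    qed
    then show "b \<in> (\<lambda>s. {s}) ` F" using b s(1) by (simp add: F_def)
  next
    fix b assume "b \<in> (\<lambda>s. {s}) ` F"
    then obtain s where s: "s \<in> F" "b = {s}" by auto
    then have "b \<in> B" using fix_orb[of s] by (auto simp: B_def orbits_def F_def)
    then show "b \<in> {b \<in> B. card b = 1}" using s by simp
  qed
  have "card S = (\<Sum>b\<in>{b \<in> B. card b = 1}. card b) + (\<Sum>b\<in>{b \<in> B. card b \<noteq> 1}. card b)"
    using sum.Int_Diff[OF finB, of card "{b. card b = 1}"] unfolding cardS
    by (simp add: Int_def set_diff_eq)
  also have "(\<Sum>b\<in>{b \<in> B. card b = 1}. card b) = card F"
    unfolding B1 by (subst sum.reindex) (auto simp: inj_on_def)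
  finally have "card S = card F + (\<Sum>b\<in>{b \<in> B. card b \<noteq> 1}. card b)" .
  moreover have "p dvd (\<Sum>b\<in>{b \<in> B. card b \<noteq> 1}. card b)"
    by (rule dvd_sum) (use dvd in auto)
  ultimately show ?thesis unfolding F_def
    by (simp add: cong_add_lcancel_0_nat cong_0_iff)
qed

lemma pgroup_fixed_point:
  fixes P (structure)
  assumes "group P" "card (carrier P) = p ^ k" "prime p" "finite S"
    and cl: "\<And>g s. g \<in> carrier P \<Longrightarrow> s \<in> S \<Longrightarrow> act g s \<in> S"
    and one: "\<And>s. s \<in> S \<Longrightarrow> act \<one> s = s"
    and mult: "\<And>g h s. g \<in> carrier P \<Longrightarrow> h \<in> carrier P \<Longrightarrow> s \<in> S \<Longrightarrow>
      act (g \<otimes> h) s = act g (act h s)"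
    and nd: "\<not> p dvd card S"
  obtains s where "s \<in> S" "\<And>g. g \<in> carrier P \<Longrightarrow> act g s = s"
proof -
  have "[card S = card {s \<in> S. \<forall>g \<in> carrier P. act g s = s}] (mod p)"
    by (rule pgroup_fixed_points) (fact assms)+
  with nd have "{s \<in> S. \<forall>g \<in> carrier P. act g s = s} \<noteq> {}"
    by (metis card.empty cong_dvd_iff dvd_0_right)
  with that show ?thesis by blast
qed

lemma transitive_action_card_dvd:
  fixes P (structure)
  assumes "group P"
    and cl: "\<And>g s. g \<in> carrier P \<Longrightarrow> s \<in> S \<Longrightarrow> act g s \<in> S"
    and one: "\<And>s. s \<in> S \<Longrightarrow> act \<one> s = s"
    and mult: "\<And>g h s. g \<in> carrier P \<Longrightarrow> h \<in> carrier P \<Longrightarrow> s \<in> S \<Longrightarrow>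
      act (g \<otimes> h) s = act g (act h s)"
    and s: "s \<in> S" and trans: "\<And>t. t \<in> S \<Longrightarrow> \<exists>g \<in> carrier P. act g s = t"
  shows "card S dvd card (carrier P)"
proof -
  define \<phi> where "\<phi> g = restrict (act g) S" for g
  interpret A: group_action P S \<phi>
    unfolding \<phi>_def by (rule group_action_restrict) (fact assms)+
  have "orbit P \<phi> s = S"
    using s cl trans by (force simp: orbit_def \<phi>_def)
  then show ?thesis
    using A.orbit_stabilizer_theorem[OF s] by (metis dvd_triv_left order_def)
qed

section \<open>Conjugation and Sylow subgroups\<close>

context group
begin

definition conjg :: "'a \<Rightarrow> 'a \<Rightarrow> 'a" where
  "conjg g x = g \<otimes> x \<otimes> inv g"

definition commute :: "'a \<Rightarrow> 'a \<Rightarrow> bool" where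
  "commute x y \<longleftrightarrow> x \<otimes> y = y \<otimes> x"

lemma inv_cancel_left [simp]:
  "x \<in> carrier G \<Longrightarrow> y \<in> carrier G \<Longrightarrow> inv x \<otimes> (x \<otimes> y) = y"
  "x \<in> carrier G \<Longrightarrow> y \<in> carrier G \<Longrightarrow> x \<otimes> (inv x \<otimes> y) = y"
  by (simp_all flip: m_assoc)

lemma conjg_closed [simp]: "g \<in> carrier G \<Longrightarrow> x \<in> carrier G \<Longrightarrow> conjg g x \<in> carrier G"
  by (simp add: conjg_def)

lemma conjg_mult:
  "g \<in> carrier G \<Longrightarrow> x \<in> carrier G \<Longrightarrow> y \<in> carrier G \<Longrightarrow> conjg g (x \<otimes> y) = conjg g x \<otimes> conjg g y"
  by (simp add: conjg_def m_assoc)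

lemma conjg_conjg:
  "g \<in> carrier G \<Longrightarrow> h \<in> carrier G \<Longrightarrow> x \<in> carrier G \<Longrightarrow> conjg g (conjg h x) = conjg (g \<otimes> h) x"
  by (simp add: conjg_def m_assoc inv_mult_group)

lemma conjg_one [simp]: "g \<in> carrier G \<Longrightarrow> conjg g \<one> = \<one>"
  by (simp add: conjg_def)

lemma one_conjg [simp]: "x \<in> carrier G \<Longrightarrow> conjg \<one> x = x"
  by (simp add: conjg_def)

lemma conjg_inv: "g \<in> carrier G \<Longrightarrow> x \<in> carrier G \<Longrightarrow> conjg g (inv x) = inv (conjg g x)"
  by (simp add: conjg_def m_assoc inv_mult_group)

lemma conjg_pow: "g \<in> carrier G \<Longrightarrow> x \<in> carrier G \<Longrightarrow> conjg g (x [^] n) = conjg g x [^] (n::nat)"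
  by (induction n) (simp_all add: conjg_mult)

lemma conjg_inv_conjg [simp]:
  "g \<in> carrier G \<Longrightarrow> x \<in> carrier G \<Longrightarrow> conjg (inv g) (conjg g x) = x"
  "g \<in> carrier G \<Longrightarrow> x \<in> carrier G \<Longrightarrow> conjg g (conjg (inv g) x) = x"
  by (simp_all add: conjg_conjg)

lemma conjg_eq_iff [simp]:
  "g \<in> carrier G \<Longrightarrow> x \<in> carrier G \<Longrightarrow> y \<in> carrier G \<Longrightarrow> conjg g x = conjg g y \<longleftrightarrow> x = y"
  by (metis conjg_inv_conjg(1))

lemma conjg_eq_one_iff [simp]:
  "g \<in> carrier G \<Longrightarrow> x \<in> carrier G \<Longrightarrow> conjg g x = \<one> \<longleftrightarrow> x = \<one>"
  by (metis conjg_eq_iff conjg_one one_closed)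

lemma inj_on_conjg: "g \<in> carrier G \<Longrightarrow> W \<subseteq> carrier G \<Longrightarrow> inj_on (conjg g) W"
  by (auto simp: inj_on_def subset_eq)

lemma conjg_eq_self_iff: "g \<in> carrier G \<Longrightarrow> x \<in> carrier G \<Longrightarrow> conjg g x = x \<longleftrightarrow> commute g x"
  by (simp add: conjg_def commute_def inv_solve_right')

lemma commute_sym: "commute x y \<Longrightarrow> commute y x"
  by (simp add: commute_def)

lemma commute_refl [simp]: "commute x x"
  by (simp add: commute_def)

lemma commute_one [simp]: "x \<in> carrier G \<Longrightarrow> commute \<one> x" "x \<in> carrier G \<Longrightarrow> commute x \<one>"
  by (simp_all add: commute_def)

lemma commute_mult:
  "x \<in> carrier G \<Longrightarrow> y \<in> carrier G \<Longrightarrow> z \<in> carrier G \<Longrightarrow> commute z x \<Longrightarrow> commute z y \<Longrightarrow> commute z (x \<otimes> y)"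
  unfolding commute_def by (metis m_assoc)

lemma commute_inv:
  "x \<in> carrier G \<Longrightarrow> z \<in> carrier G \<Longrightarrow> commute z x \<Longrightarrow> commute z (inv x)"
  unfolding commute_def by (simp add: inv_solve_right' m_assoc)

lemma commute_pow:
  "x \<in> carrier G \<Longrightarrow> z \<in> carrier G \<Longrightarrow> commute z x \<Longrightarrow> commute z (x [^] (n::nat))"
  by (induction n) (simp_all add: commute_mult)

lemma commute_pow_pow:
  "x \<in> carrier G \<Longrightarrow> y \<in> carrier G \<Longrightarrow> commute x y \<Longrightarrow> commute (x [^] (m::nat)) (y [^] (n::nat))"
  by (simp add: commute_pow commute_sym)

lemma commute_conjg:
  "g \<in> carrier G \<Longrightarrow> x \<in> carrier G \<Longrightarrow> y \<in> carrier G \<Longrightarrow> commute (conjg g x) (conjg g y) \<longleftrightarrow> commute x y"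
  unfolding commute_def by (metis conjg_eq_iff conjg_mult m_closed)

definition centralizer :: "'a set \<Rightarrow> 'a set" where
  "centralizer W = {g \<in> carrier G. \<forall>x \<in> W. commute g x}"

lemma subgroup_centralizer: "W \<subseteq> carrier G \<Longrightarrow> subgroup (centralizer W) G"
proof (rule subgroupI)
  assume W: "W \<subseteq> carrier G"
  show "centralizer W \<subseteq> carrier G" by (auto simp: centralizer_def)
  show "centralizer W \<noteq> {}" using W by (auto simp: centralizer_def intro!: exI[of _ \<one>])
  show "inv a \<in> centralizer W" if "a \<in> centralizer W" for a
    using that W commute_inv[THEN commute_sym, OF _ _ commute_sym] by (auto simp: centralizer_def)
  show "a \<otimes> b \<in> centralizer W" if "a \<in> centralizer W" "b \<in> centralizer W" for a b
    using that W commute_mult[THEN commute_sym, OF _ _ _ commute_sym commute_sym]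
    by (auto simp: centralizer_def)
qed

definition set_normalizer :: "'a set \<Rightarrow> 'a set" where
  "set_normalizer W = {g \<in> carrier G. conjg g ` W = W}"

lemma conjg_image_conjg_image:
  "g \<in> carrier G \<Longrightarrow> h \<in> carrier G \<Longrightarrow> W \<subseteq> carrier G \<Longrightarrow> conjg g ` (conjg h ` W) = conjg (g \<otimes> h) ` W"
  by (force simp: image_image conjg_conjg subset_eq)

lemma one_conjg_image: "W \<subseteq> carrier G \<Longrightarrow> conjg \<one> ` W = W"
  by (force simp: subset_eq image_iff)

lemma subgroup_set_normalizer: "W \<subseteq> carrier G \<Longrightarrow> subgroup (set_normalizer W) G"
proof (rule subgroupI)
  assume W: "W \<subseteq> carrier G"
  show "set_normalizer W \<subseteq> carrier G" by (auto simp: set_normalizer_def)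
  show "set_normalizer W \<noteq> {}" using one_conjg_image[OF W] by (auto simp: set_normalizer_def)
  show "inv a \<in> set_normalizer W" if "a \<in> set_normalizer W" for a
    using that conjg_image_conjg_image[of "inv a" a, OF _ _ W] one_conjg_image[OF W]
    by (auto simp: set_normalizer_def)
  show "a \<otimes> b \<in> set_normalizer W" if "a \<in> set_normalizer W" "b \<in> set_normalizer W" for a b
    using that conjg_image_conjg_image[of a b, OF _ _ W] by (auto simp: set_normalizer_def)
qed

lemma subgroup_conjg_image: "subgroup H G \<Longrightarrow> g \<in> carrier G \<Longrightarrow> subgroup (conjg g ` H) G"
proof (rule subgroupI)
  assume H: "subgroup H G" and g: "g \<in> carrier G"
  note [simp] = subgroup.mem_carrier[OF H] subgroup.m_closed[OF H] subgroup.m_inv_closed[OF H]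
  show "conjg g ` H \<subseteq> carrier G" using g by auto
  show "conjg g ` H \<noteq> {}" using subgroup.one_closed[OF H] by auto
  show "inv a \<in> conjg g ` H" if "a \<in> conjg g ` H" for a
    using that g by (auto simp flip: conjg_inv)
  show "a \<otimes> b \<in> conjg g ` H" if "a \<in> conjg g ` H" "b \<in> conjg g ` H" for a b
    using that g by (auto simp flip: conjg_mult)
qed

lemma normal_conjg: "N \<lhd> G \<Longrightarrow> g \<in> carrier G \<Longrightarrow> x \<in> N \<Longrightarrow> conjg g x \<in> N"
  by (simp add: conjg_def normal.inv_op_closed2)

lemma normal_conjg_iff: "N \<lhd> G \<longleftrightarrow> subgroup N G \<and> (\<forall>g \<in> carrier G. \<forall>x \<in> N. conjg g x \<in> N)"
  by (simp add: normal_inv_iff conjg_def)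

lemma subgroup_group: "subgroup H G \<Longrightarrow> group (G\<lparr>carrier := H\<rparr>)"
  by (simp add: subgroup.subgroup_is_group)

lemma subgroup_in_subgroup:
  "subgroup H G \<Longrightarrow> subgroup K G \<Longrightarrow> K \<subseteq> H \<Longrightarrow> subgroup K (G\<lparr>carrier := H\<rparr>)"
  by (simp add: subgroup_incl)

lemma subgroup_card_dvd:
  assumes "subgroup H G" "subgroup K G" "K \<subseteq> H"
  shows "card K dvd card H"
  using group.lagrange[OF subgroup_group subgroup_in_subgroup, OF assms(1) assms]
  by (simp add: order_def) (metis dvd_triv_right)

lemma subgroup_pow: "subgroup H G \<Longrightarrow> x \<in> H \<Longrightarrow> x [^] (n::nat) \<in> H"
  by (induction n) (simp_all add: subgroup.one_closed subgroup.m_closed)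

lemma card_subgroup_eq_1_iff: "subgroup H G \<Longrightarrow> card H = 1 \<longleftrightarrow> H = {\<one>}"
  using subgroup.one_closed[of H G] by (auto simp: card_1_singleton_iff)

lemma conjg_mem: "subgroup H G \<Longrightarrow> g \<in> H \<Longrightarrow> x \<in> H \<Longrightarrow> conjg g x \<in> H"
  by (simp add: conjg_def subgroup.m_closed subgroup.m_inv_closed)

lemma pow_eq_iff_cong:
  "x \<in> carrier G \<Longrightarrow> x [^] a = x [^] (b::nat) \<longleftrightarrow> [a = b] (mod ord x)"
  using int_pow_eq[of x "int a" "int b"]
  by (simp add: int_pow_int dvd_diff_commute flip: cong_int_iff cong_iff_dvd_diff)

text \<open>Natural exponents suffice in a finite group and turn equality of members into a
  congruence modulo \<open>ord x\<close>.\<close>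

definition cyc :: "'a \<Rightarrow> 'a set" where
  "cyc x = range (\<lambda>n::nat. x [^] n)"

lemma cyc_commute: "a \<in> carrier G \<Longrightarrow> x \<in> cyc a \<Longrightarrow> y \<in> cyc a \<Longrightarrow> commute x y"
  by (auto simp: cyc_def intro: commute_pow_pow)

end

section \<open>Finite groups: cyclic subgroups, fixed points and Sylow subgroups\<close>

locale finite_group = group +
  assumes fin [simp]: "finite (carrier G)"
begin

lemma finite_subgroup: "subgroup H G \<Longrightarrow> finite H"
  by (meson fin finite_subset subgroup.subset)

lemma conjg_image_eqI:
  assumes "g \<in> carrier G" "subgroup A G" "\<And>a. a \<in> A \<Longrightarrow> conjg g a \<in> A"
  shows "conjg g ` A = A"
  using assms by (intro endo_inj_surj finite_subgroup inj_on_conjg) (auto dest: subgroup.subset)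

lemma ord_pos: "x \<in> carrier G \<Longrightarrow> ord x > 0"
  using ord_ge_1[OF fin, of x] by linarith

lemma cyc_generate: "x \<in> carrier G \<Longrightarrow> cyc x = generate G {x}"
  using generate_pow_nat[of x] ord_pos[of x] by (auto simp: cyc_def)

lemma subgroup_cyc: "x \<in> carrier G \<Longrightarrow> subgroup (cyc x) G"
  by (simp add: cyc_generate generate_is_subgroup)

lemma card_cyc: "x \<in> carrier G \<Longrightarrow> card (cyc x) = ord x"
  by (simp add: cyc_generate generate_pow_card)

lemma self_in_cyc: "x \<in> carrier G \<Longrightarrow> x \<in> cyc x"
  by (metis cyc_def nat_pow_eone rangeI)

lemma cyc_subset: "subgroup H G \<Longrightarrow> x \<in> H \<Longrightarrow> cyc x \<subseteq> H"
  by (auto simp: cyc_def subgroup_pow)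

lemma ord_dvd_card_subgroup: "subgroup H G \<Longrightarrow> x \<in> H \<Longrightarrow> ord x dvd card H"
  by (metis card_cyc cyc_subset subgroup.mem_carrier subgroup_card_dvd subgroup_cyc)

lemma exists_prime_order_pow:
  assumes "x \<in> carrier G" "prime p" "p dvd ord x"
  obtains n :: nat where "ord (x [^] n) = p"
proof -
  obtain n where n: "ord x = p * n" using assms by auto
  then have "n \<noteq> 0" "n dvd ord x" using ord_pos[OF assms(1)] by auto
  then have "ord (x [^] n) = p" using ord_pow[of x n] assms(1) n by simp
  then show ?thesis using that by blast
qed

lemma exists_sylow:
  assumes "subgroup M G" "prime p" "p ^ a dvd card M"
  obtains R where "subgroup R G" "R \<subseteq> M" "card R = p ^ a"
proof -
  obtain m where m: "card M = p ^ a * m" using assms by auto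
  have "\<exists>R. subgroup R (G\<lparr>carrier := M\<rparr>) \<and> card R = p ^ a"
    by (rule sylow_thm[of p _ a m])
      (use assms m in \<open>simp_all add: subgroup_group order_def finite_subgroup\<close>)
  then obtain R where R: "subgroup R (G\<lparr>carrier := M\<rparr>)" "card R = p ^ a" by blast
  from subgroup.subset[OF R(1)] have "R \<subseteq> M" by simp
  with that R incl_subgroup[OF assms(1)] show ?thesis by blast
qed

lemma exists_prime_order:
  assumes "subgroup M G" "prime p" "p dvd card M"
  obtains x where "x \<in> M" "ord x = p"
proof -
  obtain R where R: "subgroup R G" "R \<subseteq> M" "card R = p ^ 1"
    using exists_sylow[of M p 1] assms by auto
  have "card R > 1" using R assms prime_gt_1_nat by simp
  then have "\<not> R \<subseteq> {\<one>}" by (metis card_mono finite.intros is_singletonI is_singleton_altdef not_less)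
  then obtain x where x: "x \<in> R" "x \<noteq> \<one>" by blast
  have "ord x dvd p" using ord_dvd_card_subgroup[OF R(1) x(1)] R(3) by simp
  moreover have "ord x \<noteq> 1" using x R(1) ord_eq_1[of x] subgroup.mem_carrier[OF R(1)] by simp
  ultimately have "ord x = p" using assms(2) prime_nat_iff by blast
  with that x R show ?thesis by blast
qed

text \<open>The fixed points of \<open>P\<close> on \<open>B\<close> under conjugation number a
  multiple of \<open>p\<close> and include \<one>, so there is another one. For \<open>B = P\<close>
  this is the nontrivial centre of a \<open>p\<close>-group.\<close>

lemma pgroup_centralizes_nontrivial:
  assumes P: "subgroup P G" "card P = p ^ k" and p: "prime p"
    and B: "subgroup B G" "p dvd card B" and PB: "\<And>g b. g \<in> P \<Longrightarrow> b \<in> B \<Longrightarrow> conjg g b \<in> B"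
  obtains b where "b \<in> B" "b \<noteq> \<one>" "\<And>g. g \<in> P \<Longrightarrow> commute g b"
proof -
  note [simp] = subgroup.mem_carrier[OF P(1)] subgroup.mem_carrier[OF B(1)]
  define F where "F = {b \<in> B. \<forall>g \<in> P. conjg g b = b}"
  have "[card B = card {s \<in> B. \<forall>g \<in> carrier (G\<lparr>carrier := P\<rparr>). conjg g s = s}] (mod p)"
    by (rule pgroup_fixed_points)
      (use P B p PB in \<open>auto simp: subgroup_group finite_subgroup conjg_conjg\<close>)
  then have "p dvd card F" using B by (simp add: F_def cong_dvd_iff)
  have "\<one> \<in> F" using B subgroup.one_closed by (auto simp: F_def)
  have "F \<noteq> {\<one>}" using \<open>p dvd card F\<close> p by (metis One_nat_def card.empty card.insert
        empty_iff finite.emptyI nat_dvd_1_iff_1 not_prime_1)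
  then obtain b where "b \<in> F" "b \<noteq> \<one>" using \<open>\<one> \<in> F\<close> by blast
  then show ?thesis using that[of b] by (auto simp: F_def conjg_eq_self_iff)
qed

text \<open>Relative to a subgroup \<open>M\<close> of the ambient group, so that Sylow subgroups of
  different subgroups can be compared and conjugated by all of \<open>G\<close>. If \<open>p\<close>
  does not divide \<open>card M\<close>, then \<open>R\<close> is trivial.\<close>

definition sylow_of :: "nat \<Rightarrow> 'a set \<Rightarrow> 'a set \<Rightarrow> bool" where
  "sylow_of p R M \<longleftrightarrow> subgroup R G \<and> R \<subseteq> M \<and> card R = p ^ multiplicity p (card M)"

lemma sylow_of_exists:
  assumes "subgroup M G" "prime p"
  obtains R where "sylow_of p R M"
  using exists_sylow[OF assms multiplicity_dvd] by (auto simp: sylow_of_def)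

lemma sylow_of_index:
  assumes R: "sylow_of p R M" and p: "prime p" and n: "n * card R = card M" "card M \<noteq> 0"
  shows "\<not> p dvd n"
proof
  assume "p dvd n"
  then have "p ^ Suc (multiplicity p (card M)) dvd card M"
    using R n(1) by (metis mult_dvd_mono dvd_refl power_Suc sylow_of_def)
  then show False
    using n(2) p power_dvd_iff_le_multiplicity[of "card M" p "Suc (multiplicity p (card M))"]
      prime_gt_1_nat[OF p] by auto
qed

text \<open>\<open>Q\<close> permutes the right cosets of \<open>R\<close> in \<open>M\<close>,
  whose number is prime to \<open>p\<close>; a fixed coset \<open>R #> m\<close> supplies the
  conjugating element. Multiplying by inverses on the right makes this a left action.\<close>

lemma sylow_conj_into:
  assumes M: "subgroup M G" and p: "prime p" and R: "sylow_of p R M"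
    and Q: "subgroup Q G" "Q \<subseteq> M" "card Q = p ^ k"
  obtains m where "m \<in> M" "\<And>q. q \<in> Q \<Longrightarrow> conjg m q \<in> R"
proof -
  note [simp] = subgroup.mem_carrier[OF M]
  have RG: "subgroup R G" "R \<subseteq> M" using R by (auto simp: sylow_of_def)
  then have RC: "R \<subseteq> carrier G" by (simp add: subgroup.subset)
  have QM: "q \<in> M" "q \<in> carrier G" "inv q \<in> M" if "q \<in> Q" for q
    using that Q(2) M by (auto simp: subgroup.m_inv_closed)
  define S where "S = {R #> m | m. m \<in> M}"
  have S: "S = rcosets\<^bsub>G\<lparr>carrier := M\<rparr>\<^esub> R" by (auto simp: S_def RCOSETS_def)
  have "card S * card R = card M"
    using group.lagrange[OF subgroup_group[OF M] subgroup_in_subgroup[OF M RG]]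
    by (simp add: S order_def)
  moreover have "card M > 0" using M finite_subgroup subgroup.finite_imp_card_positive fin by blast
  ultimately have nd: "\<not> p dvd card S" using sylow_of_index[OF R p] by blast
  obtain t where t: "t \<in> S" "\<And>g. g \<in> carrier (G\<lparr>carrier := Q\<rparr>) \<Longrightarrow> t #> inv g = t"
  proof (rule pgroup_fixed_point)
    show "finite S" unfolding S_def using finite_subgroup[OF M] by simp
    show "s #> inv g \<in> S" if "g \<in> carrier (G\<lparr>carrier := Q\<rparr>)" "s \<in> S" for g s
    proof -
      obtain m where m: "m \<in> M" "s = R #> m" using \<open>s \<in> S\<close> by (auto simp: S_def)
      moreover have "m \<otimes> inv g \<in> M" using m that QM by (simp add: subgroup.m_closed[OF M])
      ultimately show ?thesis using that QM RC by (auto simp: S_def coset_mult_assoc)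
    qed
    show "s #> inv \<one>\<^bsub>G\<lparr>carrier := Q\<rparr>\<^esub> = s" if "s \<in> S" for s
      using that RC by (auto simp: S_def coset_mult_assoc)
    show "s #> inv (g \<otimes>\<^bsub>G\<lparr>carrier := Q\<rparr>\<^esub> h) = s #> inv h #> inv g"
      if "g \<in> carrier (G\<lparr>carrier := Q\<rparr>)" "h \<in> carrier (G\<lparr>carrier := Q\<rparr>)" "s \<in> S" for g h s
      using that RC QM by (auto simp: S_def coset_mult_assoc inv_mult_group m_assoc)
  qed (use Q p nd in \<open>simp_all add: subgroup_group\<close>)
  then obtain m where m: "m \<in> M" "\<And>q. q \<in> Q \<Longrightarrow> R #> m #> inv q = R #> m"
    by (auto simp: S_def)
  have "conjg m q \<in> R" if q: "q \<in> Q" for q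
  proof -
    have "R #> (m \<otimes> inv q) = R #> m" using m q QM RC by (simp add: coset_mult_assoc)
    moreover have "m \<otimes> inv q \<in> R #> (m \<otimes> inv q)" using m q QM RG by (simp add: rcos_self)
    ultimately have "m \<otimes> inv q \<in> R #> m" by simp
    then have "m \<otimes> inv q \<otimes> inv m \<in> R"
      using subgroup.rcos_module[OF RG(1) is_group] m q QM by simp
    then have "inv (m \<otimes> inv q \<otimes> inv m) \<in> R" using RG by (simp add: subgroup.m_inv_closed)
    then show ?thesis using m q QM by (simp add: conjg_def inv_mult_group m_assoc)
  qed
  with that m show ?thesis by blast
qed

lemma sylow_conjugate:
  assumes M: "subgroup M G" and p: "prime p" and R: "sylow_of p R M" and Q: "sylow_of p Q M"
  obtains m where "m \<in> M" "conjg m ` Q = R"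
proof -
  obtain m where m: "m \<in> M" "\<And>q. q \<in> Q \<Longrightarrow> conjg m q \<in> R"
    using sylow_conj_into[OF M p R] Q unfolding sylow_of_def by metis
  have "Q \<subseteq> carrier G" using Q by (simp add: sylow_of_def subgroup.subset)
  then have "card (conjg m ` Q) = card R"
    using Q R subgroup.mem_carrier[OF M m(1)] by (simp add: card_image inj_on_conjg sylow_of_def)
  then have "conjg m ` Q = R"
    using m R by (intro card_subset_eq) (auto simp: sylow_of_def finite_subgroup)
  with that m show ?thesis by blast
qed

text \<open>\<open>E\<close> acts on the Sylow \<open>q\<close>-subgroups of \<open>A\<close>. Since
  \<open>A\<close> permutes them transitively, their number divides \<open>card A\<close> and is
  prime to \<open>r\<close>, so the \<open>r\<close>-group \<open>E\<close> fixes one.\<close>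

lemma exists_normalized_sylow:
  assumes A: "subgroup A G" and E: "subgroup E G" "card E = r ^ k" and r: "prime r" "\<not> r dvd card A"
    and EA: "\<And>e. e \<in> E \<Longrightarrow> conjg e ` A = A" and q: "prime q"
  obtains Y where "sylow_of q Y A" "\<And>e. e \<in> E \<Longrightarrow> conjg e ` Y = Y"
proof -
  note [simp] = subgroup.mem_carrier[OF A] subgroup.mem_carrier[OF E(1)]
  define S where "S = {Y. sylow_of q Y A}"
  have SG: "Y \<subseteq> carrier G" if "Y \<in> S" for Y
    using that by (simp add: S_def sylow_of_def subgroup.subset)
  have cl: "conjg g ` Y \<in> S" if "g \<in> carrier G" "conjg g ` A = A" "Y \<in> S" for g Y
    using that SG image_mono[of Y A "conjg g"]
    by (simp add: S_def sylow_of_def subgroup_conjg_image card_image inj_on_conjg)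
  have AA: "conjg a ` A = A" if "a \<in> A" for a
    using that A by (intro conjg_image_eqI conjg_mem) auto
  obtain Y0 where Y0: "Y0 \<in> S" using sylow_of_exists[OF A q] by (auto simp: S_def)
  have "card S dvd card (carrier (G\<lparr>carrier := A\<rparr>))"
  proof (rule transitive_action_card_dvd[where act = "\<lambda>g Y. conjg g ` Y"])
    show "\<exists>g\<in>carrier (G\<lparr>carrier := A\<rparr>). conjg g ` Y0 = t" if "t \<in> S" for t
    proof -
      have "sylow_of q t A" "sylow_of q Y0 A" using that Y0 by (auto simp: S_def)
      then obtain m where "m \<in> A" "conjg m ` Y0 = t" using sylow_conjugate[OF A q] by metis
      then show ?thesis by auto
    qed
  qed (use cl AA Y0 SG in \<open>auto simp: subgroup_group[OF A] conjg_image_conjg_image one_conjg_image\<close>)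
  then have nd: "\<not> r dvd card S" using r by auto
  have finS: "finite S"
    by (rule finite_subset[of _ "Pow (carrier G)"]) (use SG in auto)
  obtain Y where "Y \<in> S" "\<And>g. g \<in> carrier (G\<lparr>carrier := E\<rparr>) \<Longrightarrow> conjg g ` Y = Y"
    by (rule pgroup_fixed_point[where S = S and P = "G\<lparr>carrier := E\<rparr>" and act = "\<lambda>g Y. conjg g ` Y"])
      (use E r nd finS cl EA SG in \<open>auto simp: subgroup_group conjg_image_conjg_image one_conjg_image\<close>)
  with that show ?thesis by (auto simp: S_def)
qed

lemma ord_conjg: "g \<in> carrier G \<Longrightarrow> x \<in> carrier G \<Longrightarrow> ord (conjg g x) = ord x"
  by (simp add: ord_unique pow_eq_id flip: conjg_pow)

section \<open>Transfer\<close>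

text \<open>
  Since conjugate elements of \<open>R\<close> are equal, \<open>r \<otimes> d \<otimes> s \<mapsto> r \<otimes> s\<close> is well defined on every double
  coset of \<open>R\<close> with representative \<open>d\<close>.  The resulting map \<open>\<phi>\<close> commutes with left and right
  multiplication by \<open>R\<close>, so the transfer, the product of the \<open>\<phi> (k \<otimes> g) \<otimes> inv (\<phi> k)\<close> over the right
  cosets \<open>R #> k\<close>, has all factors equal to \<open>g\<close> when \<open>g \<in> R\<close>.
\<close>

lemma exists_transfer:
  assumes R: "subgroup R G" and comm: "\<And>x y. x \<in> R \<Longrightarrow> y \<in> R \<Longrightarrow> commute x y"
    and fusion: "\<And>x h. x \<in> R \<Longrightarrow> h \<in> carrier G \<Longrightarrow> conjg h x \<in> R \<Longrightarrow> conjg h x = x"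
  obtains V where "V \<in> hom G G" "V ` carrier G \<subseteq> R" "\<And>x. x \<in> R \<Longrightarrow> V x = x [^] card (rcosets R)"
proof -
  note [simp] = subgroup.mem_carrier[OF R] subgroup.m_closed[OF R] subgroup.m_inv_closed[OF R]
    subgroup.one_closed[OF R]
  have RC: "R \<subseteq> carrier G" by auto
  have comm': "x \<otimes> y = y \<otimes> x" if "x \<in> R" "y \<in> R" for x y using comm that by (simp add: commute_def)
  have lcomm: "x \<otimes> (y \<otimes> z) = y \<otimes> (x \<otimes> z)" if "x \<in> R" "y \<in> R" "z \<in> R" for x y z
    using that by (metis comm' m_assoc subgroup.mem_carrier[OF R])
  note ac = m_assoc comm' lcomm
  define dc where "dc k = {r \<otimes> k \<otimes> s | r s. r \<in> R \<and> s \<in> R}" for k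
  \<comment> \<open>The choice depends on \<open>k\<close> only through the set \<open>dc k\<close>,
    so all elements of a double coset share their representative.\<close>
  define rep where "rep k = (SOME d. d \<in> dc k)" for k
  define \<phi> where "\<phi> k = (SOME w. \<exists>r\<in>R. \<exists>s\<in>R. k = r \<otimes> rep k \<otimes> s \<and> w = r \<otimes> s)" for k
  have dc_sub: "dc (r \<otimes> k \<otimes> s) \<subseteq> dc k" if "r \<in> R" "s \<in> R" "k \<in> carrier G" for r s k
  proof
    fix x assume "x \<in> dc (r \<otimes> k \<otimes> s)"
    then obtain a b where ab: "a \<in> R" "b \<in> R" "x = a \<otimes> (r \<otimes> k \<otimes> s) \<otimes> b" by (auto simp: dc_def)
    then have "x = (a \<otimes> r) \<otimes> k \<otimes> (s \<otimes> b)" using that by (simp add: m_assoc)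
    then show "x \<in> dc k" unfolding dc_def using ab that
      by (intro CollectI exI[of _ "a \<otimes> r"] exI[of _ "s \<otimes> b"]) simp
  qed
  have dc_eq: "dc (r \<otimes> k \<otimes> s) = dc k" if "r \<in> R" "s \<in> R" "k \<in> carrier G" for r s k
  proof
    have "k = inv r \<otimes> (r \<otimes> k \<otimes> s) \<otimes> inv s" using that by (simp add: m_assoc)
    then show "dc k \<subseteq> dc (r \<otimes> k \<otimes> s)"
      using dc_sub[of "inv r" "inv s" "r \<otimes> k \<otimes> s"] that by simp
  qed (rule dc_sub[OF that])
  have rep: "\<exists>r\<in>R. \<exists>s\<in>R. k = r \<otimes> rep k \<otimes> s" "rep k \<in> carrier G" if "k \<in> carrier G" for k
  proof -
    have "k \<in> dc k" unfolding dc_def using that by (intro CollectI exI[of _ \<one>]) simp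
    then have "rep k \<in> dc k" unfolding rep_def by (rule someI)
    then obtain r s where rs: "r \<in> R" "s \<in> R" "rep k = r \<otimes> k \<otimes> s" by (auto simp: dc_def)
    then have "k = inv r \<otimes> rep k \<otimes> inv s" using that by (simp add: m_assoc)
    then show "\<exists>r\<in>R. \<exists>s\<in>R. k = r \<otimes> rep k \<otimes> s"
      using rs by (intro bexI[of _ "inv r"] bexI[of _ "inv s"]) simp_all
    show "rep k \<in> carrier G" using rs that by simp
  qed
  have uniq: "r \<otimes> s = r' \<otimes> s'"
    if "r \<in> R" "s \<in> R" "r' \<in> R" "s' \<in> R" "d \<in> carrier G" "r \<otimes> d \<otimes> s = r' \<otimes> d \<otimes> s'" for r s r' s' d
  proof -
    have "inv r' \<otimes> (r \<otimes> d \<otimes> s) \<otimes> inv s = inv r' \<otimes> (r' \<otimes> d \<otimes> s') \<otimes> inv s"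
      by (simp only: that(6))
    then have "inv r' \<otimes> r \<otimes> d = d \<otimes> (s' \<otimes> inv s)" using that(1-5) by (simp add: m_assoc)
    \<comment> \<open>Two factorizations over the same \<open>d\<close> exhibit elements of
      \<open>R\<close> conjugate under \<open>inv d\<close>, which the fusion hypothesis
      identifies.\<close>
    then have *: "conjg (inv d) (inv r' \<otimes> r) = s' \<otimes> inv s"
      using that(1-5) by (simp add: conjg_def m_assoc)
    have "conjg (inv d) (inv r' \<otimes> r) = inv r' \<otimes> r"
      by (rule fusion) (use that(1-5) * in simp_all)
    with * have "inv r' \<otimes> r = s' \<otimes> inv s" by simp
    then have "r' \<otimes> (inv r' \<otimes> r) \<otimes> s = r' \<otimes> (s' \<otimes> inv s) \<otimes> s" by simp
    then show ?thesis using that(1-5) by (simp add: m_assoc)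
  qed
  have \<phi>_eq: "\<phi> k = r \<otimes> s" if "r \<in> R" "s \<in> R" "k = r \<otimes> rep k \<otimes> s" "k \<in> carrier G" for k r s
  proof -
    have "\<exists>w. \<exists>r\<in>R. \<exists>s\<in>R. k = r \<otimes> rep k \<otimes> s \<and> w = r \<otimes> s" using that by blast
    then have "\<exists>r\<in>R. \<exists>s\<in>R. k = r \<otimes> rep k \<otimes> s \<and> \<phi> k = r \<otimes> s" unfolding \<phi>_def by (rule someI_ex)
    then obtain a b where ab: "a \<in> R" "b \<in> R" "k = a \<otimes> rep k \<otimes> b" "\<phi> k = a \<otimes> b" by blast
    with that rep(2)[of k] uniq[of a b r s "rep k"] show ?thesis by simp
  qed
  have \<phi>R: "\<phi> k \<in> R" if "k \<in> carrier G" for k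
    using rep(1)[OF that] \<phi>_eq[OF _ _ _ that] by force
  have \<phi>_mult: "\<phi> (r \<otimes> k \<otimes> s) = r \<otimes> \<phi> k \<otimes> s" if rsk: "r \<in> R" "s \<in> R" "k \<in> carrier G" for r s k
  proof -
    obtain a b where ab: "a \<in> R" "b \<in> R" "k = a \<otimes> rep k \<otimes> b" using rep(1)[OF rsk(3)] by blast
    have rk: "rep (r \<otimes> k \<otimes> s) = rep k" unfolding rep_def using dc_eq rsk by simp
    have "r \<otimes> k \<otimes> s = r \<otimes> (a \<otimes> rep k \<otimes> b) \<otimes> s" using ab(3) by simp
    also have "\<dots> = (r \<otimes> a) \<otimes> rep (r \<otimes> k \<otimes> s) \<otimes> (b \<otimes> s)"
      unfolding rk using rsk ab(1,2) rep(2)[OF rsk(3)] by (simp add: m_assoc)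
    finally have "\<phi> (r \<otimes> k \<otimes> s) = (r \<otimes> a) \<otimes> (b \<otimes> s)"
      using rsk ab(1,2) by (intro \<phi>_eq) simp_all
    moreover have "\<phi> k = a \<otimes> b" using ab rsk by (intro \<phi>_eq) simp_all
    ultimately show ?thesis using rsk ab(1,2) by (simp add: m_assoc)
  qed
  define w where "w g k = \<phi> (k \<otimes> g) \<otimes> inv (\<phi> k)" for g k
  have wR: "w g k \<in> R" if "g \<in> carrier G" "k \<in> carrier G" for g k
    using that \<phi>R by (simp add: w_def)
  have w_left: "w g (r \<otimes> k) = w g k" if "g \<in> carrier G" "k \<in> carrier G" "r \<in> R" for g k r
    using \<phi>_mult[of r \<one> k] \<phi>_mult[of r \<one> "k \<otimes> g"] that \<phi>R
    by (simp add: w_def inv_mult_group ac)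
  define W where "W g c = w g (SOME k. k \<in> c)" for g c
  have W: "W g (R #> k) = w g k" if "g \<in> carrier G" "k \<in> carrier G" for g k
  proof -
    have "(SOME x. x \<in> R #> k) \<in> R #> k" using rcos_self[OF that(2) R] by (rule someI)
    then obtain r where "r \<in> R" "(SOME x. x \<in> R #> k) = r \<otimes> k" by (auto simp: r_coset_def)
    then show ?thesis using that w_left by (simp add: W_def)
  qed
  interpret R: comm_group "G\<lparr>carrier := R\<rparr>"
    by (rule group.group_comm_groupI) (use subgroup_group[OF R] comm' in auto)
  define V where "V g = finprod (G\<lparr>carrier := R\<rparr>) (W g) (rcosets R)" for g
  have WR: "W g c \<in> R" if "g \<in> carrier G" "c \<in> rcosets R" for g c
    using that W wR by (auto simp: RCOSETS_def)
  have finC: "finite (rcosets R)" by (simp add: RCOSETS_def)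
  have VR: "V g \<in> R" if "g \<in> carrier G" for g
    using R.finprod_closed[of "W g" "rcosets R"] WR that by (simp add: V_def Pi_def)
  have trans: "(\<lambda>c. c #> g) ` (rcosets R) = rcosets R" "inj_on (\<lambda>c. c #> g) (rcosets R)"
    if g: "g \<in> carrier G" for g
  proof -
    have sub: "(\<lambda>c. c #> g) ` (rcosets R) \<subseteq> rcosets R"
      using g RC by (auto simp: RCOSETS_def coset_mult_assoc)
    have "c #> g #> inv g = c" if "c \<in> rcosets R" for c
      using that g RC by (auto simp: RCOSETS_def coset_mult_assoc m_assoc)
    then show inj: "inj_on (\<lambda>c. c #> g) (rcosets R)" by (rule inj_on_inverseI)
    show "(\<lambda>c. c #> g) ` (rcosets R) = rcosets R" by (rule endo_inj_surj[OF finC sub inj])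
  qed
  have "V (g \<otimes> h) = V g \<otimes> V h" if gh: "g \<in> carrier G" "h \<in> carrier G" for g h
  proof -
    \<comment> \<open>Cocycle identity, obtained by inserting \<open>\<phi> (k \<otimes> g)\<close>.
      The shift \<open>c #> g\<close> permutes the cosets and disappears in the product over all of
      them.\<close>
    have "W (g \<otimes> h) c = W g c \<otimes> W h (c #> g)" if c: "c \<in> rcosets R" for c
    proof -
      obtain k where k: "k \<in> carrier G" "c = R #> k" using c by (auto simp: RCOSETS_def)
      then have "c #> g = R #> (k \<otimes> g)" using gh RC by (simp add: coset_mult_assoc)
      then show ?thesis using gh k \<phi>R by (simp add: W w_def ac)
    qed
    moreover have cg: "c #> g \<in> rcosets R" if "c \<in> rcosets R" for c
      using trans(1)[OF gh(1)] that by blast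
    ultimately have "V (g \<otimes> h) = finprod (G\<lparr>carrier := R\<rparr>) (\<lambda>c. W g c \<otimes> W h (c #> g)) (rcosets R)"
      unfolding V_def using WR gh by (intro R.finprod_cong') (auto simp: Pi_def)
    also have "\<dots> = V g \<otimes> finprod (G\<lparr>carrier := R\<rparr>) (\<lambda>c. W h (c #> g)) (rcosets R)"
      unfolding V_def using WR gh cg R.finprod_multf[of "W g" "rcosets R" "\<lambda>c. W h (c #> g)"]
      by (simp add: Pi_def)
    also have "finprod (G\<lparr>carrier := R\<rparr>) (\<lambda>c. W h (c #> g)) (rcosets R) = V h"
      unfolding V_def using R.finprod_reindex[of "W h" "\<lambda>c. c #> g" "rcosets R"] trans[of g] gh WR
      by (simp add: Pi_def)
    finally show ?thesis .
  qed
  then have "V \<in> hom G G" using VR by (auto simp: hom_def)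
  moreover have "V x = x [^] card (rcosets R)" if x: "x \<in> R" for x
  proof -
    have "W x c = x" if c: "c \<in> rcosets R" for c
    proof -
      obtain k where k: "k \<in> carrier G" "c = R #> k" using c by (auto simp: RCOSETS_def)
      then show ?thesis using x \<phi>_mult[of \<one> x k] \<phi>R[of k] by (simp add: W w_def ac)
    qed
    then have "V x = finprod (G\<lparr>carrier := R\<rparr>) (\<lambda>c. x) (rcosets R)"
      unfolding V_def using x by (intro R.finprod_cong') (auto simp: Pi_def)
    also have "\<dots> = x [^] card (rcosets R)"
      using R.finprod_const[of x "rcosets R"] x by (simp flip: nat_pow_consistent)
    finally show ?thesis .
  qed
  moreover have "V ` carrier G \<subseteq> R" using VR by blast
  ultimately show ?thesis using that by blast
qed

text \<open>On \<open>R\<close> the transfer is the power map whose exponent is the index of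
  \<open>R\<close>. The index is prime to \<open>r\<close>, so this map is bijective on
  \<open>R\<close>: the kernel consists of the elements of order prime to \<open>r\<close>, and some
  \<open>y\<close> in \<open>R\<close> has the same transfer as \<open>g\<close>.\<close>

lemma normal_complement:
  assumes R: "sylow_of r R (carrier G)" and r: "prime r"
    and comm: "\<And>x y. x \<in> R \<Longrightarrow> y \<in> R \<Longrightarrow> commute x y"
    and fusion: "\<And>x h. x \<in> R \<Longrightarrow> h \<in> carrier G \<Longrightarrow> conjg h x \<in> R \<Longrightarrow> conjg h x = x"
  shows "subgroup {g \<in> carrier G. \<not> r dvd ord g} G"
    and "g \<in> carrier G \<Longrightarrow> \<exists>y \<in> R. \<not> r dvd ord (g \<otimes> inv y)"
proof -
  have RG: "subgroup R G" using R by (simp add: sylow_of_def)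
  note [simp] = subgroup.mem_carrier[OF RG] subgroup.m_inv_closed[OF RG]
  obtain V where V: "V \<in> hom G G" "V ` carrier G \<subseteq> R"
    "\<And>x. x \<in> R \<Longrightarrow> V x = x [^] card (rcosets R)"
    using exists_transfer[OF RG comm fusion] by blast
  interpret V: group_hom G G V by unfold_locales (rule V(1))
  define n where "n = card (rcosets R)"
  define k where "k = multiplicity r (card (carrier G))"
  have k: "card R = r ^ k" using R by (simp add: sylow_of_def k_def)
  have "n * card R = card (carrier G)"
    using lagrange[OF RG] by (simp add: n_def order_def)
  moreover have "card (carrier G) \<noteq> 0" using fin carrier_not_empty by simp
  ultimately have nd: "\<not> r dvd n"
    using sylow_of_index R r by blast
  have V_pow: "V (x [^] (m::nat)) = V x [^] m" if "x \<in> carrier G" for x m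
    using that by (rule V.hom_nat_pow)
  have ker: "V g = \<one> \<longleftrightarrow> \<not> r dvd ord g" if g: "g \<in> carrier G" for g
  proof
    assume Vg: "V g = \<one>"
    show "\<not> r dvd ord g"
    proof
      assume "r dvd ord g"
      then obtain m :: nat where m: "ord (g [^] m) = r" using exists_prime_order_pow g r by blast
      define y where "y = g [^] m"
      have y: "y \<in> carrier G" "ord y = r" "V y = \<one>" using g m Vg by (simp_all add: y_def V_pow)
      \<comment> \<open>A kernel element of order \<open>r\<close> is conjugated into
        \<open>R\<close>, where the transfer is the \<open>n\<close>-th power; so \<open>r\<close>
        would divide \<open>n\<close>.\<close>
      have "card (cyc y) = r ^ 1" using y by (simp add: card_cyc)
      then obtain h where h: "h \<in> carrier G" "\<And>q. q \<in> cyc y \<Longrightarrow> conjg h q \<in> R"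
        using sylow_conj_into[OF subgroup_self r R subgroup_cyc[OF y(1)]] subgroup.subset[OF subgroup_cyc[OF y(1)]]
        by metis
      have z: "conjg h y \<in> R" using h self_in_cyc y by blast
      have "V (conjg h y) = \<one>" using h y by (simp add: conjg_def)
      then have "conjg h y [^] n = \<one>" using V(3)[OF z] by (simp add: n_def)
      then have "ord (conjg h y) dvd n" using z by (simp add: pow_eq_id)
      then show False using nd ord_conjg h y by simp
    qed
  next
    assume nr: "\<not> r dvd ord g"
    have "V g \<in> R" using V(2) g by blast
    then have "ord (V g) dvd r ^ k" using ord_dvd_card_subgroup[OF RG] k by metis
    moreover have "V g [^] ord g = \<one>" using g by (simp flip: V_pow)
    then have "ord (V g) dvd ord g" using g by (simp add: pow_eq_id)
    moreover have "coprime (r ^ k) (ord g)" using nr r by (simp add: prime_imp_coprime)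
    ultimately have "ord (V g) = 1" by (rule coprime_common_divisor_nat[rotated])
    then show "V g = \<one>" using g ord_eq_1 by simp
  qed
  have "{g \<in> carrier G. \<not> r dvd ord g} = kernel G G V" using ker by (auto simp: kernel_def)
  then show "subgroup {g \<in> carrier G. \<not> r dvd ord g} G" using V.subgroup_kernel by simp
  assume g: "g \<in> carrier G"
  have "coprime n (r ^ k)" using prime_imp_coprime[OF r nd] by (simp add: coprime_commute)
  then obtain m where m: "[n * m = 1] (mod r ^ k)" using cong_solve_coprime_nat[of n "r ^ k"] by auto
  define y where "y = V g [^] m"
  have VgR: "V g \<in> R" using V(2) g by blast
  have yR: "y \<in> R" unfolding y_def using VgR RG by (simp add: subgroup_pow)
  have "V y = V g [^] (n * m)" using V(3)[OF yR] VgR by (simp add: y_def n_def nat_pow_pow mult.commute)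
  also have "\<dots> = V g [^] (1::nat)"
  proof -
    have "[n * m = 1] (mod ord (V g))"
      using m ord_dvd_card_subgroup[OF RG VgR] k cong_dvd_modulus_nat by metis
    then show ?thesis using VgR by (subst pow_eq_iff_cong) simp_all
  qed
  finally have "V (g \<otimes> inv y) = \<one>" using g yR VgR by simp
  then show "\<exists>y \<in> R. \<not> r dvd ord (g \<otimes> inv y)" using ker[of "g \<otimes> inv y"] g yR by auto
qed

end

section \<open>Cyclic \<open>p\<close>-groups\<close>

text \<open>With \<open>k = 1 + r c\<close> the sum is \<open>r + r^2 c (r - 1) / 2\<close> modulo
  \<open>r^2\<close>, and \<open>(r - 1) / 2\<close> is an integer as \<open>r\<close> is odd; hence
  exactly one factor \<open>r\<close>. The sum arises as exponent when an element
  \<open>b \<otimes> a [^] i\<close> is raised to the power \<open>r\<close>.\<close>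

lemma geometric_sum_cong:
  fixes r k :: nat
  assumes r: "prime r" "odd r" and k: "[k = 1] (mod r)"
  obtains u where "(\<Sum>i<r. k ^ i) = r * u" "coprime u r"
proof -
  have "r > 1" using r prime_gt_1_nat by simp
  obtain c where c: "int k = 1 + int r * c"
    using k by (metis cong_iff_dvd_diff cong_int_iff dvdE int_ops(2) add.commute diff_add_cancel)
  have pw: "[int k ^ i = 1 + int i * int r * c] (mod int r ^ 2)" for i
  proof (induction i)
    case (Suc i)
    have "[int k ^ Suc i = (1 + int r * c) * (1 + int i * int r * c)] (mod int r ^ 2)"
      using cong_mult[OF cong_refl Suc, of "int k"] c by simp
    moreover have "(1 + int r * c) * (1 + int i * int r * c)
        = (1 + int (Suc i) * int r * c) + int r ^ 2 * (int i * c * c)"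
      by (simp add: algebra_simps power2_eq_square)
    ultimately show ?case by (simp add: cong_def)
  qed simp
  have "[(\<Sum>i<r. int k ^ i) = (\<Sum>i<r. 1 + int i * int r * c)] (mod int r ^ 2)"
    by (intro cong_sum pw)
  moreover have "(\<Sum>i<r. 1 + int i * int r * c) = int r + int r * c * (\<Sum>i<r. int i)"
    by (simp add: sum.distrib sum_distrib_left mult_ac)
  moreover have "(\<Sum>i<r. int i) = int r * ((int r - 1) div 2)"
  proof -
    have "2 * (\<Sum>i<n. int i) = int n * (int n - 1)" for n
      by (induction n) (simp_all add: algebra_simps)
    moreover have "2 * ((int r - 1) div 2) = int r - 1" using r(2) by simp
    ultimately have "2 * (\<Sum>i<r. int i) = 2 * (int r * ((int r - 1) div 2))"
      by (metis mult.left_commute)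
    then show ?thesis by simp
  qed
  ultimately have "[int (\<Sum>i<r. k ^ i) = int r + int r * c * (int r * ((int r - 1) div 2))] (mod int r ^ 2)"
    by simp
  also have "int r + int r * c * (int r * ((int r - 1) div 2)) = int r + int r ^ 2 * (c * ((int r - 1) div 2))"
    by (simp add: power2_eq_square algebra_simps)
  also have "[\<dots> = int r] (mod int r ^ 2)" by (simp add: cong_def)
  finally have "[(\<Sum>i<r. k ^ i) = r] (mod r ^ 2)"
    by (metis cong_int_iff of_nat_power)
  then have sq: "[(\<Sum>i<r. k ^ i) = r] (mod r * r)" by (simp add: power2_eq_square)
  then have "r dvd (\<Sum>i<r. k ^ i)"
    by (metis cong_dvd_iff cong_dvd_modulus_nat dvd_refl dvd_triv_left)
  then obtain u where u: "(\<Sum>i<r. k ^ i) = r * u" by auto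
  have "[r * u = r * 1] (mod r * r)" using sq u by simp
  then have "[u = 1] (mod r)"
    using \<open>r > 1\<close> by (metis cong_def mult_mod_right mult_cancel1 not_one_less_zero)
  then have "coprime u r" by (metis cong_imp_coprime cong_sym coprime_1_left)
  with u that show ?thesis by blast
qed

context finite_group
begin

text \<open>\<open>A\<close> acts on its \<open>r\<close> right cosets in \<open>R\<close> and fixes
  \<open>A\<close> itself. The number of fixed cosets is a multiple of \<open>r\<close>, so there is
  a second one, and its representative normalizes \<open>A\<close>.\<close>

lemma exists_nonmember_normalizing:
  assumes R: "subgroup R G" "card R = r ^ Suc n" and r: "prime r"
    and A: "subgroup A G" "A \<subseteq> R" "card A = r ^ n"
  obtains b where "b \<in> R" "b \<notin> A" "\<And>a. a \<in> A \<Longrightarrow> conjg b a \<in> A" "b [^] r \<in> A"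
proof -
  note [simp] = subgroup.mem_carrier[OF R(1)] subgroup.mem_carrier[OF A(1)]
  have AC: "A \<subseteq> carrier G" by auto
  define S where "S = {A #> m | m. m \<in> R}"
  have S: "S = rcosets\<^bsub>G\<lparr>carrier := R\<rparr>\<^esub> A" by (auto simp: S_def RCOSETS_def)
  have "card S * card A = card R"
    using group.lagrange[OF subgroup_group[OF R(1)] subgroup_in_subgroup[OF R(1) A(1,2)]]
    by (simp add: S order_def)
  then have cS: "card S = r" using R A r prime_gt_0_nat by auto
  define F where "F = {s \<in> S. \<forall>g \<in> A. s #> inv g = s}"
  have "[card S = card {s \<in> S. \<forall>g \<in> carrier (G\<lparr>carrier := A\<rparr>). s #> inv g = s}] (mod r)"
  proof (rule pgroup_fixed_points)
    show "finite S" unfolding S_def using finite_subgroup[OF R(1)] by simp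
    show "s #> inv g \<in> S" if "g \<in> carrier (G\<lparr>carrier := A\<rparr>)" "s \<in> S" for g s
    proof -
      obtain m where m: "m \<in> R" "s = A #> m" using \<open>s \<in> S\<close> by (auto simp: S_def)
      moreover have "m \<otimes> inv g \<in> R"
        using m that A(2) by (simp add: subgroup.m_closed[OF R(1)] subgroup.m_inv_closed[OF R(1)] subset_eq)
      ultimately show ?thesis using that AC by (auto simp: S_def coset_mult_assoc)
    qed
    show "s #> inv \<one>\<^bsub>G\<lparr>carrier := A\<rparr>\<^esub> = s" if "s \<in> S" for s
      using that AC by (auto simp: S_def coset_mult_assoc)
    show "s #> inv (g \<otimes>\<^bsub>G\<lparr>carrier := A\<rparr>\<^esub> h) = s #> inv h #> inv g"
      if "g \<in> carrier (G\<lparr>carrier := A\<rparr>)" "h \<in> carrier (G\<lparr>carrier := A\<rparr>)" "s \<in> S" for g h s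
      using that AC by (auto simp: S_def coset_mult_assoc inv_mult_group m_assoc)
  qed (use A r in \<open>simp_all add: subgroup_group\<close>)
  then have "[r = card F] (mod r)" using cS by (simp add: F_def)
  then have "r dvd card F" by (metis cong_dvd_iff dvd_refl)
  have AF: "A \<in> F" using A R by (auto simp: F_def S_def coset_join2 subgroup.one_closed
      subgroup.m_inv_closed intro!: exI[of _ \<one>])
  have "F \<noteq> {A}" using \<open>r dvd card F\<close> r by auto
  then obtain s where s: "s \<in> F" "s \<noteq> A" using AF by blast
  then obtain b where b: "b \<in> R" "s = A #> b" by (auto simp: F_def S_def)
  have bA: "b \<notin> A" using s b A by (auto simp: coset_join2)
  have nb: "conjg b a \<in> A" if a: "a \<in> A" for a
  proof -
    have "s #> inv (inv a) = s"
      using s(1) a subgroup.m_inv_closed[OF A(1)] unfolding F_def by blast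
    then have "A #> b #> a = A #> b" using a b by simp
    then have "A #> (b \<otimes> a) = A #> b" using a b AC by (simp add: coset_mult_assoc)
    moreover have "b \<otimes> a \<in> A #> (b \<otimes> a)" using a b A by (simp add: rcos_self)
    ultimately have "b \<otimes> a \<in> A #> b" by simp
    then show ?thesis using subgroup.rcos_module[OF A(1) is_group] a b by (simp add: conjg_def)
  qed
  \<comment> \<open>Iterated \<open>r\<close>-th powers of \<open>b\<close> end in \<one>; the last
    one before entering \<open>A\<close> still normalizes \<open>A\<close> and has its
    \<open>r\<close>-th power in \<open>A\<close>.\<close>
  define c where "c i = b [^] (r ^ i)" for i :: nat
  have cR: "c i \<in> R" for i using b R by (simp add: c_def subgroup_pow)
  have cn: "conjg (c i) a \<in> A" if "a \<in> A" for i a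
  proof -
    have "conjg (b [^] m) a \<in> A" for m :: nat
    proof (induction m)
      case (Suc m)
      have "conjg (b [^] Suc m) a = conjg b (conjg (b [^] m) a)"
        using b that nat_pow_Suc2[of b m] by (simp add: conjg_conjg)
      then show ?case using nb Suc by simp
    qed (use that in simp)
    then show ?thesis by (simp add: c_def)
  qed
  have c0: "c 0 \<notin> A" using bA b by (simp add: c_def)
  have "c (Suc n) = \<one>"
    using ord_dvd_card_subgroup[OF R(1) b(1)] R(2) b by (simp add: c_def pow_eq_id)
  then have cn1: "c (Suc n) \<in> A" using A by (simp add: subgroup.one_closed)
  have "c i \<notin> A" if "\<And>j. c j \<notin> A \<Longrightarrow> c (Suc j) \<notin> A" for i
    by (induction i) (use c0 that in blast)+
  with cn1 obtain i where i: "c i \<notin> A" "c (Suc i) \<in> A" by blast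
  have "c i [^] r \<in> A" using i(2) b by (simp add: c_def nat_pow_pow mult.commute)
  with i cn cR that show ?thesis by blast
qed

text \<open>
  Let \<open>A = cyc a\<close> have index \<open>r\<close> in \<open>R\<close> and let \<open>b\<close> lie outside \<open>A\<close>.  If \<open>b [^] r\<close> does not generate
  \<open>A\<close>, it is an \<open>r\<close>-th power in \<open>A\<close>, and as \<open>r\<close> is odd some \<open>b \<otimes> a [^] i\<close> has order \<open>r\<close>; together
  with the elements of order \<open>r\<close> in \<open>A\<close> it contradicts the rank assumption.
\<close>

lemma cyclic_pgroup:
  assumes R: "subgroup R G" "card R = r ^ n" and r: "prime r" "odd r"
    and no_rank2: "\<And>x y. \<lbrakk>x \<in> R; y \<in> R; x [^] r = \<one>; ord y = r; commute x y\<rbrakk> \<Longrightarrow> x \<in> cyc y"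
  shows "\<exists>a \<in> R. R = cyc a"
  using R no_rank2
proof (induction n arbitrary: R)
  case 0
  then have "card R = 1" by simp
  then have "R = {\<one>}" using subgroup.one_closed[OF 0(1)] by (metis card_1_singletonE singletonD)
  then show ?case by (auto simp: cyc_def)
next
  case (Suc n)
  note R = Suc.prems(1,2)
  note [simp] = subgroup.mem_carrier[OF R(1)]
  obtain A where A: "subgroup A G" "A \<subseteq> R" "card A = r ^ n"
    using exists_sylow[OF R(1) r(1), of n] R(2) by auto
  obtain a where a: "a \<in> A" "A = cyc a"
    using Suc.IH[OF A(1,3)] Suc.prems(3) A(2) by blast
  have aR: "a \<in> R" using a A by blast
  have oa: "ord a = r ^ n" using a A(3) aR by (simp add: card_cyc)
  obtain b where b: "b \<in> R" "b \<notin> A" "\<And>a. a \<in> A \<Longrightarrow> conjg b a \<in> A" "b [^] r \<in> A"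
    using exists_nonmember_normalizing[OF R r(1) A] by blast
  obtain l where l: "b [^] r = a [^] (l::nat)" using b(4) a(2) by (auto simp: cyc_def)
  show ?case
  \<comment> \<open>For \<open>n = 0\<close> the trivial group \<open>A\<close> is generated by
    \<open>b [^] r\<close> whatever \<open>l\<close> is, so this joins the case in which
    \<open>b\<close> generates \<open>R\<close>.\<close>
  proof (cases "r dvd l \<and> n > 0")
    case False
    have "ord (a [^] l) = r ^ n"
    proof (cases "n = 0")
      case True
      then have "a = \<one>" using oa ord_eq_1[of a] aR by simp
      then show ?thesis using True by simp
    next
      case False
      with \<open>\<not> (r dvd l \<and> n > 0)\<close> have nl: "\<not> r dvd l" by simp
      then have "l \<noteq> 0" using dvd_0_right by metis
      have "coprime (ord a) l" using prime_imp_coprime[OF r(1) nl] oa by simp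
      then have "gcd (ord a) l = 1" by (simp only: coprime_iff_gcd_eq_1)
      then show ?thesis using ord_pow_gen[of a l] aR oa \<open>l \<noteq> 0\<close> by simp
    qed
    then have ob: "ord (b [^] r) = r ^ n" using l by simp
    have "ord b dvd r ^ Suc n" using ord_dvd_card_subgroup[OF R(1) b(1)] R(2) by simp
    then obtain i where i: "i \<le> Suc n" "ord b = r ^ i" using r divides_primepow_nat by blast
    have "i = Suc n"
    proof (rule ccontr)
      assume "i \<noteq> Suc n"
      then have "r ^ i dvd r ^ n" using i by (simp add: le_imp_power_dvd)
      then have "card (cyc b) \<le> card A" using i b A(3) r by (simp add: card_cyc dvd_imp_le prime_gt_0_nat)
      moreover have "A \<subseteq> cyc b"
      proof -
        have "card A = card (cyc (b [^] r))" using ob A(3) b by (simp add: card_cyc)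
        moreover have "cyc (b [^] r) \<subseteq> A" using b A by (simp add: cyc_subset)
        ultimately have "cyc (b [^] r) = A" using finite_subgroup[OF A(1)] by (simp add: card_subset_eq)
        moreover have "cyc (b [^] r) \<subseteq> cyc b"
          using b by (intro cyc_subset subgroup_cyc) (auto simp: cyc_def)
        ultimately show ?thesis by simp
      qed
      ultimately have "A = cyc b" using b finite_subgroup[OF subgroup_cyc[of b]] by (simp add: card_seteq)
      then show False using b self_in_cyc[of b] by simp
    qed
    then have "card (cyc b) = card R" using b R(2) i by (simp add: card_cyc)
    then have "cyc b = R" using b R finite_subgroup by (intro card_subset_eq cyc_subset) auto
    with b show ?thesis by blast
  next
    case True
    then obtain j where j: "l = r * j" by auto
    have an: "ord a = r * r ^ (n - 1)" using True oa by (simp flip: power_Suc)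
    have "conjg (inv b) a \<in> A"
    proof -
      have "conjg b ` A = A" using b A by (intro conjg_image_eqI) auto
      then obtain a' where "a' \<in> A" "a = conjg b a'" using a by blast
      then show ?thesis using b A by auto
    qed
    then obtain k where k: "conjg (inv b) a = a [^] (k::nat)" using a by (auto simp: cyc_def)
    have ab: "a [^] i \<otimes> b = b \<otimes> a [^] (k * i)" for i :: nat
    proof -
      have "b \<otimes> conjg (inv b) (a [^] i) = a [^] i \<otimes> b" using b aR by (simp add: conjg_def m_assoc)
      moreover have "conjg (inv b) (a [^] i) = a [^] (k * i)" using b aR k by (simp add: conjg_pow nat_pow_pow)
      ultimately show ?thesis by simp
    qed
    have abn: "a [^] i \<otimes> b [^] m = b [^] m \<otimes> a [^] (k ^ m * i)" for i m :: nat
    proof (induction m)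
      case (Suc m)
      have "a [^] i \<otimes> b [^] Suc m = (a [^] i \<otimes> b [^] m) \<otimes> b" using b aR by (simp add: m_assoc)
      also have "\<dots> = b [^] m \<otimes> (a [^] (k ^ m * i) \<otimes> b)" using Suc b aR by (simp add: m_assoc)
      also have "\<dots> = b [^] Suc m \<otimes> a [^] (k ^ Suc m * i)" using ab b aR by (simp add: m_assoc mult_ac)
      finally show ?case .
    qed (use aR in simp)
    \<comment> \<open>Conjugation by the inverse of \<open>b [^] r\<close> raises \<open>a\<close>
      to the power \<open>k ^ r\<close>, yet it is trivial because \<open>b [^] r = a [^] l\<close>.
      With Fermat's theorem, \<open>k\<close> is 1 modulo \<open>r\<close>.\<close>
    have "commute a (a [^] l)" using aR by (simp add: commute_pow)
    moreover have "a \<otimes> a [^] l = a [^] l \<otimes> a [^] (k ^ r)" using abn[of 1 r] l aR by simp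
    ultimately have "a [^] l \<otimes> a [^] (k ^ r) = a [^] l \<otimes> a" by (simp add: commute_def)
    then have "a [^] (k ^ r) = a [^] (1::nat)" using aR by simp
    then have "[k ^ r = 1] (mod ord a)" using aR by (subst (asm) pow_eq_iff_cong) simp_all
    then have "[k ^ r = 1] (mod r)" by (rule cong_dvd_modulus_nat) (simp add: an)
    moreover have "[k ^ r = k] (mod r)"
    proof (cases "r dvd k")
      case True
      then have "r dvd k ^ r" using prime_gt_0_nat[OF r(1)] by (intro dvd_trans[OF True dvd_power]) simp
      then show ?thesis using True by (simp add: cong_def mod_eq_0_iff_dvd)
    next
      case False
      have "[k ^ (r - 1) * k = 1 * k] (mod r)"
        using fermat_theorem[OF r(1) False] by (intro cong_mult) auto
      moreover have "k ^ (r - 1) * k = k ^ r"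
        using prime_gt_0_nat[OF r(1)] by (rule power_minus_mult)
      ultimately show ?thesis by simp
    qed
    ultimately have k1: "[k = 1] (mod r)" using cong_sym cong_trans by blast
    obtain u where u: "(\<Sum>i<r. k ^ i) = r * u" "coprime u r"
      using geometric_sum_cong[OF r k1] by blast
    have "coprime u (ord a)" using u oa by simp
    then obtain v where v: "[u * v = 1] (mod ord a)" using cong_solve_coprime_nat[of u "ord a"] by auto
    \<comment> \<open>Since
      \<open>(b \<otimes> a [^] i) [^] r = a [^] (r * j + i * (r * u))\<close>, the exponent
      \<open>i\<close> should be \<open>- j / u\<close> modulo \<open>ord a\<close>; here
      \<open>v\<close> inverts \<open>u\<close> and \<open>ord a - 1\<close> stands for
      \<open>- 1\<close>.\<close>
    define i where "i = v * (ord a - 1) * j"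
    define c where "c = b \<otimes> a [^] i"
    have cR: "c \<in> R" using b aR R by (simp add: c_def subgroup.m_closed subgroup_pow)
    have cm: "c [^] m = b [^] m \<otimes> a [^] (i * (\<Sum>t<m. k ^ t))" for m :: nat
    proof (induction m)
      case (Suc m)
      have "c [^] Suc m = c \<otimes> c [^] m" using cR by (intro nat_pow_Suc2) simp
      also have "\<dots> = b \<otimes> (a [^] i \<otimes> b [^] m) \<otimes> a [^] (i * (\<Sum>t<m. k ^ t))"
        using Suc b aR by (simp add: c_def m_assoc)
      also have "\<dots> = (b \<otimes> b [^] m) \<otimes> a [^] (k ^ m * i + i * (\<Sum>t<m. k ^ t))"
        unfolding abn using b aR by (simp add: m_assoc nat_pow_mult del: nat_pow_Suc)
      also have "b \<otimes> b [^] m = b [^] Suc m" using b by (intro nat_pow_Suc2[symmetric]) simp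
      also have "k ^ m * i + i * (\<Sum>t<m. k ^ t) = i * (\<Sum>t<Suc m. k ^ t)" by (simp add: algebra_simps)
      finally show ?case .
    qed simp
    have "c [^] r = a [^] (r * j + i * (r * u))"
      unfolding cm u l j using aR by (simp add: nat_pow_mult)
    also have "\<dots> = \<one>"
    proof -
      have "[r * j + r * j * (u * v * (ord a - 1)) = r * j + r * j * (1 * (ord a - 1))] (mod ord a)"
        using v by (intro cong_add cong_mult cong_refl)
      also have "r * j + r * j * (1 * (ord a - 1)) = r * j * ord a"
        using ord_pos[of a] aR by (simp add: algebra_simps)
      also have "[\<dots> = 0] (mod ord a)" by (simp add: cong_def)
      finally have "[r * j + i * (r * u) = 0] (mod ord a)" by (simp add: i_def mult_ac)
      then show ?thesis using aR by (simp add: pow_eq_id cong_0_iff)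
    qed
    finally have cr: "c [^] r = \<one>" .
    \<comment> \<open>An element of order \<open>r\<close> in \<open>A\<close>; it commutes with
      \<open>b\<close> as \<open>k\<close> is 1 modulo \<open>r\<close>. The rank assumption then
      puts \<open>c\<close>, and with it \<open>b\<close>, into \<open>A\<close>.\<close>
    define z where "z = a [^] (r ^ (n - 1))"
    have zA: "z \<in> A" using a A by (simp add: z_def subgroup_pow)
    have zR: "z \<in> R" using zA A by blast
    have oz: "ord z = r" unfolding z_def
      using ord_pow[of a "r ^ (n - 1)"] an aR r by (simp add: prime_gt_0_nat)
    have "commute z c"
    proof -
      have "z \<otimes> b = b \<otimes> a [^] (k * r ^ (n - 1))" unfolding z_def by (rule ab)
      also have "a [^] (k * r ^ (n - 1)) = a [^] (1 * r ^ (n - 1))"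
      proof -
        have "[k * r ^ (n - 1) = 1 * r ^ (n - 1)] (mod r * r ^ (n - 1))"
          using k1 by (metis cong_def mult_mod_left)
        then show ?thesis using aR an by (simp only: pow_eq_iff_cong[of a] subgroup.mem_carrier[OF R(1)])
      qed
      finally have "commute z b" by (simp add: commute_def z_def)
      moreover have "commute z (a [^] i)" using aR by (simp add: z_def commute_def nat_pow_mult add.commute)
      ultimately show ?thesis unfolding c_def using zR b aR by (intro commute_mult) auto
    qed
    then have "c \<in> cyc z" using Suc.prems(3)[OF cR zR cr oz] by (simp add: commute_sym)
    then have "c \<in> A" using cyc_subset[OF A(1) zA] by blast
    have "b = c \<otimes> inv (a [^] i)" using b aR by (simp add: c_def m_assoc)
    moreover have "inv (a [^] i) \<in> A" using a A by (simp add: subgroup_pow subgroup.m_inv_closed)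
    ultimately have "b \<in> A" using \<open>c \<in> A\<close> A by (simp add: subgroup.m_closed)
    with b show ?thesis by simp
  qed
qed

end

section \<open>Free actions\<close>

lemma (in comm_monoid) finprod_swap:
  assumes "finite A" "finite B" "\<And>a b. a \<in> A \<Longrightarrow> b \<in> B \<Longrightarrow> f a b \<in> carrier G"
  shows "finprod G (\<lambda>a. finprod G (f a) B) A = finprod G (\<lambda>b. finprod G (\<lambda>a. f a b) A) B"
  using assms(1,3)
proof (induction A rule: finite_induct)
  case (insert a A)
  have "finprod G (\<lambda>b. finprod G (\<lambda>a. f a b) (insert a A)) B
      = finprod G (\<lambda>b. f a b \<otimes> finprod G (\<lambda>a. f a b) A) B"
    using insert by (intro finprod_cong') (auto simp: Pi_def)
  also have "\<dots> = finprod G (f a) B \<otimes> finprod G (\<lambda>b. finprod G (\<lambda>a. f a b) A) B"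
    using insert by (intro finprod_multf) (auto simp: Pi_def)
  finally show ?case using insert by (simp add: Pi_def)
qed simp

context finite_group
begin

lemma conjg_finprod:
  assumes V: "subgroup V G" "comm_group (G\<lparr>carrier := V\<rparr>)"
    and g: "g \<in> carrier G" "\<And>v. v \<in> V \<Longrightarrow> conjg g v \<in> V"
    and f: "finite A" "\<And>a. a \<in> A \<Longrightarrow> f a \<in> V"
  shows "conjg g (finprod (G\<lparr>carrier := V\<rparr>) f A) = finprod (G\<lparr>carrier := V\<rparr>) (\<lambda>a. conjg g (f a)) A"
  using f
proof (induction A rule: finite_induct)
  case empty
  interpret V: comm_group "G\<lparr>carrier := V\<rparr>" by fact
  show ?case using V.finprod_empty g by simp
next
  case (insert a A)
  interpret V: comm_group "G\<lparr>carrier := V\<rparr>" by fact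
  have m: "finprod (G\<lparr>carrier := V\<rparr>) f A \<in> V"
    using V.finprod_closed[of f A] insert by (simp add: Pi_def)
  show ?case
    using insert g m V.finprod_insert[of A a f] V.finprod_insert[of A a "\<lambda>a. conjg g (f a)"]
    by (simp add: Pi_def conjg_mult subgroup.mem_carrier[OF V(1)])
qed

text \<open>
  For \<open>b \<noteq> \<one>\<close> of order \<open>r\<close> the product of the conjugates of \<open>v\<close> by the powers of \<open>b\<close> is fixed
  by \<open>b\<close>, hence trivial.  Multiplying over \<open>b = x \<otimes> y [^] i\<close> for \<open>i < r\<close> leaves \<open>v [^] r\<close>, as the
  factors with \<open>j\<close>-th powers, \<open>0 < j < r\<close>, form such a product for \<open>y\<close>.
\<close>

lemma free_rank2_exponent:
  fixes r :: nat
  assumes E: "subgroup E G" and V: "subgroup V G" and ab: "\<And>u v. u \<in> V \<Longrightarrow> v \<in> V \<Longrightarrow> commute u v"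
    and EV: "\<And>g v. g \<in> E \<Longrightarrow> v \<in> V \<Longrightarrow> conjg g v \<in> V"
    and free: "\<And>g v. g \<in> E \<Longrightarrow> g \<noteq> \<one> \<Longrightarrow> v \<in> V \<Longrightarrow> commute g v \<Longrightarrow> v = \<one>"
    and r: "prime r"
    and xy: "x \<in> E" "y \<in> E" "commute x y" "x [^] r = \<one>" "y [^] r = \<one>" "y \<noteq> \<one>" "x \<notin> cyc y"
    and v: "v \<in> V"
  shows "v [^] r = \<one>"
proof -
  note [simp] = subgroup.mem_carrier[OF E] subgroup.mem_carrier[OF V]
  have r0: "r > 0" using r prime_gt_0_nat by blast
  have VC: "V \<subseteq> carrier G" by auto
  define C where "C = G\<lparr>carrier := V\<rparr>"
  interpret C: comm_group C unfolding C_def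
    by (rule group.group_comm_groupI) (use subgroup_group[OF V] ab in \<open>auto simp: commute_def\<close>)
  have C [simp]: "carrier C = V" "\<one>\<^bsub>C\<^esub> = \<one>" "u \<otimes>\<^bsub>C\<^esub> v = u \<otimes> v" for u v
    by (simp_all add: C_def)
  have CC: "comm_group (G\<lparr>carrier := V\<rparr>)" using C.comm_group_axioms by (simp add: C_def)
  have pE [simp]: "g [^] (n::nat) \<in> E" if "g \<in> E" for g n using E that by (rule subgroup_pow)
  have pow_mod: "b [^] (i mod r) = b [^] i" if "b \<in> E" "b [^] r = \<one>" for b and i :: nat
  proof -
    have "ord b dvd r" using that by (simp add: pow_eq_id)
    moreover have "[i mod r = i] (mod r)" by simp
    ultimately have "[i mod r = i] (mod ord b)" using cong_dvd_modulus_nat by blast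
    then show ?thesis using that by (simp add: pow_eq_iff_cong)
  qed
  define N where "N b u = finprod C (\<lambda>j. conjg (b [^] j) u) {..<r}" for b u
  have NV: "N b u \<in> V" if "b \<in> E" "u \<in> V" for b u
    using C.finprod_closed[of "\<lambda>j. conjg (b [^] j) u" "{..<r}"] EV that by (simp add: N_def Pi_def)
  have N1: "N b u = \<one>" if b: "b \<in> E" "b [^] r = \<one>" "b \<noteq> \<one>" "u \<in> V" for b u
  proof -
    define s where "s j = Suc j mod r" for j
    have s: "inj_on s {..<r}"
    proof (rule inj_onI)
      fix i j assume "i \<in> {..<r}" "j \<in> {..<r}" "s i = s j"
      then have "[Suc i = Suc j] (mod r)" by (simp add: s_def cong_def)
      then have "[i = j] (mod r)" using cong_add_rcancel_nat[of i 1 j r] by simp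
      then show "i = j" using \<open>i \<in> {..<r}\<close> \<open>j \<in> {..<r}\<close> by (simp add: cong_less_modulus_unique_nat)
    qed
    have s': "s ` {..<r} = {..<r}" by (rule endo_inj_surj) (use s r0 in \<open>auto simp: s_def\<close>)
    have "conjg b (N b u) = finprod C (\<lambda>j. conjg b (conjg (b [^] j) u)) {..<r}"
      unfolding N_def C_def using CC EV b by (intro conjg_finprod V) auto
    also have "\<dots> = finprod C (\<lambda>j. conjg (b [^] s j) u) {..<r}"
    proof (rule C.finprod_cong')
      show "conjg b (conjg (b [^] j) u) = conjg (b [^] s j) u" for j
        using b by (simp add: conjg_conjg s_def pow_mod nat_pow_Suc2[of b j, symmetric] del: nat_pow_Suc)
    qed (use EV b in auto)
    also have "\<dots> = N b u"
      using C.finprod_reindex[of "\<lambda>j. conjg (b [^] j) u" s "{..<r}"] s s' EV b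
      by (simp add: N_def Pi_def)
    finally have "commute b (N b u)" using NV[of b u] b by (simp add: conjg_eq_self_iff)
    then show ?thesis using free b NV by blast
  qed
  have xyi: "x \<otimes> y [^] i \<in> E" "(x \<otimes> y [^] i) [^] j = x [^] j \<otimes> y [^] (i * j)" for i j :: nat
  proof -
    show "x \<otimes> y [^] i \<in> E" using xy E by (simp add: subgroup.m_closed)
    show "(x \<otimes> y [^] i) [^] j = x [^] j \<otimes> y [^] (i * j)"
      using xy commute_pow[of y x i] pow_mult_distrib[of x "y [^] i" j]
      by (simp add: commute_def nat_pow_pow)
  qed
  have xyr: "(x \<otimes> y [^] i) [^] r = \<one>" for i :: nat
    using xy by (simp add: xyi) (metis mult.commute nat_pow_pow nat_pow_one subgroup.mem_carrier[OF E])
  \<comment> \<open>Here \<open>x \<notin> cyc y\<close> enters: norms vanish only for nontrivial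
    elements.\<close>
  have xyn: "x \<otimes> y [^] i \<noteq> \<one>" for i :: nat
  proof
    assume "x \<otimes> y [^] i = \<one>"
    then have "x = inv (y [^] i)" using xy by (intro inv_equality[symmetric]) auto
    then have "x \<in> cyc y" using xy subgroup_cyc[of y] by (auto simp: cyc_def subgroup.m_inv_closed)
    with xy show False by simp
  qed
  have inner: "finprod C (\<lambda>i. conjg ((x \<otimes> y [^] i) [^] j) v) {..<r} = (if j = 0 then v [^] r else \<one>)"
    if j: "j < r" for j
  proof (cases "j = 0")
    case True
    have "finprod C (\<lambda>i. v) {..<r} = v [^]\<^bsub>C\<^esub> r" using C.finprod_const[of v "{..<r}"] v by simp
    then show ?thesis using True v by (simp add: C_def flip: nat_pow_consistent)
  next
    case False
    define s where "s i = i * j mod r" for i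
    have cop: "coprime j r" using j False r
      by (metis coprime_commute dvd_imp_le gr0I not_less prime_imp_coprime)
    have s: "inj_on s {..<r}"
    proof (rule inj_onI)
      fix a b assume "a \<in> {..<r}" "b \<in> {..<r}" "s a = s b"
      then have "[a * j = b * j] (mod r)" by (simp add: s_def cong_def)
      then have "[a = b] (mod r)" using cop by (simp add: cong_mult_rcancel_nat)
      then show "a = b" using \<open>a \<in> {..<r}\<close> \<open>b \<in> {..<r}\<close> by (simp add: cong_less_modulus_unique_nat)
    qed
    have s': "s ` {..<r} = {..<r}" by (rule endo_inj_surj) (use s r0 in \<open>auto simp: s_def\<close>)
    define u where "u = conjg (x [^] j) v"
    have u: "u \<in> V" using EV xy v by (simp add: u_def)
    have "finprod C (\<lambda>i. conjg ((x \<otimes> y [^] i) [^] j) v) {..<r} = finprod C (\<lambda>i. conjg (y [^] s i) u) {..<r}"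
    proof (rule C.finprod_cong')
      show "conjg ((x \<otimes> y [^] i) [^] j) v = conjg (y [^] s i) u" for i
      proof -
        have "x [^] j \<otimes> y [^] (i * j) = y [^] (i * j) \<otimes> x [^] j"
          using commute_pow_pow[of x y j "i * j"] xy by (simp add: commute_def)
        then show ?thesis using xy v by (simp add: xyi u_def conjg_conjg s_def pow_mod)
      qed
    qed (use EV xy u in auto)
    also have "\<dots> = N y u"
      using C.finprod_reindex[of "\<lambda>i. conjg (y [^] i) u" s "{..<r}"] s s' EV xy u
      by (simp add: N_def Pi_def)
    finally show ?thesis using N1[of y u] xy u False by simp
  qed
  \<comment> \<open>Grouped by \<open>i\<close>, every factor is a vanishing norm; grouped by the
    exponent \<open>j\<close>, only \<open>j = 0\<close> contributes.\<close>
  have "\<one> = finprod C (\<lambda>i. N (x \<otimes> y [^] i) v) {..<r}"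
    using N1 xyi(1) xyr xyn v C.finprod_one_eqI[of "{..<r}" "\<lambda>i. N (x \<otimes> y [^] i) v"] by simp
  also have "\<dots> = finprod C (\<lambda>j. finprod C (\<lambda>i. conjg ((x \<otimes> y [^] i) [^] j) v) {..<r}) {..<r}"
    unfolding N_def using EV xyi(1) v by (intro C.finprod_swap) auto
  also have "\<dots> = finprod C (\<lambda>j. if j = 0 then v [^] r else \<one>) {..<r}"
    by (rule C.finprod_cong') (use inner v V in \<open>auto simp: subgroup_pow subgroup.one_closed\<close>)
  also have "\<dots> = finprod C (\<lambda>j. if 0 = j then v [^] r else \<one>\<^bsub>C\<^esub>) {..<r}"
    by (rule C.finprod_cong') (use v V in \<open>auto simp: subgroup_pow subgroup.one_closed\<close>)
  also have "\<dots> = v [^] r"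
    using C.finprod_singleton[of 0 "{..<r}" "\<lambda>_. v [^] r"] r0 v V by (simp add: subgroup_pow)
  finally show ?thesis by simp
qed

end

section \<open>Vertices that a normal subgroup does not reach\<close>

context finite_group
begin

text \<open>The least positive \<open>n\<close> with \<open>h [^] n \<in> C\<close> divides all such
  exponents, so a prime \<open>s\<close> dividing \<open>n\<close> would divide the part of
  \<open>ord h\<close> that is prime to \<open>s\<close>.\<close>

lemma mem_subgroup_of_primary_powers:
  assumes C: "subgroup C G" and h: "h \<in> carrier G"
    and prim: "\<And>s f m. prime s \<Longrightarrow> ord h = s ^ f * m \<Longrightarrow> \<not> s dvd m \<Longrightarrow> h [^] (m::nat) \<in> C"
  shows "h \<in> C"
proof -
  define n where "n = (LEAST n::nat. n > 0 \<and> h [^] n \<in> C)"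
  have "ord h > 0 \<and> h [^] ord h \<in> C" using h ord_pos subgroup.one_closed[OF C] by simp
  then have n: "n > 0" "h [^] n \<in> C" unfolding n_def by (metis (mono_tags, lifting) LeastI)+
  have dvd: "n dvd m" if "h [^] m \<in> C" for m :: nat
  proof -
    have "h [^] m = (h [^] n) [^] (m div n) \<otimes> h [^] (m mod n)"
      using h by (simp add: nat_pow_pow nat_pow_mult)
    then have "h [^] (m mod n) = inv ((h [^] n) [^] (m div n)) \<otimes> h [^] m" using h by simp
    then have "h [^] (m mod n) \<in> C"
      using C n that by (simp add: subgroup_pow subgroup.m_closed subgroup.m_inv_closed)
    moreover have "m mod n < n" using n by simp
    ultimately have "m mod n = 0"
      unfolding n_def using not_less_Least by (metis (no_types, lifting) gr0I)
    then show ?thesis by auto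
  qed
  have "n = 1"
  proof (rule ccontr)
    assume "n \<noteq> 1"
    then obtain s where s: "prime s" "s dvd n" using prime_factor_nat by blast
    obtain m where m: "ord h = s ^ multiplicity s (ord h) * m" "\<not> s dvd m"
      using multiplicity_decompose'[of "ord h" s] ord_pos[OF h] s(1)
      by (metis less_not_refl not_prime_unit)
    then have "n dvd m" using prim[OF s(1)] dvd by blast
    then show False using s m by (meson dvd_trans)
  qed
  then show ?thesis using n h by simp
qed

text \<open>A cyclic group has one subgroup of each order: equal orders mean that the exponents have
  the same gcd with \<open>ord a\<close>, and modulo \<open>ord a\<close> this gcd is a multiple of
  \<open>i\<close>.\<close>

lemma cyc_same_ord:
  assumes a: "a \<in> carrier G" and xy: "x \<in> cyc a" "y \<in> cyc a" "ord x = ord y"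
  shows "y \<in> cyc x"
proof -
  obtain i j :: nat where ij: "x = a [^] i" "y = a [^] j" using xy by (auto simp: cyc_def)
  have o: "ord a > 0" using a by (rule ord_pos)
  have ordp: "ord (a [^] k) * gcd k (ord a) = ord a" for k
    using ord_pow_gen[OF a, of k] o by (simp add: gcd.commute)
  have g: "gcd i (ord a) = gcd j (ord a)"
    using ordp[of i] ordp[of j] xy(3) o unfolding ij by (metis mult_cancel1 mult_is_0 not_gr_zero)
  obtain s where "[i * s = gcd i (ord a)] (mod ord a)"
  proof (cases "i = 0")
    case True
    then show ?thesis using that[of 0] by (simp add: cong_def)
  next
    case False
    then show ?thesis using that cong_solve_nat by blast
  qed
  then have "x [^] s = a [^] gcd j (ord a)" using a g by (simp add: ij nat_pow_pow pow_eq_iff_cong)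
  moreover obtain l where "j = gcd j (ord a) * l" using gcd_dvd1 by (metis dvdE)
  ultimately have "y = x [^] (s * l)" using a ij by (metis nat_pow_closed nat_pow_pow)
  then show ?thesis by (auto simp: cyc_def)
qed

lemma sylow_of_subgroup:
  assumes R: "sylow_of r R M" and r: "prime r" and M: "subgroup M G" and N: "subgroup N G" "R \<subseteq> N" "N \<subseteq> M"
  shows "sylow_of r R N"
proof -
  have RG: "subgroup R G" "card R = r ^ multiplicity r (card M)" using R by (auto simp: sylow_of_def)
  have pos: "card N \<noteq> 0" "card M \<noteq> 0"
    using subgroup.finite_imp_card_positive[OF N(1)] subgroup.finite_imp_card_positive[OF M] by auto
  have "card R dvd card N" "card N dvd card M"
    using subgroup_card_dvd[OF N(1) RG(1) N(2)] subgroup_card_dvd[OF M N(1) N(3)] by auto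
  then have "multiplicity r (card M) \<le> multiplicity r (card N)" "multiplicity r (card N) \<le> multiplicity r (card M)"
    using pos r RG power_dvd_iff_le_multiplicity[of "card N" r] prime_gt_1_nat[OF r]
    by (auto simp: dvd_imp_multiplicity_le)
  then show ?thesis using RG N by (simp add: sylow_of_def)
qed

lemma l_r_coset_conj: "H \<subseteq> carrier G \<Longrightarrow> g \<in> carrier G \<Longrightarrow> (g <# H) #> inv g = conjg g ` H"
  by (auto simp: l_coset_def r_coset_def conjg_def)

lemma frobenius_groupI:
  assumes H: "subgroup H G" "H \<noteq> {\<one>}" "H \<noteq> carrier G"
    and triv: "\<And>g z. g \<in> carrier G \<Longrightarrow> g \<notin> H \<Longrightarrow> z \<in> H \<Longrightarrow> conjg g z \<in> H \<Longrightarrow> z = \<one>"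
  shows "frobenius_group G"
proof -
  have HC: "H \<subseteq> carrier G" using H(1) by (rule subgroup.subset)
  have "H \<inter> ((g <# H) #> inv g) = {\<one>}" if g: "g \<in> carrier G - H" for g
  proof -
    have "\<one> \<in> conjg g ` H" using g subgroup.one_closed[OF H(1)] by (intro image_eqI[of _ _ \<one>]) auto
    moreover have "z = \<one>" if "z \<in> H" "z \<in> conjg g ` H" for z
    proof -
      obtain y where y: "y \<in> H" "z = conjg g y" using \<open>z \<in> conjg g ` H\<close> by blast
      then have "y = \<one>" using triv[of g y] g \<open>z \<in> H\<close> by blast
      then show ?thesis using y g by simp
    qed
    ultimately show ?thesis using g HC subgroup.one_closed[OF H(1)] l_r_coset_conj[of H g] by blast
  qed
  then have "frobenius_complement G H" using H by (simp add: frobenius_complement_def)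
  then show ?thesis by (auto simp: frobenius_group_def)
qed

end

text \<open>\<open>U\<close> is the set of vertices that cannot be reached from the normal subgroup \<open>A\<close>;
  \<open>commute x (conjg g x)\<close> says that there is an edge from \<open>g\<close> to \<open>x\<close>.\<close>

locale engel_unreachable = finite_group +
  fixes U A
  assumes U: "U \<subseteq> carrier G" "\<one> \<notin> U" "U \<noteq> {}"
    and A: "A \<lhd> G" "A \<noteq> {\<one>}" "A \<inter> U = {}"
    and U_conjg: "g \<in> carrier G \<Longrightarrow> x \<in> U \<Longrightarrow> conjg g x \<in> U"
    and U_engel: "x \<in> U \<Longrightarrow> g \<in> carrier G \<Longrightarrow> g \<noteq> \<one> \<Longrightarrow> commute x (conjg g x) \<Longrightarrow> g \<in> U"
begin

lemma U_closed [simp]: "x \<in> U \<Longrightarrow> x \<in> carrier G"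
  using U by blast

lemma A_subgroup: "subgroup A G"
  using A by (simp add: normal_imp_subgroup)

lemma A_closed [simp]: "a \<in> A \<Longrightarrow> a \<in> carrier G"
  using A_subgroup by (rule subgroup.mem_carrier)

lemma U_commute: "x \<in> U \<Longrightarrow> y \<in> carrier G \<Longrightarrow> y \<noteq> \<one> \<Longrightarrow> commute x y \<Longrightarrow> y \<in> U"
  using U_engel[of x y] by (simp add: conjg_eq_self_iff[THEN iffD2] commute_sym)

lemma U_not_commute_A: "x \<in> U \<Longrightarrow> a \<in> A \<Longrightarrow> commute x a \<Longrightarrow> a = \<one>"
  using U_commute[of x a] A by auto

lemma A_nontrivial: obtains a where "a \<in> A" "a \<noteq> \<one>"
  using A(2) subgroup.one_closed[OF A_subgroup] by blast

text \<open>The set \<pi> of the overview.\<close>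

definition U_prime :: "nat \<Rightarrow> bool" where
  "U_prime r \<longleftrightarrow> prime r \<and> (\<exists>u \<in> U. r dvd ord u)"

lemma pow_in_U: "u \<in> U \<Longrightarrow> u [^] (n::nat) \<noteq> \<one> \<Longrightarrow> u [^] n \<in> U"
  using U_commute[of u "u [^] n"] by (simp add: commute_pow)

lemma U_prime_element:
  assumes r: "U_prime r" obtains u where "u \<in> U" "ord u = r"
proof -
  obtain u where u: "u \<in> U" "r dvd ord u" "prime r" using r by (auto simp: U_prime_def)
  then obtain n :: nat where n: "ord (u [^] n) = r" using exists_prime_order_pow[of u r] by auto
  then have "u [^] n \<noteq> \<one>" using u by auto
  with pow_in_U u n that show ?thesis by blast
qed

text \<open>\<open>U\<close> absorbs every nontrivial element commuting with one of its members.
  This leads from an element of order \<open>r\<close> to the centre of a Sylow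
  \<open>r\<close>-subgroup, on to the whole Sylow subgroup, and by conjugation to all
  \<open>r\<close>-elements.\<close>

lemma r_element_in_U:
  assumes r: "U_prime r" and x: "x \<in> carrier G" "x \<noteq> \<one>" "ord x = r ^ k"
  shows "x \<in> U"
proof -
  have pr: "prime r" using r by (simp add: U_prime_def)
  obtain u where u: "u \<in> U" "ord u = r" using U_prime_element[OF r] by blast
  obtain S where S: "sylow_of r S (carrier G)" using sylow_of_exists[OF subgroup_self pr] by blast
  then have SG: "subgroup S G" "card S = r ^ multiplicity r (card (carrier G))"
    by (auto simp: sylow_of_def)
  have into: "\<exists>m \<in> carrier G. conjg m z \<in> S" if "z \<in> carrier G" "ord z = r ^ j" for z j
    using sylow_conj_into[OF subgroup_self pr S subgroup_cyc[OF that(1)], of j]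
      subgroup.subset[OF subgroup_cyc[OF that(1)]] that self_in_cyc card_cyc by metis
  obtain m where m: "m \<in> carrier G" "conjg m u \<in> S" using into[of u 1] u by auto
  have mU: "conjg m u \<in> U" using U_conjg m u by blast
  then have mn: "conjg m u \<noteq> \<one>" using U by auto
  have "r dvd card S"
    using ord_dvd_card_subgroup[OF SG(1) m(2)] ord_conjg[of m u] m u by simp
  then obtain z where z: "z \<in> S" "z \<noteq> \<one>" "\<And>g. g \<in> S \<Longrightarrow> commute g z"
    using pgroup_centralizes_nontrivial[OF SG pr SG(1)] conjg_mem[OF SG(1)] by metis
  have zC: "z \<in> carrier G" using SG(1) z(1) by (rule subgroup.mem_carrier)
  have zU: "z \<in> U" using U_commute[OF mU zC z(2) z(3)] m by simp
  obtain m' where m': "m' \<in> carrier G" "conjg m' x \<in> S" using into x by blast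
  have "conjg m' x \<in> U"
    by (rule U_commute[OF zU]) (use m' x z in \<open>auto intro: commute_sym\<close>)
  then have "conjg (inv m') (conjg m' x) \<in> U" using m' by (simp add: U_conjg del: conjg_inv_conjg)
  then show ?thesis using m' x by simp
qed

text \<open>\<open>x\<close> commutes with its own power of order \<open>r\<close>. Consequently the
  primes dividing the order of an element lie either all in \<pi> or all outside it.\<close>

lemma U_prime_dvd_in_U:
  assumes r: "U_prime r" and x: "x \<in> carrier G" "r dvd ord x"
  shows "x \<in> U"
proof -
  have pr: "prime r" using r by (simp add: U_prime_def)
  obtain n :: nat where n: "ord (x [^] n) = r" using exists_prime_order_pow[OF x(1) pr x(2)] by blast
  then have "x [^] n \<noteq> \<one>" using pr by auto
  then have "x [^] n \<in> U" using r_element_in_U[OF r, of "x [^] n" 1] x n by simp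
  moreover have "x \<noteq> \<one>" using \<open>x [^] n \<noteq> \<one>\<close> by auto
  moreover have "commute (x [^] n) x" using x(1) by (simp add: commute_pow commute_sym)
  ultimately show ?thesis using U_commute x(1) by blast
qed

lemma r_subgroup_in_U:
  assumes "U_prime r" "subgroup Q G" "card Q = r ^ k" "x \<in> Q" "x \<noteq> \<one>"
  shows "x \<in> U"
proof -
  have "ord x dvd r ^ k" using assms ord_dvd_card_subgroup by metis
  then obtain j where "ord x = r ^ j" using assms(1) divides_primepow_nat U_prime_def by blast
  then show ?thesis using r_element_in_U[OF assms(1) subgroup.mem_carrier[OF assms(2,4)] assms(5)] by blast
qed

lemma U_prime_not_dvd_A: "U_prime r \<Longrightarrow> \<not> r dvd card A"
proof
  assume r: "U_prime r" "r dvd card A"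
  then obtain x where x: "x \<in> A" "ord x = r"
    using exists_prime_order[OF A_subgroup] U_prime_def by metis
  then have "x \<in> U" using U_prime_dvd_in_U[OF r(1)] by simp
  then show False using x A by auto
qed

text \<open>As \<open>t\<close> fixes only \<one> in \<open>A\<close>, the map \<open>f\<close> is
  injective, hence onto \<open>A\<close>, and \<open>t\<close> inverts every element
  \<open>inv b \<otimes> conjg t b\<close>.\<close>

lemma involution_inverts_A:
  assumes t: "t \<in> U" "t \<otimes> t = \<one>" and a: "a \<in> A"
  shows "conjg t a = inv a"
proof -
  define f where "f b = inv b \<otimes> conjg t b" for b
  have tA: "conjg t b \<in> A" if "b \<in> A" for b using normal_conjg[OF A(1)] t that by simp
  have "inj_on f A"
  proof (rule inj_onI)
    fix b c assume bc: "b \<in> A" "c \<in> A" "f b = f c"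
    have "c \<otimes> f b \<otimes> inv (conjg t b) = c \<otimes> f c \<otimes> inv (conjg t b)" using bc(3) by simp
    then have "c \<otimes> inv b = conjg t c \<otimes> inv (conjg t b)" using bc(1,2) t by (simp add: f_def m_assoc)
    also have "\<dots> = conjg t (c \<otimes> inv b)" using bc(1,2) t by (simp add: conjg_mult conjg_inv)
    finally have eq: "conjg t (c \<otimes> inv b) = c \<otimes> inv b" by (rule sym)
    then have "commute t (c \<otimes> inv b)" using conjg_eq_self_iff[of t "c \<otimes> inv b"] bc(1,2) t by simp
    then have "c \<otimes> inv b = \<one>"
      using U_not_commute_A t bc A_subgroup by (simp add: subgroup.m_closed subgroup.m_inv_closed)
    then show "b = c" using bc by (simp add: inv_solve_right')
  qed
  moreover have "f ` A \<subseteq> A"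
    using A_subgroup tA by (auto simp: f_def subgroup.m_closed subgroup.m_inv_closed)
  ultimately have "f ` A = A" by (intro endo_inj_surj finite_subgroup[OF A_subgroup])
  then obtain b where b: "b \<in> A" "a = inv b \<otimes> conjg t b" using a by (auto simp: f_def)
  then have "conjg t a = inv (conjg t b) \<otimes> b" using t by (simp add: conjg_mult conjg_inv conjg_conjg)
  then show ?thesis using b t by (simp add: inv_mult_group)
qed

text \<open>If \<open>z\<close> and \<open>conjg g z\<close> centralize \<open>t\<close>, then
  \<open>z\<close> commutes with \<open>t\<close> and with its conjugate \<open>s\<close>, which
  differs from \<open>t\<close>. Both invert \<open>A\<close>, so \<open>t \<otimes> s\<close>
  centralizes \<open>A\<close> and is not in \<open>U\<close>; but a nontrivial \<open>z\<close>
  lies in \<open>U\<close>, commuting with \<open>t\<close>, and would pull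
  \<open>t \<otimes> s\<close> into \<open>U\<close>.\<close>

lemma frobenius_even:
  assumes "U_prime 2"
  shows "frobenius_group G"
proof -
  obtain t where t: "t \<in> U" "ord t = 2" using U_prime_element[OF assms] by blast
  have tt: "t \<otimes> t = \<one>" using pow_ord_eq_1[of t] t by (simp add: numeral_2_eq_2)
  define H where "H = centralizer {t}"
  have H: "subgroup H G" unfolding H_def using t by (intro subgroup_centralizer) simp
  have Hm: "h \<in> H \<longleftrightarrow> h \<in> carrier G \<and> commute h t" for h by (simp add: H_def centralizer_def)
  obtain a where a: "a \<in> A" "a \<noteq> \<one>" using A_nontrivial by blast
  show ?thesis
  proof (rule frobenius_groupI[OF H])
    show "H \<noteq> {\<one>}" using Hm[of t] t U by auto
    show "H \<noteq> carrier G" using Hm[of a] a t U_not_commute_A[of t a] commute_sym by auto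
  next
    fix g z assume g: "g \<in> carrier G" "g \<notin> H" and z: "z \<in> H" "conjg g z \<in> H"
    define s where "s = conjg (inv g) t"
    have s: "s \<in> U" "s \<otimes> s = \<one>" using U_conjg g t tt conjg_mult[of "inv g" t t] by (simp_all add: s_def)
    have sC: "s \<in> carrier G" using s by simp
    have ts: "t \<otimes> s \<noteq> \<one>"
    proof
      assume "t \<otimes> s = \<one>"
      then have "t \<otimes> (t \<otimes> s) = t" using t by simp
      then have "s = t" using t sC tt by (simp flip: m_assoc)
      then have "conjg g t = t" using g t unfolding s_def by (metis U_closed conjg_inv_conjg(2))
      then show False using g t Hm by (simp add: conjg_eq_self_iff)
    qed
    have "conjg (t \<otimes> s) a = a"
      using involution_inverts_A[OF t(1) tt] involution_inverts_A[OF s] a t sC A_subgroup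
      by (simp add: subgroup.m_inv_closed flip: conjg_conjg)
    then have "commute (t \<otimes> s) a" using a t sC by (simp add: conjg_eq_self_iff)
    then have nU: "t \<otimes> s \<notin> U" using U_not_commute_A a by blast
    have zC: "z \<in> carrier G" and zt: "commute z t" using z Hm by auto
    have "commute (conjg (inv g) (conjg g z)) s" unfolding s_def using z Hm g t zC commute_conjg[of "inv g" "conjg g z" t] by (simp del: conjg_inv_conjg)
    then have zs: "commute z s" using g zC by simp
    show "z = \<one>"
    proof (rule ccontr)
      assume "z \<noteq> \<one>"
      then have "z \<in> U" using U_commute[of t z] t zC zt by (simp add: commute_sym)
      then have "t \<otimes> s \<in> U" using U_commute[of z "t \<otimes> s"] zC t sC zt zs ts by (simp add: commute_mult)
      with nU show False ..
    qed
  qed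
qed

text \<open>Otherwise \<open>R\<close> contains two independent commuting elements of order
  \<open>r\<close>, acting freely on the centre \<open>V\<close> of an \<open>R\<close>-invariant
  Sylow subgroup of \<open>A\<close>. The norm argument then gives \<open>V\<close> exponent
  \<open>r\<close>, although \<open>r\<close> does not divide \<open>card A\<close>.\<close>

lemma r_subgroup_cyclic:
  assumes r: "U_prime r" "odd r" and R: "subgroup R G" "card R = r ^ n"
  shows "\<exists>a \<in> R. R = cyc a"
proof (rule cyclic_pgroup[OF R])
  show pr: "prime r" using r by (simp add: U_prime_def)
  show "odd r" by fact
  fix x y assume xy: "x \<in> R" "y \<in> R" "x [^] r = \<one>" "ord y = r" "commute x y"
  note [simp] = subgroup.mem_carrier[OF R(1)]
  show "x \<in> cyc y"
  proof (rule ccontr)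
    assume nx: "x \<notin> cyc y"
    have "card A \<noteq> 1" using A(2) card_subgroup_eq_1_iff[OF A_subgroup] by simp
    then obtain q where q: "prime q" "q dvd card A" using prime_factor_nat by blast
    have RA: "conjg e ` A = A" if "e \<in> R" for e
      using that normal_conjg[OF A(1)] by (intro conjg_image_eqI[OF _ A_subgroup]) auto
    obtain Y where Y: "sylow_of q Y A" "\<And>e. e \<in> R \<Longrightarrow> conjg e ` Y = Y"
      using exists_normalized_sylow[OF A_subgroup R pr U_prime_not_dvd_A[OF r(1)] RA q(1)] by blast
    have YG: "subgroup Y G" "Y \<subseteq> A" "card Y = q ^ multiplicity q (card A)"
      using Y(1) by (auto simp: sylow_of_def)
    have YC: "Y \<subseteq> carrier G" using YG(1) by (rule subgroup.subset)
    have "card A \<noteq> 0" using subgroup.finite_imp_card_positive[OF A_subgroup fin] by simp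
    then have "multiplicity q (card A) > 0"
      using q prime_gt_1_nat[OF q(1)] by (simp add: multiplicity_gt_zero_iff)
    then have "q dvd card Y" using YG(3) by simp
    then obtain v where v: "v \<in> Y" "v \<noteq> \<one>" "\<And>g. g \<in> Y \<Longrightarrow> commute g v"
      using pgroup_centralizes_nontrivial[OF YG(1,3) q(1) YG(1)] conjg_mem[OF YG(1)] by metis
    define V where "V = Y \<inter> centralizer Y"
    have V: "subgroup V G" unfolding V_def
      using YG(1) subgroup_centralizer[OF YC] by (rule subgroups_Inter_pair)
    have RV: "conjg g w \<in> V" if "g \<in> R" "w \<in> V" for g w
    proof -
      have w: "w \<in> Y" "\<And>z. z \<in> Y \<Longrightarrow> commute w z" using that by (auto simp: V_def centralizer_def)
      have "commute (conjg g w) z" if zY: "z \<in> Y" for z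
      proof -
        obtain z' where z': "z' \<in> Y" "z = conjg g z'" using Y(2)[OF \<open>g \<in> R\<close>] zY by blast
        then have "w \<in> carrier G" "z' \<in> carrier G" using w YC by auto
        then show ?thesis using w(2)[OF z'(1)] z'(2) \<open>g \<in> R\<close> by (simp add: commute_conjg)
      qed
      moreover have "conjg g w \<in> Y" using Y(2)[OF \<open>g \<in> R\<close>] w by blast
      ultimately show ?thesis using YC by (auto simp: V_def centralizer_def)
    qed
    have free: "w = \<one>" if "g \<in> R" "g \<noteq> \<one>" "w \<in> V" "commute g w" for g w
      using U_not_commute_A[of g w] r_subgroup_in_U[OF r(1) R] that YG(2) by (auto simp: V_def)
    have vV: "v \<in> V" using v YC by (auto simp: V_def centralizer_def intro: commute_sym)
    have comm: "commute u w" if "u \<in> V" "w \<in> V" for u w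
      using that by (auto simp: V_def centralizer_def)
    have y: "y [^] r = \<one>" "y \<noteq> \<one>" using xy pr pow_ord_eq_1[of y] by auto
    have "v [^] r = \<one>"
      by (rule free_rank2_exponent[OF R(1) V comm RV free pr xy(1,2,5,3) y nx vV])
    moreover have vA: "v \<in> A" using v YG by blast
    ultimately have "ord v dvd r" by (simp add: pow_eq_id)
    moreover have "ord v \<noteq> 1" using v vA ord_eq_1 by simp
    ultimately have "ord v = r" using pr prime_nat_iff by blast
    then show False
      using U_prime_not_dvd_A[OF r(1)] ord_dvd_card_subgroup[OF A_subgroup vA] by simp
  qed
qed

end

section \<open>Fusion and transfer when all primes of \<pi> are odd\<close>

lemma cong_one_if_pow_coprime_totient:
  fixes k m n :: nat
  assumes "[k ^ n = 1] (mod m)" "n > 0" "coprime n (totient m)"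
  shows "[k = 1] (mod m)"
proof -
  have "coprime (k ^ n) m" using cong_imp_coprime[OF cong_sym[OF assms(1)]] by simp
  then have "coprime m k" using assms(2) by (simp add: coprime_commute)
  then have "Pocklington.ord m k dvd totient m" by (rule order_divides_totient)
  moreover have "Pocklington.ord m k dvd n" using assms(1) ord_divides by blast
  ultimately have "Pocklington.ord m k = 1" using assms(3) coprime_common_divisor_nat by blast
  then show ?thesis using ord_divides[of k 1 m] by simp
qed

lemma (in group) ord_subgroup: "subgroup H G \<Longrightarrow> group.ord (G\<lparr>carrier := H\<rparr>) x = ord x"
  using nat_pow_consistent[of x _ H] by (simp add: group.ord_def[OF subgroup_group] ord_def)

context engel_unreachable
begin

text \<open>In the cyclic \<open>R\<close> the conjugates \<open>x\<close> and
  \<open>conjg h x\<close> generate the same subgroup, so \<open>h\<close> normalizes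
  \<open>cyc x\<close>. The nontrivial elements of \<open>M\<close> doing so lie in
  \<open>U\<close>, hence their orders involve no prime below \<open>r\<close>. An
  \<open>r\<close>-element among them is conjugate into the abelian \<open>R\<close>; an element of
  order a power of a larger prime \<open>s\<close> acts trivially, because \<open>cyc x\<close> has
  \<open>totient (r ^ e)\<close> automorphisms, a number prime to \<open>s\<close>.\<close>

lemma fusion_trivial:
  assumes M: "subgroup M G" and r: "U_prime r" "odd r"
    and min: "\<And>s. U_prime s \<Longrightarrow> s dvd card M \<Longrightarrow> r \<le> s"
    and R: "sylow_of r R M" and x: "x \<in> R" and h: "h \<in> M" "conjg h x \<in> R"
  shows "commute h x"
proof (cases "x = \<one>")
  case True
  then show ?thesis using h subgroup.mem_carrier[OF M] by simp
next
  case False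
  have RG: "subgroup R G" "R \<subseteq> M" "card R = r ^ multiplicity r (card M)"
    using R by (auto simp: sylow_of_def)
  note [simp] = subgroup.mem_carrier[OF M] subgroup.mem_carrier[OF RG(1)]
  have pr: "prime r" using r by (simp add: U_prime_def)
  have xU: "x \<in> U" using r_subgroup_in_U[OF r(1) RG(1,3) x False] .
  have xC: "x \<in> carrier G" using x by simp
  obtain a where a: "a \<in> R" "R = cyc a" using r_subgroup_cyclic[OF r RG(1,3)] by blast
  have Rcomm: "commute u v" if "u \<in> R" "v \<in> R" for u v
    using cyc_commute[of a u v] that a by simp
  have sx: "subgroup (cyc x) G" using xC by (rule subgroup_cyc)
  have cx: "cyc x \<subseteq> carrier G" using sx by (rule subgroup.subset)
  define N where "N = M \<inter> set_normalizer (cyc x)"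
  have N: "subgroup N G" "N \<subseteq> M"
    unfolding N_def using subgroups_Inter_pair[OF M subgroup_set_normalizer[OF cx]] by auto
  have memN: "g \<in> N" if g: "g \<in> M" "conjg g x \<in> cyc x" for g
  proof -
    obtain k :: nat where "conjg g x = x [^] k" using g by (auto simp: cyc_def)
    then have "conjg g (x [^] i) \<in> cyc x" for i :: nat
      using g xC by (auto simp: conjg_pow nat_pow_pow cyc_def)
    then have "conjg g ` cyc x = cyc x" using g by (intro conjg_image_eqI sx) (auto simp: cyc_def)
    then show ?thesis using g by (simp add: N_def set_normalizer_def)
  qed
  have Ncyc: "conjg g z \<in> cyc x" if "g \<in> N" "z \<in> cyc x" for g z
    using that by (auto simp: N_def set_normalizer_def)
  have NU: "g \<in> U" if "g \<in> N" "g \<noteq> \<one>" for g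
  proof -
    have "conjg g x \<in> cyc x" using Ncyc that self_in_cyc xC by blast
    then have "commute x (conjg g x)" using xC by (auto simp: cyc_def commute_pow)
    then show ?thesis using U_engel[OF xU] that N by auto
  qed
  have "conjg h x \<in> cyc x"
    by (rule cyc_same_ord[of a]) (use a x h xC in \<open>auto simp: ord_conjg\<close>)
  then have hN: "h \<in> N" using memN h by blast
  have RN: "sylow_of r R N"
  proof (rule sylow_of_subgroup[OF R pr M N(1) _ N(2)])
    show "R \<subseteq> N"
    proof
      fix g assume g: "g \<in> R"
      then have "conjg g x = x" using x Rcomm by (simp add: conjg_eq_self_iff)
      then show "g \<in> N" using memN g RG self_in_cyc xC by auto
    qed
  qed
  have "h \<in> centralizer {x}"
  proof (rule mem_subgroup_of_primary_powers)
    show "subgroup (centralizer {x}) G" using xC by (intro subgroup_centralizer) simp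
    show "h \<in> carrier G" using h by simp
    fix s f m assume s: "prime s" and o: "ord h = s ^ f * m" and m: "\<not> s dvd m"
    define g where "g = h [^] m"
    have g: "g \<in> N" unfolding g_def using N(1) hN by (rule subgroup_pow)
    then have gM: "g \<in> M" and gC: "g \<in> carrier G" using N by auto
    have "m \<noteq> 0" using m by (cases "m = 0") simp_all
    then have og: "ord g = s ^ f"
      using ord_pow[of h m] h o unfolding g_def by simp
    have "commute g x"
    proof (cases "g = \<one>")
      case True
      then show ?thesis using xC by simp
    next
      case False
      then have "f \<noteq> 0" using og gC ord_eq_1[of g] by auto
      then have sg: "s dvd ord g" using og by simp
      then have Us: "U_prime s" using s NU[OF g False] by (auto simp: U_prime_def)
      have "s dvd card M" using sg ord_dvd_card_subgroup[OF M gM] dvd_trans by blast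
      then have "r \<le> s" using min Us by blast
      show ?thesis
      proof (cases "s = r")
        case True
        have "cyc g \<subseteq> N" "card (cyc g) = r ^ f" using cyc_subset[OF N(1) g] gC og True by (simp_all add: card_cyc)
        then obtain n where n: "n \<in> N" "\<And>q. q \<in> cyc g \<Longrightarrow> conjg n q \<in> R"
          using sylow_conj_into[OF N(1) pr RN subgroup_cyc[OF gC]] by metis
        have nC: "n \<in> carrier G" using n N by auto
        \<comment> \<open>The conjugation is shifted to \<open>x\<close>: \<open>conjg n g\<close>
          and \<open>x\<close> both lie in \<open>R\<close>, so \<open>g\<close> commutes with
          \<open>y\<close>, and \<open>y\<close> generates the same subgroup as
          \<open>x\<close>.\<close>
        define y where "y = conjg (inv n) x"
        have yx: "y \<in> cyc x" unfolding y_def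
          using Ncyc subgroup.m_inv_closed[OF N(1) n(1)] self_in_cyc xC by blast
        have yC: "y \<in> carrier G" using nC xC by (simp add: y_def)
        have "commute (conjg n g) (conjg n y)" using Rcomm n(2) self_in_cyc gC x nC xC by (simp add: y_def)
        then have gy: "commute g y" using nC gC yC by (simp add: commute_conjg)
        have "x \<in> cyc y"
          by (rule cyc_same_ord[of x]) (use yx xC nC self_in_cyc in \<open>auto simp: y_def ord_conjg\<close>)
        then show ?thesis using gy gC yC by (auto simp: cyc_def commute_pow)
      next
        case False
        with \<open>r \<le> s\<close> have "r < s" by simp
        have "conjg g x \<in> cyc x" using Ncyc[OF g self_in_cyc[OF xC]] .
        then obtain k :: nat where k: "conjg g x = x [^] k" by (auto simp: cyc_def)
        have "conjg (g [^] i) x = x [^] (k ^ i)" for i :: nat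
        proof (induction i)
          case (Suc i)
          have "conjg (g [^] Suc i) x = conjg (g [^] i) (conjg g x)" using gC xC by (simp add: conjg_conjg)
          also have "\<dots> = x [^] (k ^ i * k)" using Suc k gC xC by (simp add: conjg_pow nat_pow_pow)
          finally show ?case by (simp add: mult.commute)
        qed (use xC in simp)
        from this[of "s ^ f"] have "x [^] (k ^ s ^ f) = x [^] (1::nat)"
          using og gC xC pow_ord_eq_1[of g] by simp
        then have k1: "[k ^ s ^ f = 1] (mod ord x)" by (rule iffD1[OF pow_eq_iff_cong[OF xC]])
        obtain e where e: "ord x = r ^ e"
          using ord_dvd_card_subgroup[OF RG(1) x] divides_primepow_nat[OF pr] RG(3) by auto
        have e0: "e \<noteq> 0" using e \<open>x \<noteq> \<one>\<close> xC ord_eq_1[of x] by auto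
        have "\<not> s dvd r" using False primes_dvd_imp_eq[OF s pr] by blast
        then have "coprime s (r ^ (e - 1))" by (intro coprime_power_right_iff[THEN iffD2] disjI1 prime_imp_coprime[OF s])
        moreover have "coprime s (r - 1)"
        proof (rule prime_imp_coprime[OF s], rule notI)
          assume "s dvd r - 1"
          moreover have "r - 1 > 0" using prime_gt_1_nat[OF pr] by simp
          ultimately have "s \<le> r - 1" by (rule dvd_imp_le)
          with \<open>r < s\<close> show False by simp
        qed
        ultimately have "coprime (s ^ f) (totient (r ^ e))"
          using totient_prime_power[OF pr, of e] e0 by auto
        then have "[k = 1] (mod ord x)"
          using cong_one_if_pow_coprime_totient[OF k1] e s prime_gt_0_nat by simp
        then have "x [^] k = x [^] (1::nat)" by (rule iffD2[OF pow_eq_iff_cong[OF xC]])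
        then show ?thesis using k xC gC by (simp add: conjg_eq_self_iff)
      qed
    qed
    then show "h [^] m \<in> centralizer {x}" using gC by (simp add: g_def centralizer_def)
  qed
  then show ?thesis by (simp add: centralizer_def)
qed

text \<open>Transfer is applied in a normal subgroup \<open>M\<close> of least order that meets
  \<open>U\<close> and contains everything outside \<open>U\<close>. Its normal
  \<open>r\<close>-complement \<open>K\<close> also contains everything outside \<open>U\<close> but
  is smaller, so it misses \<open>U\<close>. Every nontrivial element of the normalizer
  \<open>H\<close> of the abelian \<open>R\<close> has an edge into \<open>R\<close> and so lies in
  \<open>U\<close>; thus \<open>H\<close> and \<open>K\<close> meet trivially.\<close>

lemma frobenius_odd:
  assumes "\<not> U_prime 2"
  shows "frobenius_group G"
proof -
  have odd: "odd r" if "U_prime r" for r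
    using that assms U_prime_def prime_odd_nat prime_ge_2_nat by (metis le_neq_implies_less)
  define good where "good M \<longleftrightarrow> M \<lhd> G \<and> M \<inter> U \<noteq> {} \<and> carrier G - U \<subseteq> M" for M
  have "good (carrier G)" using U normal_conjg_iff subgroup_self by (auto simp: good_def)
  then obtain M where M: "good M" "\<And>M'. good M' \<Longrightarrow> card M \<le> card M'"
    using ex_has_least_nat[of good "carrier G" card] by auto
  have Mn: "M \<lhd> G" and MX: "carrier G - U \<subseteq> M" using M by (auto simp: good_def)
  have MG: "subgroup M G" using Mn by (rule normal_imp_subgroup)
  obtain u where u: "u \<in> M" "u \<in> U" using M by (auto simp: good_def)
  have "ord u \<noteq> 1" using u U ord_eq_1[of u] by auto
  then obtain p where p: "prime p" "p dvd ord u" using prime_factor_nat by blast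
  define P where "P s \<longleftrightarrow> U_prime s \<and> s dvd card M" for s
  have "P p" using p u ord_dvd_card_subgroup[OF MG u(1)] dvd_trans by (auto simp: P_def U_prime_def)
  define r where "r = (LEAST s. P s)"
  have "P r" unfolding r_def using \<open>P p\<close> by (rule LeastI)
  then have r: "U_prime r" "r dvd card M" by (auto simp: P_def)
  have min: "r \<le> s" if "U_prime s" "s dvd card M" for s
    unfolding r_def using that by (intro Least_le) (simp add: P_def)
  have pr: "prime r" using r by (simp add: U_prime_def)
  obtain R where R: "sylow_of r R M" using sylow_of_exists[OF MG pr] by blast
  have RG: "subgroup R G" "R \<subseteq> M" "card R = r ^ multiplicity r (card M)"
    using R by (auto simp: sylow_of_def)
  note [simp] = subgroup.mem_carrier[OF MG] subgroup.mem_carrier[OF RG(1)]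
  obtain a where a: "a \<in> R" "R = cyc a" using r_subgroup_cyclic[OF r(1) odd[OF r(1)] RG(1,3)] by blast
  have Rcomm: "commute u v" if "u \<in> R" "v \<in> R" for u v
    using cyc_commute[of a u v] that a by simp
  interpret M: finite_group "G\<lparr>carrier := M\<rparr>"
    using subgroup_group[OF MG] finite_subgroup[OF MG]
    by (simp add: finite_group_def finite_group_axioms_def)
  have Mcommute: "M.commute = commute" by (simp add: fun_eq_iff M.commute_def commute_def)
  have Mcj: "M.conjg h x = conjg h x" if "h \<in> M" for h x
    using that by (simp add: M.conjg_def conjg_def m_inv_consistent[OF MG])
  have MR: "M.sylow_of r R (carrier (G\<lparr>carrier := M\<rparr>))"
    using R subgroup_in_subgroup[OF MG RG(1,2)] by (simp add: M.sylow_of_def sylow_of_def)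
  have Mfus: "M.conjg h x = x" if "x \<in> R" "h \<in> carrier (G\<lparr>carrier := M\<rparr>)" "M.conjg h x \<in> R" for x h
    using that fusion_trivial[OF MG r(1) odd[OF r(1)] min R] by (simp add: Mcj conjg_eq_self_iff)
  define K where "K = {g \<in> M. \<not> r dvd ord g}"
  have "subgroup K (G\<lparr>carrier := M\<rparr>)"
    using M.normal_complement(1)[OF MR pr _ Mfus] Rcomm
    by (simp add: Mcommute ord_subgroup[OF MG] K_def)
  then have KG: "subgroup K G" using incl_subgroup[OF MG] by blast
  have split: "\<exists>y \<in> R. g \<otimes> inv y \<in> K" if g: "g \<in> M" for g
  proof -
    obtain y where y: "y \<in> R" "\<not> r dvd M.ord (g \<otimes> inv\<^bsub>G\<lparr>carrier := M\<rparr>\<^esub> y)"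
      using M.normal_complement(2)[OF MR pr _ Mfus, of g] Rcomm g by (auto simp: Mcommute)
    then have yM: "y \<in> M" using RG(2) by blast
    then have "\<not> r dvd ord (g \<otimes> inv y)" using y(2) by (simp add: ord_subgroup[OF MG] m_inv_consistent[OF MG])
    moreover have "g \<otimes> inv y \<in> M" using g yM MG by (simp add: subgroup.m_closed subgroup.m_inv_closed)
    ultimately show ?thesis using y(1) by (auto simp: K_def)
  qed
  note [simp] = subgroup.mem_carrier[OF KG]
  have Kn: "K \<lhd> G"
    unfolding normal_conjg_iff using KG normal_conjg[OF Mn] by (auto simp: K_def ord_conjg)
  have KX: "carrier G - U \<subseteq> K"
    using MX U_prime_dvd_in_U[OF r(1)] by (auto simp: K_def)
  obtain x where x: "x \<in> M" "ord x = r" by (rule exists_prime_order[OF MG pr r(2)])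
  have "K \<subseteq> M" by (auto simp: K_def)
  moreover have "x \<notin> K" unfolding K_def using x(2) by simp
  ultimately have "K \<subset> M" using x(1) by blast
  then have "card K < card M" using finite_subgroup[OF MG] by (simp add: psubset_card_mono)
  then have "\<not> good K" using M(2) by fastforce
  then have KU: "K \<inter> U = {}" using Kn KX by (simp add: good_def)
  define H where "H = set_normalizer R"
  have RC: "R \<subseteq> carrier G" using RG(1) by (rule subgroup.subset)
  have HG: "subgroup H G" unfolding H_def using RC by (rule subgroup_set_normalizer)
  note [simp] = subgroup.mem_carrier[OF HG]
  have RH: "R \<subseteq> H"
  proof
    fix g assume g: "g \<in> R"
    then have "conjg g ` R = R" using conjg_mem[OF RG(1) g] by (intro conjg_image_eqI RG(1)) simp_all
    then show "g \<in> H" unfolding H_def set_normalizer_def using g by simp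
  qed
  have "R \<noteq> {\<one>}"
  proof
    assume "R = {\<one>}"
    then have "r ^ multiplicity r (card M) = 1" using RG(3) by simp
    moreover have "multiplicity r (card M) > 0"
      using r(2) pr subgroup.finite_imp_card_positive[OF MG fin] prime_gt_1_nat[OF pr]
      by (simp add: multiplicity_gt_zero_iff)
    ultimately show False using prime_gt_1_nat[OF pr] by (metis One_nat_def nat_power_eq_Suc_0_iff less_not_refl)
  qed
  then obtain b where b: "b \<in> R" "b \<noteq> \<one>" using subgroup.one_closed[OF RG(1)] by blast
  have bU: "b \<in> U" using r_subgroup_in_U[OF r(1) RG(1,3) b] .
  have HU: "g \<in> U" if g: "g \<in> H" "g \<noteq> \<one>" for g
  proof -
    have "conjg g b \<in> R" using g b unfolding H_def set_normalizer_def by blast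
    then show ?thesis using U_engel[OF bU] Rcomm b g by simp
  qed
  have HK: "g = \<one>" if "g \<in> H" "g \<in> K" for g using HU KU that by blast
  have frattini: "\<exists>k \<in> K. \<exists>h \<in> H. g = k \<otimes> h" if g: "g \<in> carrier G" for g
  proof -
    have "sylow_of r (conjg g ` R) M"
    proof -
      have "conjg g ` R \<subseteq> M" using normal_conjg[OF Mn g] RG(2) by blast
      then show ?thesis using RG g RC by (simp add: sylow_of_def subgroup_conjg_image card_image inj_on_conjg)
    qed
    then obtain m where m: "m \<in> M" "conjg m ` (conjg g ` R) = R" using sylow_conjugate[OF MG pr R] by blast
    have mg: "m \<otimes> g \<in> H" unfolding H_def set_normalizer_def using m g RC by (simp add: conjg_image_conjg_image)
    obtain y where y: "y \<in> R" "inv m \<otimes> inv y \<in> K"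
      using split[of "inv m"] m MG by (auto simp: subgroup.m_inv_closed)
    have "g = (inv m \<otimes> inv y) \<otimes> (y \<otimes> (m \<otimes> g))" using m y g by (simp add: m_assoc)
    moreover have "y \<otimes> (m \<otimes> g) \<in> H" using HG RH y mg by (auto intro: subgroup.m_closed)
    ultimately show ?thesis using y by blast
  qed
  show ?thesis
  proof (rule frobenius_groupI[OF HG])
    show "H \<noteq> {\<one>}" using b RH by auto
    obtain c where "c \<in> A" "c \<noteq> \<one>" using A_nontrivial by blast
    then show "H \<noteq> carrier G" using HU[of c] A(3) by auto
  next
    fix g z assume g: "g \<in> carrier G" "g \<notin> H" and z: "z \<in> H" "conjg g z \<in> H"
    obtain k h where kh: "k \<in> K" "h \<in> H" "g = k \<otimes> h" using frattini[OF g(1)] by blast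
    \<comment> \<open>The factor \<open>h\<close> stays inside \<open>H\<close>. The product
      \<open>conjg k w \<otimes> inv w\<close> lies in \<open>H\<close>, and in \<open>K\<close> by
      normality, so it is trivial; then \<open>k\<close>, a nontrivial element outside
      \<open>U\<close>, commutes with \<open>w\<close>, which forces
      \<open>w = \<one>\<close>.\<close>
    define w where "w = conjg h z"
    have w: "w \<in> H" using conjg_mem[OF HG] kh z by (simp add: w_def)
    have gw: "conjg g z = conjg k w" using kh z by (simp add: w_def conjg_conjg)
    have "conjg k w \<otimes> inv w = k \<otimes> conjg w (inv k)" using kh w by (simp add: conjg_def m_assoc)
    moreover have "k \<otimes> conjg w (inv k) \<in> K"
      using KG kh w normal_conjg[OF Kn] by (simp add: subgroup.m_closed subgroup.m_inv_closed)
    moreover have "conjg k w \<otimes> inv w \<in> H"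
      using HG w z gw by (simp add: subgroup.m_closed subgroup.m_inv_closed)
    ultimately have "conjg k w \<otimes> inv w = \<one>" using HK by simp
    then have "conjg k w = w" using kh w by (simp add: inv_solve_right')
    then have kw: "commute w k" using kh w by (simp add: conjg_eq_self_iff commute_sym)
    have "k \<noteq> \<one>" using kh g by auto
    have "w = \<one>"
    proof (rule ccontr)
      assume "w \<noteq> \<one>"
      then have "w \<in> U" using HU w by blast
      moreover have "k \<in> carrier G" using kh by simp
      ultimately have "k \<in> U" using U_commute kw \<open>k \<noteq> \<one>\<close> by blast
      then show False using KU kh by blast
    qed
    then show "z = \<one>" using kh z by (simp add: w_def)
  qed
qed

lemma frobenius: "frobenius_group G"
  using frobenius_even frobenius_odd by blast

end

context finite_group
begin

section \<open>Reachability and strong connectivity\<close>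

text \<open>The arcs in the form of \<open>engel2_eq_one_iff\<close>; that all nontrivial elements
  are vertices comes from \<open>engel2_trivial\<close>.\<close>

definition engel_rel :: "('a \<times> 'a) set" where
  "engel_rel = {(x, y). x \<in> carrier G - {\<one>} \<and> y \<in> carrier G - {\<one>} \<and> commute y (conjg x y)}"

lemma commute_engel_rel:
  "\<lbrakk>x \<in> carrier G; y \<in> carrier G; x \<noteq> \<one>; y \<noteq> \<one>; commute x y\<rbrakk> \<Longrightarrow> (x, y) \<in> engel_rel"
  by (simp add: engel_rel_def conjg_eq_self_iff[THEN iffD2])

lemma engel_rel_conjg:
  assumes "(x, y) \<in> engel_rel\<^sup>*" "g \<in> carrier G"
  shows "(conjg g x, conjg g y) \<in> engel_rel\<^sup>*"
  using assms(1)
proof (induction rule: rtrancl_induct)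
  case (step y z)
  then have yz: "y \<in> carrier G" "z \<in> carrier G" "y \<noteq> \<one>" "z \<noteq> \<one>" "commute z (conjg y z)"
    by (auto simp: engel_rel_def)
  have "conjg (conjg g y) (conjg g z) = conjg g (conjg y z)"
    using yz assms(2) by (simp add: conjg_def m_assoc inv_mult_group)
  then have "(conjg g y, conjg g z) \<in> engel_rel" using yz assms(2) by (simp add: engel_rel_def commute_conjg)
  with step.IH show ?case by (rule rtrancl.rtrancl_into_rtrancl)
qed simp

lemma engel_path_to_normal:
  assumes A: "A \<lhd> G" "A \<noteq> {\<one>}" and x: "x \<in> carrier G" "x \<noteq> \<one>"
  obtains a where "a \<in> A" "a \<noteq> \<one>" "(x, a) \<in> engel_rel\<^sup>*"
proof -
  have AG: "subgroup A G" using A(1) by (rule normal_imp_subgroup)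
  have "ord x \<noteq> 1" using x ord_eq_1 by simp
  then obtain p where p: "prime p" "p dvd ord x" using prime_factor_nat by blast
  obtain n :: nat where n: "ord (x [^] n) = p" using exists_prime_order_pow[OF x(1) p] by blast
  define z where "z = x [^] n"
  have z: "z \<in> carrier G" "z \<noteq> \<one>" "ord z = p" using x n p by (auto simp: z_def)
  have xz: "(x, z) \<in> engel_rel"
    using x z commute_pow[of x x n] by (intro commute_engel_rel) (auto simp: z_def)
  have cz: "subgroup (cyc z) G" "card (cyc z) = p ^ 1" using z by (simp_all add: subgroup_cyc card_cyc)
  have zz: "z \<in> cyc z" using z by (simp add: self_in_cyc)
  have zC: "g \<in> carrier G" if "g \<in> cyc z" for g using cz(1) that by (rule subgroup.mem_carrier)
  have "\<exists>a \<in> A. a \<noteq> \<one> \<and> (z, a) \<in> engel_rel"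
  proof (cases "p dvd card A")
    case True
    obtain b where b: "b \<in> A" "b \<noteq> \<one>" "\<And>g. g \<in> cyc z \<Longrightarrow> commute g b"
      using pgroup_centralizes_nontrivial[OF cz p(1) AG True] normal_conjg[OF A(1)] zC by metis
    then show ?thesis using zz z subgroup.mem_carrier[OF AG] by (auto intro: commute_engel_rel)
  next
    case False
    have "card A \<noteq> 1" using A(2) card_subgroup_eq_1_iff[OF AG] by simp
    then obtain q where q: "prime q" "q dvd card A" using prime_factor_nat by blast
    have EA: "conjg e ` A = A" if "e \<in> cyc z" for e
      using zC[OF that] normal_conjg[OF A(1)] by (intro conjg_image_eqI AG) auto
    obtain Y where Y: "sylow_of q Y A" "\<And>e. e \<in> cyc z \<Longrightarrow> conjg e ` Y = Y"
      using exists_normalized_sylow[OF AG cz p(1) False EA q(1)] by blast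
    have YG: "subgroup Y G" "Y \<subseteq> A" "card Y = q ^ multiplicity q (card A)"
      using Y(1) by (auto simp: sylow_of_def)
    have "multiplicity q (card A) > 0"
      using q prime_gt_1_nat[OF q(1)] subgroup.finite_imp_card_positive[OF AG fin]
      by (simp add: multiplicity_gt_zero_iff)
    then have "q dvd card Y" using YG(3) by simp
    then obtain v where v: "v \<in> Y" "v \<noteq> \<one>" "\<And>g. g \<in> Y \<Longrightarrow> commute g v"
      using pgroup_centralizes_nontrivial[OF YG(1,3) q(1) YG(1)] conjg_mem[OF YG(1)] by metis
    have "conjg z v \<in> Y" using Y(2)[OF zz] v(1) by blast
    then have "commute v (conjg z v)" using v(3) commute_sym by blast
    then have "(z, v) \<in> engel_rel"
      using z v subgroup.mem_carrier[OF YG(1)] by (simp add: engel_rel_def)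
    then show ?thesis using v YG(2) by blast
  qed
  then obtain a where "a \<in> A" "a \<noteq> \<one>" "(z, a) \<in> engel_rel" by blast
  with xz that show ?thesis by (meson r_into_rtrancl rtrancl_trans)
qed

text \<open>Since \<open>x\<close> reaches \<open>A\<close> and \<open>A\<close> lies in one strong
  component, a vertex \<open>y\<close> that \<open>x\<close> misses is missed by all of
  \<open>A\<close>. Prolonging paths makes \<open>U\<close> closed under predecessors, and
  conjugation is an automorphism of the graph.\<close>

lemma connected_or_frobenius:
  assumes A: "A \<lhd> G" "A \<noteq> {\<one>}"
    and conn: "\<And>a b. \<lbrakk>a \<in> A; b \<in> A; a \<noteq> \<one>; b \<noteq> \<one>\<rbrakk> \<Longrightarrow> (a, b) \<in> engel_rel\<^sup>*"
    and xy: "x \<in> carrier G" "x \<noteq> \<one>" "y \<in> carrier G" "y \<noteq> \<one>" "(x, y) \<notin> engel_rel\<^sup>*"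
  shows "frobenius_group G"
proof -
  have AC: "a \<in> carrier G" if "a \<in> A" for a
    using normal_imp_subgroup[OF A(1)] that by (rule subgroup.mem_carrier)
  define U where "U = {z \<in> carrier G - {\<one>}. \<forall>a \<in> A - {\<one>}. (a, z) \<notin> engel_rel\<^sup>*}"
  have memU: "z \<in> U \<longleftrightarrow> z \<in> carrier G \<and> z \<noteq> \<one> \<and> (\<forall>a. a \<in> A \<longrightarrow> a \<noteq> \<one> \<longrightarrow> (a, z) \<notin> engel_rel\<^sup>*)" for z
    by (auto simp: U_def)
  obtain a where a: "a \<in> A" "a \<noteq> \<one>" "(x, a) \<in> engel_rel\<^sup>*"
    using engel_path_to_normal[OF A xy(1,2)] by blast
  have yU: "y \<in> U"
  proof (rule ccontr)
    assume "y \<notin> U"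
    then obtain b where b: "b \<in> A" "b \<noteq> \<one>" "(b, y) \<in> engel_rel\<^sup>*" using xy memU by blast
    then have "(a, y) \<in> engel_rel\<^sup>*" using conn[of a b] a by (meson rtrancl_trans)
    then show False using a xy by (meson rtrancl_trans)
  qed
  interpret engel_unreachable G U A
  proof (intro engel_unreachable.intro engel_unreachable_axioms.intro finite_group_axioms)
    show "U \<subseteq> carrier G" "\<one> \<notin> U" "U \<noteq> {}" using yU by (auto simp: U_def)
    show "A \<inter> U = {}" using memU by auto
    show "conjg g z \<in> U" if g: "g \<in> carrier G" and z: "z \<in> U" for g z
    proof -
      have zc: "z \<in> carrier G" "z \<noteq> \<one>" using z memU by auto
      have "(b, conjg g z) \<notin> engel_rel\<^sup>*" if b: "b \<in> A" "b \<noteq> \<one>" for b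
      proof
        assume "(b, conjg g z) \<in> engel_rel\<^sup>*"
        then have "(conjg (inv g) b, conjg (inv g) (conjg g z)) \<in> engel_rel\<^sup>*" using g by (intro engel_rel_conjg) auto
        then have "(conjg (inv g) b, z) \<in> engel_rel\<^sup>*" using g zc by simp
        moreover have "conjg (inv g) b \<in> A" "conjg (inv g) b \<noteq> \<one>"
          using b g AC[OF b(1)] normal_conjg[OF A(1)] by simp_all
        ultimately show False using z memU by blast
      qed
      moreover have "conjg g z \<in> carrier G" "conjg g z \<noteq> \<one>" using g zc by simp_all
      ultimately show ?thesis unfolding memU by blast
    qed
    show "g \<in> U" if z: "z \<in> U" and g: "g \<in> carrier G" "g \<noteq> \<one>" "commute z (conjg g z)" for g z
    proof -
      have "(g, z) \<in> engel_rel" using z g memU by (simp add: engel_rel_def)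
      then have "(b, g) \<notin> engel_rel\<^sup>*" if "b \<in> A" "b \<noteq> \<one>" for b
        using z memU that by (meson rtrancl.rtrancl_into_rtrancl)
      then show ?thesis using memU g by blast
    qed
  qed (fact A)+
  show ?thesis by (rule frobenius)
qed

section \<open>2-Engel elements and the centre\<close>

lemma subgroup_eq_carrierI:
  assumes C: "subgroup C G" and syl: "\<And>s. prime s \<Longrightarrow> \<exists>S. sylow_of s S (carrier G) \<and> S \<subseteq> C"
  shows "C = carrier G"
proof -
  define n where "n = card (rcosets C)"
  have n: "n * card C = card (carrier G)" using lagrange[OF C] by (simp add: n_def order_def)
  have c0: "card (carrier G) \<noteq> 0" using fin carrier_not_empty by simp
  \<comment> \<open>A prime \<open>s\<close> dividing the index of \<open>C\<close> would divide the
    index of the Sylow \<open>s\<close>-subgroup contained in \<open>C\<close>.\<close>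
  have "n = 1"
  proof (rule ccontr)
    assume "n \<noteq> 1"
    then obtain s where s: "prime s" "s dvd n" using prime_factor_nat by blast
    obtain S where S: "sylow_of s S (carrier G)" "S \<subseteq> C" using syl s by blast
    then have "card S dvd card C" by (intro subgroup_card_dvd C) (simp_all add: sylow_of_def)
    then obtain m where "card C = card S * m" by auto
    then have "(n * m) * card S = card (carrier G)" using n by (simp add: mult_ac)
    then have "\<not> s dvd n * m" using sylow_of_index[OF S(1) s(1) _ c0] by blast
    then show False using s by simp
  qed
  then have "card C = card (carrier G)" using n by simp
  then show ?thesis using subgroup.subset[OF C] by (simp add: card_subset_eq)
qed

lemma normal_centralizer:
  assumes W: "W \<subseteq> carrier G" "\<And>g w. g \<in> carrier G \<Longrightarrow> w \<in> W \<Longrightarrow> conjg g w \<in> W"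
  shows "centralizer W \<lhd> G"
  unfolding normal_conjg_iff
proof (intro conjI ballI subgroup_centralizer W(1))
  fix g c assume g: "g \<in> carrier G" and c: "c \<in> centralizer W"
  have cC: "c \<in> carrier G" using c by (simp add: centralizer_def)
  have "commute (conjg g c) w" if w: "w \<in> W" for w
  proof -
    have "conjg (inv g) w \<in> W" using W g w by simp
    then have "commute c (conjg (inv g) w)" using c by (simp add: centralizer_def)
    then have "commute (conjg g c) (conjg g (conjg (inv g) w))"
      using g cC W(1) w by (subst commute_conjg) auto
    then show ?thesis using g W(1) w by auto
  qed
  then show "conjg g c \<in> centralizer W" using g cC by (simp add: centralizer_def)
qed

text \<open>
  Written additively, every \<open>x\<close> satisfies \<open>(x - 1)\<^sup>2 = 0\<close> on \<open>W\<close>, so \<open>x [^] q\<close> acts trivially on the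
  elements of \<open>W\<close> of order \<open>q\<close>, and an element of these fixed by a Sylow \<open>q\<close>-subgroup is central.
\<close>

lemma center_nontrivial_of_engel:
  assumes W: "W \<lhd> G" "W \<noteq> {\<one>}" and ab: "\<And>u v. u \<in> W \<Longrightarrow> v \<in> W \<Longrightarrow> commute u v"
    and engel: "\<And>x a. x \<in> carrier G \<Longrightarrow> a \<in> W \<Longrightarrow> commute x (inv a \<otimes> conjg x a)"
  obtains b where "b \<in> carrier G" "b \<noteq> \<one>" "\<And>x. x \<in> carrier G \<Longrightarrow> commute b x"
proof -
  have WG: "subgroup W G" using W(1) by (rule normal_imp_subgroup)
  note [simp] = subgroup.mem_carrier[OF WG] subgroup.m_closed[OF WG] subgroup.m_inv_closed[OF WG]
  have "card W \<noteq> 1" using W(2) card_subgroup_eq_1_iff[OF WG] by simp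
  then obtain q where q: "prime q" "q dvd card W" using prime_factor_nat by blast
  define B where "B = {a \<in> W. a [^] q = \<one>}"
  have BW: "a \<in> W" "a [^] q = \<one>" if "a \<in> B" for a using that by (auto simp: B_def)
  have pw: "(u \<otimes> v) [^] n = u [^] n \<otimes> v [^] n" if "u \<in> W" "v \<in> W" for u v and n :: nat
    using ab[OF that] that unfolding commute_def by (intro pow_mult_distrib) simp_all
  have BG: "subgroup B G"
  proof (rule subgroupI)
    show "B \<subseteq> carrier G" "B \<noteq> {}" using subgroup.one_closed[OF WG] by (auto simp: B_def)
  qed (auto simp: B_def pw nat_pow_inv)
  have Bcj: "conjg g a \<in> B" if "g \<in> carrier G" "a \<in> B" for g a
  proof -
    have aC: "a \<in> carrier G" using BW(1)[OF that(2)] by simp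
    have "conjg g a [^] q = conjg g (a [^] q)" using conjg_pow[OF that(1) aC] by (rule sym)
    then have "conjg g a [^] q = \<one>" using BW(2)[OF that(2)] that(1) by simp
    moreover have "conjg g a \<in> W" using W(1) that(1) BW(1)[OF that(2)] by (rule normal_conjg)
    ultimately show ?thesis by (simp add: B_def)
  qed
  obtain w where w: "w \<in> W" "ord w = q" by (rule exists_prime_order[OF WG q])
  then have "w [^] q = \<one>" using pow_ord_eq_1[of w] by simp
  then have "w \<in> B" using w(1) unfolding B_def by blast
  then have qB: "q dvd card B" using ord_dvd_card_subgroup[OF BG, of w] w(2) by simp
  have xq: "commute (x [^] q) a" if x: "x \<in> carrier G" and a: "a \<in> B" for x a
  proof -
    define c where "c = inv a \<otimes> conjg x a"
    have cW: "c \<in> W" using BW[OF a] normal_conjg[OF W(1) x] by (simp add: c_def)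
    have ac: "conjg x a = a \<otimes> c" using BW[OF a] x by (simp add: c_def)
    have cc: "conjg x c = c" using engel[OF x BW(1)[OF a]] cW x by (simp add: c_def conjg_eq_self_iff)
    have "c [^] q = (inv a) [^] q \<otimes> conjg x a [^] q"
      unfolding c_def using BW(1)[OF a] normal_conjg[OF W(1) x] by (intro pw) simp_all
    then have cq: "c [^] q = \<one>"
      using BW[OF a] BW(2)[OF Bcj[OF x a]] by (simp add: nat_pow_inv)
    \<comment> \<open>Additively \<open>c\<close> is \<open>(x - 1) a\<close>, which
      \<open>x\<close> fixes, so each iteration adds another \<open>c\<close>; at
      \<open>n = q\<close> their sum vanishes.\<close>
    have "conjg (x [^] n) a = a \<otimes> c [^] n" for n :: nat
    proof (induction n)
      case (Suc n)
      have "conjg (x [^] Suc n) a = conjg x (conjg (x [^] n) a)"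
        using x BW[OF a] nat_pow_Suc2[OF x, of n] by (simp add: conjg_conjg)
      also have "\<dots> = a \<otimes> c \<otimes> c [^] n" using Suc x BW[OF a] cW ac cc by (simp add: conjg_mult conjg_pow)
      also have "\<dots> = a \<otimes> c [^] Suc n" using BW[OF a] cW nat_pow_Suc2[of c n] by (simp add: m_assoc)
      finally show ?case .
    qed (use BW[OF a] in simp)
    from this[of q] have "conjg (x [^] q) a = a" using cq BW[OF a] by simp
    then show ?thesis using x BW[OF a] by (simp add: conjg_eq_self_iff)
  qed
  obtain Q where Q: "sylow_of q Q (carrier G)" using sylow_of_exists[OF subgroup_self q(1)] by blast
  then have QG: "subgroup Q G" "card Q = q ^ multiplicity q (card (carrier G))" by (auto simp: sylow_of_def)
  obtain b where b: "b \<in> B" "b \<noteq> \<one>" "\<And>g. g \<in> Q \<Longrightarrow> commute g b"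
  proof (rule pgroup_centralizes_nontrivial[OF QG q(1) BG qB])
    show "conjg g b \<in> B" if "g \<in> Q" "b \<in> B" for g b
      using subgroup.mem_carrier[OF QG(1) that(1)] that(2) by (rule Bcj)
  qed (rule that)
  have bC: "b \<in> carrier G" using BW[OF b(1)] by simp
  define C where "C = centralizer {b}"
  have CG: "subgroup C G" unfolding C_def using bC by (intro subgroup_centralizer) simp
  have "C = carrier G"
  proof (rule subgroup_eq_carrierI[OF CG])
    fix s :: nat assume s: "prime s"
    show "\<exists>S. sylow_of s S (carrier G) \<and> S \<subseteq> C"
    proof (cases "s = q")
      case True
      have "Q \<subseteq> C" using b subgroup.mem_carrier[OF QG(1)] by (auto simp: C_def centralizer_def)
      then show ?thesis using Q True by blast
    next
      case False
      obtain S where S: "sylow_of s S (carrier G)" using sylow_of_exists[OF subgroup_self s] by blast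
      then have SG: "subgroup S G" "card S = s ^ multiplicity s (card (carrier G))" by (auto simp: sylow_of_def)
      have "x \<in> C" if xS: "x \<in> S" for x
      proof -
        have x: "x \<in> carrier G" using SG(1) xS by (rule subgroup.mem_carrier)
        have "ord x dvd s ^ multiplicity s (card (carrier G))"
          using ord_dvd_card_subgroup[OF SG(1) xS] SG(2) by simp
        moreover have "coprime q s" using False primes_coprime[OF q(1) s] by auto
        then have "coprime q (s ^ multiplicity s (card (carrier G)))" by simp
        ultimately have "coprime q (ord x)" using coprime_divisors dvd_refl by blast
        \<comment> \<open>As \<open>ord x\<close> is prime to \<open>q\<close>, \<open>x\<close> is
          a power of \<open>x [^] q\<close>, which already centralizes \<open>b\<close>.\<close>
        then obtain j where j: "[q * j = Suc 0] (mod ord x)" using cong_solve_coprime_nat by blast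
        then have "(x [^] q) [^] j = x [^] (1::nat)" using x by (simp only: nat_pow_pow pow_eq_iff_cong One_nat_def)
        moreover have "commute b ((x [^] q) [^] j)"
          by (rule commute_pow[OF _ bC commute_sym[OF xq[OF x b(1)]]]) (use x in simp)
        ultimately have "commute b x" using x by simp
        then show ?thesis using x by (simp add: C_def centralizer_def commute_sym)
      qed
      then show ?thesis using S by blast
    qed
  qed
  then have "commute b x" if "x \<in> carrier G" for x
    using that by (auto simp: C_def centralizer_def intro: commute_sym)
  with b bC that show ?thesis by blast
qed

lemma commutator_eq_one_iff:
  "a \<in> carrier G \<Longrightarrow> b \<in> carrier G \<Longrightarrow> commutator G a b = \<one> \<longleftrightarrow> commute a b"
proof -
  assume ab: "a \<in> carrier G" "b \<in> carrier G"
  have "commutator G a b = inv (b \<otimes> a) \<otimes> (a \<otimes> b)" using ab by (simp add: commutator_def inv_mult_group m_assoc)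
  then show ?thesis using ab by (simp add: inv_solve_left' commute_def)
qed

text \<open>For \<open>z = conjg (inv x) y\<close> the commutator of \<open>x\<close> and
  \<open>y\<close> is \<open>inv z \<otimes> y\<close>, which commutes with \<open>y\<close> iff
  \<open>z\<close> does. Conjugation by \<open>x\<close> carries the pair \<open>z\<close>,
  \<open>y\<close> to \<open>y\<close>, \<open>conjg x y\<close>.\<close>

lemma engel2_eq_one_iff:
  assumes x: "x \<in> carrier G" and y: "y \<in> carrier G"
  shows "engel2 G x y = \<one> \<longleftrightarrow> commute y (conjg x y)"
proof -
  define z where "z = conjg (inv x) y"
  have z: "z \<in> carrier G" using x y by (simp add: z_def)
  have c: "commutator G x y = inv z \<otimes> y"
    using x y by (simp add: z_def commutator_def conjg_def m_assoc inv_mult_group)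
  have "engel2 G x y = \<one> \<longleftrightarrow> commute (inv z \<otimes> y) y"
    unfolding engel2_def c using z y by (intro commutator_eq_one_iff) auto
  also have "\<dots> \<longleftrightarrow> commute y z"
  proof
    assume "commute (inv z \<otimes> y) y"
    then have "commute y (inv z \<otimes> y)" by (rule commute_sym)
    moreover have "commute y (inv y)" using y by (simp add: commute_inv)
    ultimately have "commute y (inv z \<otimes> y \<otimes> inv y)" using z y by (simp only: commute_mult inv_closed m_closed)
    then have "commute y (inv z)" using z y by (simp add: m_assoc)
    then show "commute y z" using commute_inv[of "inv z" y] z y by simp
  next
    assume "commute y z"
    then have "commute y (inv z \<otimes> y)" using z y by (intro commute_mult commute_inv) auto
    then show "commute (inv z \<otimes> y) y" by (rule commute_sym)
  qed
  also have "\<dots> \<longleftrightarrow> commute (conjg x y) (conjg x z)" using x y z by (simp add: commute_conjg)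
  also have "\<dots> \<longleftrightarrow> commute y (conjg x y)" using x y by (auto simp: z_def intro: commute_sym)
  finally show ?thesis .
qed

text \<open>
  The conjugates of an element \<open>g\<close> of the intersection commute, so they lie in the abelian normal
  subgroup \<open>Z\<close>, and the elements of \<open>Z\<close> that are right 2-Engel form a normal subgroup \<open>W\<close>.
\<close>

lemma engel2_trivial:
  assumes hyp: "hypercenter G = {\<one>}"
  shows "right_engel2 G \<inter> left_engel2 G = {\<one>}"
proof -
  have "g = \<one>" if gRL: "g \<in> right_engel2 G \<inter> left_engel2 G" for g
  proof (rule ccontr)
    assume g1: "g \<noteq> \<one>"
    have g: "g \<in> carrier G" using gRL by (simp add: right_engel2_def)
    have gr: "commute x (conjg g x)" if "x \<in> carrier G" for x
      using gRL that g by (simp add: right_engel2_def engel2_eq_one_iff)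
    have gl: "commute g (conjg x g)" if "x \<in> carrier G" for x
      using gRL that g by (simp add: left_engel2_def engel2_eq_one_iff)
    define D where "D = {conjg x g | x. x \<in> carrier G}"
    have DC: "D \<subseteq> carrier G" using g by (auto simp: D_def)
    have Dcj: "conjg x d \<in> D" if "x \<in> carrier G" "d \<in> D" for x d
      using that g by (auto simp: D_def conjg_conjg)
    have Dcomm: "commute d e" if "d \<in> D" "e \<in> D" for d e
    proof -
      obtain x y where xy: "x \<in> carrier G" "y \<in> carrier G" "d = conjg x g" "e = conjg y g"
        using \<open>d \<in> D\<close> \<open>e \<in> D\<close> by (auto simp: D_def)
      have "commute (conjg x g) (conjg x (conjg (inv x \<otimes> y) g))"
        using gl[of "inv x \<otimes> y"] xy g by (simp add: commute_conjg)
      moreover have "conjg x (conjg (inv x \<otimes> y) g) = conjg y g" using xy g by (simp add: conjg_conjg)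
      ultimately show ?thesis using xy by simp
    qed
    define E where "E = centralizer D"
    have En: "E \<lhd> G" unfolding E_def using DC Dcj by (rule normal_centralizer)
    have EG: "subgroup E G" using En by (rule normal_imp_subgroup)
    have EC: "E \<subseteq> carrier G" using EG by (rule subgroup.subset)
    \<comment> \<open>The centre of \<open>E\<close>. The conjugates of \<open>g\<close> commute
      with one another, so \<open>g\<close> lies in \<open>E\<close>, and by the choice of
      \<open>E\<close> it is central there.\<close>
    define Z where "Z = E \<inter> centralizer E"
    have Zn: "Z \<lhd> G" unfolding Z_def
      by (intro normal_subgroup_intersect En normal_centralizer EC normal_conjg)
    have ZG: "subgroup Z G" using Zn by (rule normal_imp_subgroup)
    note [simp] = subgroup.mem_carrier[OF ZG] subgroup.m_closed[OF ZG] subgroup.m_inv_closed[OF ZG]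
      normal_conjg[OF Zn]
    have ab: "commute u v" if "u \<in> Z" "v \<in> Z" for u v
    proof -
      have "u \<in> centralizer E" "v \<in> E" using that by (simp_all add: Z_def)
      then show ?thesis by (simp add: centralizer_def)
    qed
    have gD: "g \<in> D" unfolding D_def by (rule CollectI, rule exI[of _ \<one>]) (simp add: g)
    have "g \<in> E" using gD g Dcomm by (auto simp: E_def centralizer_def)
    moreover have "g \<in> centralizer E" using gD g by (auto simp: E_def centralizer_def intro: commute_sym)
    ultimately have gZ: "g \<in> Z" by (simp add: Z_def)
    \<comment> \<open>The operator \<open>x - 1\<close> in additive notation; the condition defining
      \<open>W\<close> then reads \<open>(x - 1)\<^sup>2 a = 0\<close>.\<close>
    define f where "f x a = inv a \<otimes> conjg x a" for x a
    have f_mult: "f x (a \<otimes> b) = f x a \<otimes> f x b" if "x \<in> carrier G" "a \<in> Z" "b \<in> Z" for x a b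
    proof -
      have "f x (a \<otimes> b) = inv b \<otimes> (inv a \<otimes> conjg x a) \<otimes> conjg x b"
        using that by (simp add: f_def conjg_mult inv_mult_group m_assoc)
      also have "inv b \<otimes> (inv a \<otimes> conjg x a) = (inv a \<otimes> conjg x a) \<otimes> inv b"
        using ab[of "inv b" "inv a \<otimes> conjg x a"] that by (simp add: commute_def)
      finally show ?thesis using that by (simp add: f_def m_assoc)
    qed
    have fZ [simp]: "f x a \<in> Z" if "x \<in> carrier G" "a \<in> Z" for x a
      using that by (simp add: f_def)
    define W where "W = {a \<in> Z. \<forall>x \<in> carrier G. commute x (f x a)}"
    have WZ: "a \<in> Z" if "a \<in> W" for a using that by (simp add: W_def)
    have WG: "subgroup W G"
    proof (rule subgroupI)
      show "W \<subseteq> carrier G" by (auto simp: W_def)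
      have "\<one> \<in> W" using subgroup.one_closed[OF ZG] by (simp add: W_def f_def)
      then show "W \<noteq> {}" by blast
      show mult: "a \<otimes> b \<in> W" if "a \<in> W" "b \<in> W" for a b
        using that by (simp add: W_def f_mult commute_mult)
      show "inv a \<in> W" if a: "a \<in> W" for a
      proof -
        have "f x (inv a) = inv (f x a)" if x: "x \<in> carrier G" for x
        proof -
          have "f x (inv a) \<otimes> f x a = f x (inv a \<otimes> a)" using WZ[OF a] x by (intro f_mult[symmetric]) auto
          also have "\<dots> = \<one>" using WZ[OF a] x by (simp add: f_def)
          finally show ?thesis using WZ[OF a] x by (intro inv_equality[symmetric]) auto
        qed
        then show ?thesis using a by (simp add: W_def commute_inv)
      qed
    qed
    have Wn: "W \<lhd> G"
      unfolding normal_conjg_iff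
    proof (intro conjI WG ballI)
      fix y a assume y: "y \<in> carrier G" and a: "a \<in> W"
      have "commute x (f x (conjg y a))" if x: "x \<in> carrier G" for x
      proof -
        define x' where "x' = conjg (inv y) x"
        have x': "x' \<in> carrier G" "x = conjg y x'" using x y by (simp_all add: x'_def)
        have "commute x' (f x' a)" using a x' by (simp add: W_def)
        then have "commute (conjg y x') (conjg y (f x' a))" using y x'(1) WZ[OF a] by (simp add: commute_conjg)
        moreover have "conjg y (f x' a) = f x (conjg y a)"
          unfolding x'(2) f_def using y x'(1) WZ[OF a] by (simp add: conjg_def m_assoc inv_mult_group)
        ultimately show ?thesis using x'(2) by simp
      qed
      then show "conjg y a \<in> W" using WZ[OF a] y by (simp add: W_def)
    qed
    \<comment> \<open>The right 2-Engel property concerns conjugates of \<open>x\<close> by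
      \<open>g\<close>, membership in \<open>W\<close> those of \<open>g\<close> by
      \<open>x\<close>; the link is \<open>f x g = conjg (inv g) x \<otimes> inv x\<close>.\<close>
    have "commute x (f x g)" if x: "x \<in> carrier G" for x
    proof -
      have "commute x (conjg (inv g) (inv x))"
      proof -
        have "commute (conjg (inv g) x) x"
          using gr[OF x] g x commute_conjg[of "inv g" x "conjg g x"] by simp
        then have "commute x (conjg (inv g) x)" by (rule commute_sym)
        then have "commute x (inv (conjg (inv g) x))" using x g by (intro commute_inv) auto
        then show ?thesis using x g by (simp add: conjg_inv)
      qed
      then have "commute x (conjg (inv g) x)"
        using x g commute_inv[of "conjg (inv g) (inv x)" x] by (simp add: conjg_inv)
      then have "commute x (conjg (inv g) x \<otimes> inv x)" using x g by (intro commute_mult commute_inv) auto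
      moreover have "conjg (inv g) x \<otimes> inv x = f x g" using x g by (simp add: f_def conjg_def m_assoc)
      ultimately show ?thesis by simp
    qed
    then have "g \<in> W" using gZ by (simp add: W_def)
    then have "W \<noteq> {\<one>}" using g1 by blast
    then obtain b where b: "b \<in> carrier G" "b \<noteq> \<one>" "\<And>x. x \<in> carrier G \<Longrightarrow> commute b x"
      using center_nontrivial_of_engel[OF Wn] ab WZ unfolding W_def f_def by blast
    then have "b \<in> upper_central G 1" by (simp add: commutator_eq_one_iff)
    then have "b \<in> hypercenter G" unfolding hypercenter_def by blast
    then show False using b hyp by blast
  qed
  moreover have "\<one> \<in> right_engel2 G \<inter> left_engel2 G"
    by (simp add: right_engel2_def left_engel2_def engel2_eq_one_iff)
  ultimately show ?thesis by blast
qed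

section \<open>Minimal normal subgroups\<close>

text \<open>Normality of \<open>S\<close> in \<open>N\<close>, stated inside \<open>G\<close> so
  that conjugates and intersections need no change of carrier.\<close>

definition stable_in :: "'a set \<Rightarrow> 'a set \<Rightarrow> bool" where
  "stable_in N S \<longleftrightarrow> subgroup S G \<and> S \<subseteq> N \<and> (\<forall>n \<in> N. \<forall>s \<in> S. conjg n s \<in> S)"

lemma stable_in_normal: "subgroup N G \<Longrightarrow> S \<lhd> G\<lparr>carrier := N\<rparr> \<longleftrightarrow> stable_in N S"
proof -
  assume N: "subgroup N G"
  have "S \<lhd> G\<lparr>carrier := N\<rparr> \<longleftrightarrow> subgroup S (G\<lparr>carrier := N\<rparr>) \<and> (\<forall>n \<in> N. \<forall>s \<in> S. conjg n s \<in> S)"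
    using group.normal_inv_iff[OF subgroup_group[OF N], of S] m_inv_consistent[OF N]
    by (simp add: conjg_def)
  moreover have "subgroup S (G\<lparr>carrier := N\<rparr>) \<longleftrightarrow> subgroup S G \<and> S \<subseteq> N"
    using incl_subgroup[OF N, of S] subgroup_in_subgroup[OF N, of S]
      subgroup.subset[of S "G\<lparr>carrier := N\<rparr>"] by auto
  ultimately show ?thesis by (auto simp: stable_in_def)
qed

lemma set_mult_commuting_subgroup:
  assumes S: "subgroup S G" and D: "subgroup D G" and comm: "\<And>s d. s \<in> S \<Longrightarrow> d \<in> D \<Longrightarrow> commute s d"
  shows "subgroup (S <#> D) G"
proof (rule subgroupI)
  note [simp] = subgroup.mem_carrier[OF S] subgroup.mem_carrier[OF D]
    subgroup.m_closed[OF S] subgroup.m_closed[OF D] subgroup.m_inv_closed[OF S] subgroup.m_inv_closed[OF D]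
  have c: "d \<otimes> s = s \<otimes> d" if "s \<in> S" "d \<in> D" for s d
    using comm[OF that] by (simp add: commute_def)
  have SDI: "s \<otimes> d \<in> S <#> D" if "s \<in> S" "d \<in> D" for s d
    using that by (auto simp: set_mult_def)
  show "S <#> D \<subseteq> carrier G" by (auto simp: set_mult_def)
  show "S <#> D \<noteq> {}" using subgroup.one_closed[OF S] subgroup.one_closed[OF D] by (auto simp: set_mult_def)
  show "inv a \<in> S <#> D" if "a \<in> S <#> D" for a
  proof -
    obtain s d where sd: "s \<in> S" "d \<in> D" "a = s \<otimes> d" using \<open>a \<in> S <#> D\<close> by (auto simp: set_mult_def)
    then have "inv a = inv s \<otimes> inv d" using c[of "inv s" "inv d"] by (simp add: inv_mult_group)
    then show ?thesis using sd SDI[of "inv s" "inv d"] by simp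
  qed
  show "a \<otimes> b \<in> S <#> D" if ab: "a \<in> S <#> D" "b \<in> S <#> D" for a b
  proof -
    obtain s d t e where sd: "s \<in> S" "d \<in> D" "a = s \<otimes> d" "t \<in> S" "e \<in> D" "b = t \<otimes> e"
      using ab by (auto simp: set_mult_def)
    then have "a \<otimes> b = s \<otimes> (d \<otimes> t) \<otimes> e" by (simp add: m_assoc)
    also have "\<dots> = (s \<otimes> t) \<otimes> (d \<otimes> e)" using sd c[of t d] by (simp add: m_assoc)
    finally have "a \<otimes> b = (s \<otimes> t) \<otimes> (d \<otimes> e)" .
    then show ?thesis using sd SDI[of "s \<otimes> t" "d \<otimes> e"] by simp
  qed
qed

lemma engel_connected_via_commuting:
  assumes A: "A \<subseteq> carrier G" and b: "b \<in> carrier G" "b \<noteq> \<one>" "\<And>a. a \<in> A \<Longrightarrow> commute a b"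
    and xy: "x \<in> A" "y \<in> A" "x \<noteq> \<one>" "y \<noteq> \<one>"
  shows "(x, y) \<in> engel_rel\<^sup>*"
proof -
  have "(x, b) \<in> engel_rel" "(b, y) \<in> engel_rel"
    using assms b(3)[OF xy(1)] commute_sym[OF b(3)[OF xy(2)]] by (auto intro!: commute_engel_rel)
  then show ?thesis by (meson r_into_rtrancl rtrancl_trans)
qed

text \<open>Take \<open>S\<close> of least order among the nontrivial normal subgroups of
  \<open>N\<close>. A conjugate of \<open>S\<close> equals \<open>S\<close> or meets it trivially
  and then lies in \<open>D\<close>, the centralizer of \<open>S\<close> in \<open>N\<close>. If
  \<open>D\<close> were trivial, \<open>S\<close> would be normal in \<open>G\<close> and smaller
  than \<open>N\<close>. The conjugates generate a normal subgroup, so \<open>S <#> D\<close> is all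
  of \<open>N\<close>; the product need not be direct.\<close>

lemma minimal_normal_decomposition:
  assumes N: "N \<lhd> G" and min: "\<And>M. M \<lhd> G \<Longrightarrow> M \<noteq> {\<one>} \<Longrightarrow> card N \<le> card M"
    and S0: "stable_in N S0" "S0 \<noteq> {\<one>}" "S0 \<noteq> N"
  obtains S D where "subgroup S G" "subgroup D G" "S \<noteq> {\<one>}" "D \<noteq> {\<one>}"
    "\<And>s d. s \<in> S \<Longrightarrow> d \<in> D \<Longrightarrow> commute s d" "N = S <#> D"
proof -
  have NG: "subgroup N G" using N by (rule normal_imp_subgroup)
  note [simp] = subgroup.mem_carrier[OF NG]
  define P where "P T \<longleftrightarrow> stable_in N T \<and> T \<noteq> {\<one>}" for T
  obtain S where S: "P S" "\<And>T. P T \<Longrightarrow> card S \<le> card T"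
    using ex_has_least_nat[of P S0 card] S0 by (auto simp: P_def)
  have SG: "subgroup S G" "S \<subseteq> N" "\<And>n s. n \<in> N \<Longrightarrow> s \<in> S \<Longrightarrow> conjg n s \<in> S" and S1: "S \<noteq> {\<one>}"
    using S(1) by (auto simp: P_def stable_in_def)
  have SC: "S \<subseteq> carrier G" using SG(1) by (rule subgroup.subset)
  have "card S0 < card N"
    using S0 finite_subgroup[OF NG] by (intro psubset_card_mono) (auto simp: stable_in_def)
  then have cSN: "card S < card N" using S(2)[of S0] S0 by (simp add: P_def)
  define D where "D = N \<inter> centralizer S"
  have DG: "subgroup D G" unfolding D_def using NG subgroup_centralizer[OF SC] by (rule subgroups_Inter_pair)
  have comm: "commute s d" if "s \<in> S" "d \<in> D" for s d
    using that unfolding D_def centralizer_def by (simp add: commute_sym)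
  have conj: "conjg g ` S = S \<or> conjg g ` S \<subseteq> D" if g: "g \<in> carrier G" for g
  proof -
    define T where "T = conjg g ` S"
    have TG: "subgroup T G" unfolding T_def using SG(1) g by (rule subgroup_conjg_image)
    have TN: "T \<subseteq> N" using SG(2) normal_conjg[OF N g] by (auto simp: T_def)
    have T: "conjg n t \<in> T" if "n \<in> N" "t \<in> T" for n t
    proof -
      obtain s where s: "s \<in> S" "t = conjg g s" using \<open>t \<in> T\<close> by (auto simp: T_def)
      have "conjg (inv g) n \<in> N" using normal_conjg[OF N] g \<open>n \<in> N\<close> by simp
      then have "conjg (conjg (inv g) n) s \<in> S" using SG s by blast
      moreover have "conjg n t = conjg g (conjg (conjg (inv g) n) s)"
        using s SC g \<open>n \<in> N\<close> by (simp add: subset_eq) (simp add: conjg_def m_assoc inv_mult_group)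
      ultimately show ?thesis by (auto simp: T_def)
    qed
    have cT: "card T = card S" using SC g by (simp add: T_def card_image inj_on_conjg)
    define I where "I = S \<inter> T"
    have I: "stable_in N I"
      using SG T subgroups_Inter_pair[OF SG(1) TG] by (auto simp: stable_in_def I_def)
    show ?thesis
    proof (cases "I = {\<one>}")
      case False
      then have "card S \<le> card I" using S(2) I by (simp add: P_def)
      then have "I = S" using finite_subgroup[OF SG(1)] by (intro card_seteq) (auto simp: I_def)
      then have "S \<subseteq> T" by (auto simp: I_def)
      then have "S = T" using cT finite_subgroup[OF TG] by (simp add: card_subset_eq)
      then show ?thesis by (simp add: T_def)
    next
      case True
      have "T \<subseteq> D"
      proof
        fix t assume t: "t \<in> T"
        then have tC: "t \<in> carrier G" "t \<in> N" using TN by auto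
        have "commute t s" if s: "s \<in> S" for s
        proof -
          have sC: "s \<in> carrier G" "s \<in> N" using s SG by auto
          \<comment> \<open>This commutator, bracketed in two ways, lies in \<open>S\<close> and in
            \<open>T\<close>.\<close>
          have "conjg t s \<otimes> inv s \<in> S" using SG s tC by (simp add: subgroup.m_closed subgroup.m_inv_closed)
          moreover have "conjg t s \<otimes> inv s = t \<otimes> conjg s (inv t)" using tC sC by (simp add: conjg_def m_assoc)
          moreover have "t \<otimes> conjg s (inv t) \<in> T"
            using TG T t sC by (simp add: subgroup.m_closed subgroup.m_inv_closed)
          ultimately have "conjg t s \<otimes> inv s = \<one>" using True by (auto simp: I_def)
          then have "conjg t s = s" using tC sC by (simp add: inv_solve_right')
          then show ?thesis using tC sC by (simp add: conjg_eq_self_iff)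
        qed
        then show "t \<in> D" using tC by (simp add: D_def centralizer_def)
      qed
      then show ?thesis by (simp add: T_def)
    qed
  qed
  have "D \<noteq> {\<one>}"
  proof
    assume D1: "D = {\<one>}"
    have "conjg g ` S = S" if g: "g \<in> carrier G" for g
    proof (rule ccontr)
      assume "conjg g ` S \<noteq> S"
      then have "conjg g ` S \<subseteq> {\<one>}" using conj[OF g] D1 by blast
      then have "S \<subseteq> {\<one>}" using g SC by (auto simp: subset_eq)
      then show False using S1 subgroup.one_closed[OF SG(1)] by blast
    qed
    then have "S \<lhd> G" unfolding normal_conjg_iff using SG(1) by blast
    then show False using min[of S] S1 cSN by simp
  qed
  moreover have "N = S <#> D"
  proof -
    have SD: "subgroup (S <#> D) G" using SG(1) DG comm by (rule set_mult_commuting_subgroup)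
    have sub: "S \<subseteq> S <#> D" "D \<subseteq> S <#> D"
      using subgroup.one_closed[OF SG(1)] subgroup.one_closed[OF DG] SC subgroup.subset[OF DG]
      by (force simp: set_mult_def)+
    define B where "B = (\<Union>g \<in> carrier G. conjg g ` S)"
    have BC: "B \<subseteq> carrier G" using SC by (auto simp: B_def)
    have "conjg g b \<in> B" if "b \<in> B" "g \<in> carrier G" for b g
    proof -
      obtain h s where hs: "h \<in> carrier G" "s \<in> S" "b = conjg h s" using \<open>b \<in> B\<close> by (auto simp: B_def)
      then have "conjg g b = conjg (g \<otimes> h) s" using SC \<open>g \<in> carrier G\<close> by (auto simp: conjg_conjg)
      moreover have "conjg (g \<otimes> h) s \<in> B"
        unfolding B_def by (rule UN_I[OF m_closed[OF \<open>g \<in> carrier G\<close> hs(1)] imageI[OF hs(2)]])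
      ultimately show ?thesis by simp
    qed
    then have T: "generate G B \<lhd> G" using BC by (intro normal_generateI) (auto simp: conjg_def)
    have "S \<subseteq> B"
    proof
      fix s assume s: "s \<in> S"
      then have "conjg \<one> s \<in> B" unfolding B_def by (rule UN_I[OF one_closed imageI])
      then show "s \<in> B" using s SC by auto
    qed
    then have "S \<subseteq> generate G B" by (auto intro: generate.incl)
    then have "generate G B \<noteq> {\<one>}" using S1 subgroup.one_closed[OF SG(1)] by auto
    then have "card N \<le> card (generate G B)" by (rule min[OF T])
    moreover have "B \<subseteq> S <#> D"
    proof
      fix z assume "z \<in> B"
      then obtain g where g: "g \<in> carrier G" "z \<in> conjg g ` S" by (auto simp: B_def)
      then show "z \<in> S <#> D" using conj[OF g(1)] sub by auto
    qed
    then have "generate G B \<subseteq> S <#> D" using SD by (rule generate_subgroup_incl)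
    moreover have SDN: "S <#> D \<subseteq> N"
    proof
      fix z assume "z \<in> S <#> D"
      then obtain s d where sd: "s \<in> S" "d \<in> D" "z = s \<otimes> d" by (auto simp: set_mult_def)
      then have "s \<in> N" "d \<in> N" using SG(2) by (auto simp: D_def)
      then show "z \<in> N" using sd(3) subgroup.m_closed[OF NG] by simp
    qed
    ultimately have "card N \<le> card (S <#> D)" using finite_subgroup[OF SD] by (meson card_mono order_trans)
    then show ?thesis using card_seteq[OF finite_subgroup[OF NG] SDN] by simp
  qed
  ultimately show ?thesis using that[OF SG(1) DG S1] comm by blast
qed

text \<open>Conjugation on \<open>N\<close> has kernel \<open>centralizer N\<close>, so it embeds
  \<open>G\<close> into the automorphisms of \<open>N\<close>, and the elements of \<open>N\<close>
  induce the inner ones.\<close>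

lemma almost_simpleI:
  assumes N: "N \<lhd> G" "N \<noteq> {\<one>}" and simple: "\<And>S. stable_in N S \<Longrightarrow> S = N \<or> S = {\<one>}"
    and C: "centralizer N = {\<one>}"
  shows "almost_simple G"
proof -
  have NG: "subgroup N G" using N(1) by (rule normal_imp_subgroup)
  note [simp] = subgroup.mem_carrier[OF NG] subgroup.m_closed[OF NG] subgroup.m_inv_closed[OF NG]
    subgroup.one_closed[OF NG] normal_conjg[OF N(1)]
  \<comment> \<open>\<open>almost_simple\<close> asks for a plain monoid record, whereas
    \<open>G\<lparr>carrier := N\<rparr>\<close> may carry further fields.\<close>
  define S :: "'a monoid" where "S = \<lparr>carrier = N, monoid.mult = (\<otimes>), one = \<one>\<rparr>"
  have S [simp]: "carrier S = N" "x \<otimes>\<^bsub>S\<^esub> y = x \<otimes> y" "\<one>\<^bsub>S\<^esub> = \<one>" for x y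
    by (simp_all add: S_def)
  interpret S: group S
  proof (rule groupI)
    show "\<exists>y \<in> carrier S. y \<otimes>\<^bsub>S\<^esub> x = \<one>\<^bsub>S\<^esub>" if "x \<in> carrier S" for x
      using that by (intro bexI[of _ "inv x"]) simp_all
  qed (simp_all add: m_assoc)
  have invS [simp]: "inv\<^bsub>S\<^esub> x = inv x" if "x \<in> N" for x
    using that by (intro S.inv_equality) auto
  interpret NN: simple_group "G\<lparr>carrier := N\<rparr>"
  proof (intro simple_group.intro simple_group_axioms.intro subgroup_group NG)
    have "card N \<noteq> 1" using N(2) card_subgroup_eq_1_iff[OF NG] by simp
    moreover have "card N > 0" using NG fin by (rule subgroup.finite_imp_card_positive)
    ultimately have "1 < card N" by linarith
    then show "1 < order (G\<lparr>carrier := N\<rparr>)" unfolding order_def by simp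
    show "H = carrier (G\<lparr>carrier := N\<rparr>) \<or> H = {\<one>\<^bsub>G\<lparr>carrier := N\<rparr>\<^esub>}" if "H \<lhd> G\<lparr>carrier := N\<rparr>" for H
      using simple[of H] that stable_in_normal[OF NG, of H] by simp
  qed
  have "id \<in> iso (G\<lparr>carrier := N\<rparr>) S" by (simp add: iso_def hom_def)
  then have "simple_group S" using NN.iso_simple S.group_axioms by blast
  moreover have "\<not> comm_group S"
  proof
    assume "comm_group S"
    then have "x \<otimes> y = y \<otimes> x" if "x \<in> N" "y \<in> N" for x y
      using comm_monoid.m_comm[OF comm_group.axioms(1), of S x y] that by simp
    then have "N \<subseteq> centralizer N" by (auto simp: centralizer_def commute_def)
    then show False using C N(2) subgroup.one_closed[OF NG] by auto
  qed
  moreover define \<Phi> where "\<Phi> g = restrict (conjg g) N" for g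
  have bij: "bij_betw (conjg g) N N" if g: "g \<in> carrier G" for g
    using conjg_image_eqI[OF g NG] inj_on_conjg[OF g subgroup.subset[OF NG]] g by (simp add: bij_betw_def)
  have \<Phi>Bij: "\<Phi> g \<in> Bij N" if "g \<in> carrier G" for g
    using bij[OF that] by (simp add: Bij_def \<Phi>_def)
  have \<Phi>auto: "\<Phi> g \<in> auto S" if "g \<in> carrier G" for g
    using \<Phi>Bij[OF that] that by (simp add: auto_def hom_def conjg_mult \<Phi>_def)
  have hom: "\<Phi> \<in> hom G (AutoGroup S)"
  proof (rule homI)
    fix g h assume gh: "g \<in> carrier G" "h \<in> carrier G"
    show "\<Phi> (g \<otimes> h) = \<Phi> g \<otimes>\<^bsub>AutoGroup S\<^esub> \<Phi> h"
      using gh \<Phi>Bij by (auto simp: AutoGroup_def BijGroup_def compose_def \<Phi>_def conjg_conjg)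
  qed (use \<Phi>auto in \<open>simp add: AutoGroup_def\<close>)
  interpret \<Phi>: group_hom G "AutoGroup S" \<Phi>
    using hom S.AutoGroup by (simp add: group_hom_def group_hom_axioms_def)
  have inj: "inj_on \<Phi> (carrier G)"
    unfolding \<Phi>.inj_on_one_iff
  proof (intro allI impI)
    fix g assume g: "g \<in> carrier G" "\<Phi> g = \<one>\<^bsub>AutoGroup S\<^esub>"
    have "conjg g x = x" if "x \<in> N" for x
      using fun_cong[OF g(2), of x] that by (simp add: AutoGroup_def BijGroup_def \<Phi>_def)
    then have "g \<in> centralizer N" using g by (simp add: centralizer_def conjg_eq_self_iff)
    then show "g = \<one>" using C by simp
  qed
  define A where "A = \<Phi> ` carrier G"
  have "subgroup A (AutoGroup S)" unfolding A_def by (rule \<Phi>.img_is_subgroup)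
  moreover have "inner_autos S \<subseteq> A"
  proof
    fix f assume "f \<in> inner_autos S"
    then obtain g where g: "g \<in> N" "f = (\<lambda>x \<in> N. g \<otimes> x \<otimes> inv g)" by (auto simp: inner_autos_def)
    then have "f = \<Phi> g" by (simp add: \<Phi>_def conjg_def fun_eq_iff)
    then show "f \<in> A" using g by (auto simp: A_def)
  qed
  moreover have "\<Phi> \<in> iso G (AutoGroup S\<lparr>carrier := A\<rparr>)"
    using hom inj by (simp add: iso_def hom_def A_def bij_betw_def)
  then have "G \<cong> AutoGroup S\<lparr>carrier := A\<rparr>" by (rule is_isoI)
  ultimately show ?thesis unfolding almost_simple_def by blast
qed

lemma almost_simple_or_frobenius:
  assumes xy: "x \<in> carrier G" "x \<noteq> \<one>" "y \<in> carrier G" "y \<noteq> \<one>" "(x, y) \<notin> engel_rel\<^sup>*"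
  shows "almost_simple G \<or> frobenius_group G"
proof -
  define P where "P M \<longleftrightarrow> M \<lhd> G \<and> M \<noteq> {\<one>}" for M
  have "P (carrier G)" using xy normal_conjg_iff subgroup_self by (auto simp: P_def)
  then obtain N where N: "P N" "\<And>M. P M \<Longrightarrow> card N \<le> card M"
    using ex_has_least_nat[of P "carrier G" card] by auto
  have Nn: "N \<lhd> G" "N \<noteq> {\<one>}" using N(1) by (auto simp: P_def)
  have NG: "subgroup N G" using Nn(1) by (rule normal_imp_subgroup)
  have NC: "N \<subseteq> carrier G" using NG by (rule subgroup.subset)
  consider (central) "centralizer N \<noteq> {\<one>}"
    | (decomposable) S where "stable_in N S" "S \<noteq> {\<one>}" "S \<noteq> N"
    | (simple) "centralizer N = {\<one>}" "\<And>S. stable_in N S \<Longrightarrow> S = N \<or> S = {\<one>}"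
    by blast
  then show ?thesis
  proof cases
    case central
    then obtain b where b: "b \<in> centralizer N" "b \<noteq> \<one>"
      using subgroup.one_closed[OF subgroup_centralizer[OF NC]] by blast
    have "(u, v) \<in> engel_rel\<^sup>*" if "u \<in> N" "v \<in> N" "u \<noteq> \<one>" "v \<noteq> \<one>" for u v
    proof (rule engel_connected_via_commuting[OF NC _ b(2) _ that])
      show "commute a b" if "a \<in> N" for a
        using b(1) that by (simp add: centralizer_def commute_sym[of b])
    qed (use b(1) in \<open>simp add: centralizer_def\<close>)
    then have "frobenius_group G" by (rule connected_or_frobenius[OF Nn _ xy])
    then show ?thesis ..
  next
    case decomposable
    have min: "card N \<le> card M" if "M \<lhd> G" "M \<noteq> {\<one>}" for M
      using N(2) that by (simp add: P_def)
    obtain S D where SD: "subgroup S G" "subgroup D G" "S \<noteq> {\<one>}" "D \<noteq> {\<one>}"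
      "\<And>s d. s \<in> S \<Longrightarrow> d \<in> D \<Longrightarrow> commute s d" "N = S <#> D"
      by (rule minimal_normal_decomposition[OF Nn(1) min decomposable]) (assumption | rule that)+
    note [simp] = subgroup.mem_carrier[OF SD(1)] subgroup.mem_carrier[OF SD(2)]
    obtain s0 where s0: "s0 \<in> S" "s0 \<noteq> \<one>" using SD(3) subgroup.one_closed[OF SD(1)] by blast
    obtain d0 where d0: "d0 \<in> D" "d0 \<noteq> \<one>" using SD(4) subgroup.one_closed[OF SD(2)] by blast
    \<comment> \<open>Commuting pairs are joined both ways. If the component \<open>s\<close> of
      \<open>u\<close> is nontrivial, the chain is \<open>u\<close>, \<open>s\<close>,
      \<open>d0\<close>, \<open>s0\<close>; otherwise \<open>u\<close> lies in \<open>D\<close> and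
      commutes with \<open>s0\<close>.\<close>
    have to: "(u, s0) \<in> engel_rel\<^sup>* \<and> (s0, u) \<in> engel_rel\<^sup>*" if u: "u \<in> N" "u \<noteq> \<one>" for u
    proof -
      obtain s d where sd: "s \<in> S" "d \<in> D" "u = s \<otimes> d" using u SD(6) by (auto simp: set_mult_def)
      show ?thesis
      proof (cases "s = \<one>")
        case True
        then have "u \<in> D" using sd by simp
        then have "commute s0 u" "u \<in> carrier G" using SD(5) s0 by auto
        then have "(u, s0) \<in> engel_rel" "(s0, u) \<in> engel_rel"
          using u s0 by (auto intro!: commute_engel_rel commute_sym[of s0 u])
        then show ?thesis by blast
      next
        case False
        have SC: "S \<subseteq> carrier G" using SD(1) by (rule subgroup.subset)
        have "(s, s0) \<in> engel_rel\<^sup>*" "(s0, s) \<in> engel_rel\<^sup>*"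
          using engel_connected_via_commuting[OF SC, of d0] d0 s0 sd False SD(5) by simp_all
        moreover have "commute s u" using sd SD(5) by (simp add: commute_mult)
        then have "(s, u) \<in> engel_rel" "(u, s) \<in> engel_rel"
          using u sd False by (auto intro!: commute_engel_rel commute_sym[of s])
        ultimately show ?thesis by (meson r_into_rtrancl rtrancl_trans)
      qed
    qed
    have "(u, v) \<in> engel_rel\<^sup>*" if "u \<in> N" "v \<in> N" "u \<noteq> \<one>" "v \<noteq> \<one>" for u v
      using to that by (meson rtrancl_trans)
    then have "frobenius_group G" by (rule connected_or_frobenius[OF Nn _ xy])
    then show ?thesis ..
  next
    case simple
    then show ?thesis using almost_simpleI[OF Nn] by blast
  qed
qed

end

theorem theorem3p12:
  fixes G :: "('a, 'b) monoid_scheme"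
  assumes "group G"
    and "finite (carrier G)"
    and "hypercenter G = {\<one>\<^bsub>G\<^esub>}"
    and "\<not> strongly_connected_or_empty (engel2_digraph G)"
  shows "almost_simple G \<or> frobenius_group G"
proof -
  interpret finite_group G
    using assms(1,2) by (simp add: finite_group_def finite_group_axioms_def)
  define D where "D = engel2_digraph G"
  have verts: "verts D = carrier G - {\<one>\<^bsub>G\<^esub>}"
    using engel2_trivial[OF assms(3)] by (simp add: D_def engel2_digraph_def engel2_verts_def)
  have arcs: "(x, y) \<in> arcs_ends D" if "(x, y) \<in> engel_rel" for x y
    using that engel2_trivial[OF assms(3)]
    by (auto simp: D_def engel2_digraph_def engel2_verts_def engel_rel_def arcs_ends_def arc_to_ends_def
        engel2_eq_one_iff image_iff)
  have reach: "x \<rightarrow>\<^sup>*\<^bsub>D\<^esub> y" if "(x, y) \<in> engel_rel\<^sup>*" "x \<in> verts D" for x y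
    using that
  proof (induction rule: rtrancl_induct)
    case base
    then show ?case by (simp add: reachable_def)
  next
    case (step y z)
    then have "z \<in> verts D" by (auto simp: verts engel_rel_def)
    then show ?case
      using step arcs unfolding reachable_def by (blast intro: rtrancl_on_into_rtrancl_on)
  qed
  obtain x y where "x \<in> verts D" "y \<in> verts D" "\<not> x \<rightarrow>\<^sup>*\<^bsub>D\<^esub> y"
    using assms(4) unfolding strongly_connected_or_empty_def strongly_connected_def D_def by blast
  then show ?thesis using almost_simple_or_frobenius[of x y] reach verts by blast
qed

end
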